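(* For every integer $n\ge 1$ there exists a piecewise linear function $F$ on $n+1$ intervals, having exactly $n$ jump points and no fold points, such that the system $$\dot x=F(x)-y,\qquad \dot y=x$$ has at least $2n$ limit cycles, where limit cycles may be of crossing, sliding, grazing or composite type. (That is, $2n$ is a lower bound for the maximum number of limit cycles of such systems.)
   Context: A piecewise linear function on $n+1$ intervals is a function of the form $$F(x)=ax+b+\sum_{i=1}^n a_i|x-x_i|+\sum_{i=1}^n b_i\,\mathrm{sgn}(x-x_i),$$ with real $a,b,a_i,b_i,x_i$, $(a_i^2+b_i^2)x_i\ne0$ for all $i$, and $x_1<\dots<x_n$. The point $(x_i,F(x_i))$ is a jump point if $F(x_i^-)\ne F(x_i^+)$ (equivalently $b_i\ne0$), and a fold point if $F$ is continuous at $x_i$ but its left and right derivatives there differ (equivalently $b_i=0$, $a_i\neq0$). Orbits are understood in the sense of Filippov, with switching lines $L_i=\{x=x_i\}$. At a fold point the crossing set is $L_i^c=\{(x,y)\in L_i:y\ne F(x_i)\}$. At a jump point the crossing set is $L_i^c=\{(x,y)\in L_i:\ y<\min\{F(x_i^-),F(x_i^+)\}\text{ or }y>\max\{F(x_i^-),F(x_i^+)\}\}$ and the sliding set is $L_i^s=\{(x,y)\in L_i:\ \min\{F(x_i^-),F(x_i^+)\}<y<\max\{F(x_i^-),F(x_i^+)\}\}$. (The sliding set includes both attracting and repelling sliding.) Orbits may move along $L_i^s$ with $\dot y=x_i$, so the orientation along a sliding segment is determined by $\mathrm{sgn}(x_i)$. Limit cycles are of the following types. (a) A periodic orbit is a crossing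 limit cycle if it crosses the switching line transversally and a suitable neighborhood of it has no other periodic orbits. (b) A periodic orbit $\Gamma$ is a sliding limit cycle if it contains nonempty open segments $\Gamma_s$ in the sliding set and $\Gamma\setminus\Gamma_s$ has a neighborhood which does not contain orbit arcs outside the sliding set of any other sliding periodic orbit. (c) A periodic orbit is a grazing limit cycle if it is tangent to the switching line at some point and it has a neighborhood which does not contain orbit arcs outside the sliding set of any other periodic orbit. (d) A periodic orbit is a composite limit cycle if at least two of the behaviors crossing, grazing, sliding occur simultaneously on it and it has a neighborhood which does not contain orbit arcs outside the sliding set of any other periodic orbit. *)

theory Defs
  imports "HOL-Analysis.Analysis"
begin

definition piecewise_linear :: "nat \<Rightarrow> (real \<Rightarrow> real) \<Rightarrow> bool" where
  "piecewise_linear n F \<longleftrightarrow>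
    (\<exists>a b \<alpha> \<beta> \<xi>.
      (\<forall>i\<in>{1..n}. ((\<alpha> i)\<^sup>2 + (\<beta> i)\<^sup>2) * \<xi> i \<noteq> 0) \<and> strict_mono_on {1..n} \<xi> \<and>
      F = (\<lambda>x::real. a * x + b + (\<Sum>i=1..n. \<alpha> i * \<bar>x - \<xi> i\<bar>) + (\<Sum>i=1..n. \<beta> i * sgn (x - \<xi> i))))"

definition jump_at :: "(real \<Rightarrow> real) \<Rightarrow> real \<Rightarrow> bool" where
  "jump_at F x \<longleftrightarrow> (\<exists>l r. (F \<longlongrightarrow> l) (at_left x) \<and> (F \<longlongrightarrow> r) (at_right x) \<and> l \<noteq> r)"

definition fold_at :: "(real \<Rightarrow> real) \<Rightarrow> real \<Rightarrow> bool" where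
  "fold_at F x \<longleftrightarrow> isCont F x \<and>
    (\<exists>l r. (F has_real_derivative l) (at_left x) \<and> (F has_real_derivative r) (at_right x) \<and> l \<noteq> r)"

definition jump_points :: "(real \<Rightarrow> real) \<Rightarrow> (real \<times> real) set" where
  "jump_points F = {(x, F x) | x. jump_at F x}"

definition fold_points :: "(real \<Rightarrow> real) \<Rightarrow> (real \<times> real) set" where
  "fold_points F = {(x, F x) | x. fold_at F x}"

definition left_lim :: "(real \<Rightarrow> real) \<Rightarrow> real \<Rightarrow> real" where
  "left_lim F x = Lim (at_left x) F"

definition right_lim :: "(real \<Rightarrow> real) \<Rightarrow> real \<Rightarrow> real" where
  "right_lim F x = Lim (at_right x) F"

definition switching_lines :: "(real \<Rightarrow> real) \<Rightarrow> (real \<times> real) set" where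
  "switching_lines F = {(x, y). jump_at F x \<or> fold_at F x}"

definition crossing_set :: "(real \<Rightarrow> real) \<Rightarrow> (real \<times> real) set" where
  "crossing_set F =
    {(x, y). fold_at F x \<and> y \<noteq> F x \<or>
             jump_at F x \<and> (y < min (left_lim F x) (right_lim F x) \<or>
                            y > max (left_lim F x) (right_lim F x))}"

definition sliding_set :: "(real \<Rightarrow> real) \<Rightarrow> (real \<times> real) set" where
  "sliding_set F =
    {(x, y). jump_at F x \<and> min (left_lim F x) (right_lim F x) < y \<and>
                           y < max (left_lim F x) (right_lim F x)}"

definition lienard_field :: "(real \<Rightarrow> real) \<Rightarrow> real \<times> real \<Rightarrow> real \<times> real" where
  "lienard_field F = (\<lambda>(x, y). (F x - y, x))"

text \<open>
  Filippov's convexification. The field is continuous off finitely many vertical lines, so its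
  Filippov set at a point is the segment between the limits of the field from the left and from
  the right; where \<open>F\<close> is continuous this segment is the single vector \<open>lienard_field F p\<close>. On the
  sliding set, the only vector of the segment tangent to the line \<open>x = x\<^sub>i\<close> is \<open>(0, x\<^sub>i)\<close>.
\<close>
definition filippov_set :: "(real \<Rightarrow> real) \<Rightarrow> real \<times> real \<Rightarrow> (real \<times> real) set" where
  "filippov_set F = (\<lambda>(x, y).
     closed_segment (Lim (at_left x) (\<lambda>u. lienard_field F (u, y)))
                    (Lim (at_right x) (\<lambda>u. lienard_field F (u, y))))"

lemma filippov_set_eq:
  assumes "(F \<longlongrightarrow> l) (at_left x)" "(F \<longlongrightarrow> r) (at_right x)"
  shows "filippov_set F (x, y) = closed_segment (l - y, x) (r - y, x)"
proof -
  have "((\<lambda>u. lienard_field F (u, y)) \<longlongrightarrow> (l - y, x)) (at_left x)"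
    "((\<lambda>u. lienard_field F (u, y)) \<longlongrightarrow> (r - y, x)) (at_right x)"
    unfolding lienard_field_def by (auto intro!: tendsto_intros assms)
  then show ?thesis
    unfolding filippov_set_def by (simp add: tendsto_Lim)
qed

lemma filippov_set_sliding:
  assumes "(x, y) \<in> sliding_set F"
  shows "(u, w) \<in> filippov_set F (x, y) \<and> u = 0 \<longleftrightarrow> (u, w) = (0, x)"
proof -
  obtain l r where lr: "(F \<longlongrightarrow> l) (at_left x)" "(F \<longlongrightarrow> r) (at_right x)"
    using assms by (auto simp: sliding_set_def jump_at_def)
  then have y: "min l r < y" "y < max l r"
    using assms by (auto simp: sliding_set_def left_lim_def right_lim_def tendsto_Lim)
  define t where "t = (l - y) / (l - r)"
  have "l \<noteq> r"
    using y by auto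
  then have "t * (l - r) = l - y"
    by (simp add: t_def)
  then have t0: "(1 - t) * (l - y) + t * (r - y) = 0"
    by (simp add: algebra_simps)
  have t: "0 \<le> t" "t \<le> 1"
    using y by (auto simp: t_def divide_simps min_def max_def split: if_splits)
  have 1: "(0, x) \<in> closed_segment (l - y, x) (r - y, x)"
    unfolding closed_segment_def using t t0
    by (auto intro!: exI[of _ t] simp: algebra_simps)
  have 2: "w = x" if "(u, w) \<in> closed_segment (l - y, x) (r - y, x)"
    using that by (auto simp: closed_segment_def algebra_simps)
  show ?thesis
    using 1 2 by (auto simp: filippov_set_eq[OF lr])
qed

text \<open>
  Being an integral of a selection of the Filippov set along \<open>\<gamma>\<close> is the same as being locally
  absolutely continuous with \<open>\<gamma>' t \<in> filippov_set F (\<gamma> t)\<close> for almost every \<open>t\<close>: such a selection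
  is locally bounded, and it may be changed on a null set.
\<close>
definition filippov_solution :: "(real \<Rightarrow> real) \<Rightarrow> (real \<Rightarrow> real \<times> real) \<Rightarrow> bool" where
  "filippov_solution F \<gamma> \<longleftrightarrow>
    (\<exists>v. (\<forall>t. v t \<in> filippov_set F (\<gamma> t)) \<and>
         (\<forall>s t. s \<le> t \<longrightarrow> (v has_integral (\<gamma> t - \<gamma> s)) {s..t}))"

definition periodic_solution :: "(real \<Rightarrow> real) \<Rightarrow> (real \<Rightarrow> real \<times> real) \<Rightarrow> bool" where
  "periodic_solution F \<gamma> \<longleftrightarrow>
    filippov_solution F \<gamma> \<and> (\<exists>T>0. \<forall>t. \<gamma> (t + T) = \<gamma> t) \<and> (\<exists>t. \<gamma> t \<noteq> \<gamma> 0)"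

definition periodic_orbit :: "(real \<Rightarrow> real) \<Rightarrow> (real \<times> real) set \<Rightarrow> bool" where
  "periodic_orbit F \<Gamma> \<longleftrightarrow> (\<exists>\<gamma>. periodic_solution F \<gamma> \<and> \<Gamma> = range \<gamma>)"

definition orbit_arc :: "(real \<Rightarrow> real) \<Rightarrow> (real \<times> real) set \<Rightarrow> (real \<times> real) set \<Rightarrow> bool" where
  "orbit_arc F \<Gamma> A \<longleftrightarrow>
    (\<exists>\<gamma> s t. periodic_solution F \<gamma> \<and> \<Gamma> = range \<gamma> \<and> s < t \<and> A = \<gamma> ` {s..t})"

text \<open>
  The union of the open vertical segments of \<open>\<Gamma>\<close> inside the sliding set. An orbit may enter the
  sliding set at one of its points, and such an entry point is not included.
\<close>
definition sliding_part :: "(real \<Rightarrow> real) \<Rightarrow> (real \<times> real) set \<Rightarrow> (real \<times> real) set" where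
  "sliding_part F \<Gamma> = \<Union>{{x} \<times> {c<..<d} | x c d. {x} \<times> {c<..<d} \<subseteq> \<Gamma> \<inter> sliding_set F}"

definition slides :: "(real \<Rightarrow> real) \<Rightarrow> (real \<times> real) set \<Rightarrow> bool" where
  "slides F \<Gamma> \<longleftrightarrow> sliding_part F \<Gamma> \<noteq> {}"

definition crosses :: "(real \<Rightarrow> real) \<Rightarrow> (real \<times> real) set \<Rightarrow> bool" where
  "crosses F \<Gamma> \<longleftrightarrow> \<Gamma> \<inter> crossing_set F \<noteq> {}"

text \<open>
  Tangential contact with a switching line. The line is met at an isolated time, so that neither
  motion along a sliding segment nor its exit through an end of the segment counts as grazing.
\<close>
definition grazes :: "(real \<Rightarrow> real) \<Rightarrow> (real \<times> real) set \<Rightarrow> bool" where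
  "grazes F \<Gamma> \<longleftrightarrow>
    (\<exists>\<gamma> t. periodic_solution F \<gamma> \<and> \<Gamma> = range \<gamma> \<and> \<gamma> t \<in> switching_lines F \<and>
       ((\<lambda>s. fst (\<gamma> s)) has_real_derivative 0) (at t) \<and>
       (\<forall>\<^sub>F s in at t. fst (\<gamma> s) \<noteq> fst (\<gamma> t)))"

text \<open>
  No other periodic orbit has an arc, however short, that lies in \<open>U\<close> and outside the sliding set.
\<close>
definition arc_isolated_in :: "(real \<Rightarrow> real) \<Rightarrow> (real \<times> real) set \<Rightarrow> (real \<times> real) set \<Rightarrow> bool" where
  "arc_isolated_in F \<Gamma> U \<longleftrightarrow>
    (\<forall>\<Gamma>' A. periodic_orbit F \<Gamma>' \<and> \<Gamma>' \<noteq> \<Gamma> \<and> orbit_arc F \<Gamma>' A \<longrightarrow> \<not> A \<subseteq> U - sliding_set F)"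

definition crossing_limit_cycle :: "(real \<Rightarrow> real) \<Rightarrow> (real \<times> real) set \<Rightarrow> bool" where
  "crossing_limit_cycle F \<Gamma> \<longleftrightarrow>
    periodic_orbit F \<Gamma> \<and>
    \<Gamma> \<inter> switching_lines F \<noteq> {} \<and> \<Gamma> \<inter> switching_lines F \<subseteq> crossing_set F \<and>
    (\<exists>U. open U \<and> \<Gamma> \<subseteq> U \<and> (\<forall>\<Gamma>'. periodic_orbit F \<Gamma>' \<and> \<Gamma>' \<noteq> \<Gamma> \<longrightarrow> \<not> \<Gamma>' \<subseteq> U))"

definition sliding_limit_cycle :: "(real \<Rightarrow> real) \<Rightarrow> (real \<times> real) set \<Rightarrow> bool" where
  "sliding_limit_cycle F \<Gamma> \<longleftrightarrow>
    periodic_orbit F \<Gamma> \<and> slides F \<Gamma> \<and>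
    (\<exists>U. open U \<and> \<Gamma> - sliding_part F \<Gamma> \<subseteq> U \<and>
      (\<forall>\<Gamma>' A. periodic_orbit F \<Gamma>' \<and> slides F \<Gamma>' \<and> \<Gamma>' \<noteq> \<Gamma> \<and> orbit_arc F \<Gamma>' A \<longrightarrow>
        \<not> A \<subseteq> U - sliding_set F))"

definition grazing_limit_cycle :: "(real \<Rightarrow> real) \<Rightarrow> (real \<times> real) set \<Rightarrow> bool" where
  "grazing_limit_cycle F \<Gamma> \<longleftrightarrow>
    periodic_orbit F \<Gamma> \<and> grazes F \<Gamma> \<and> (\<exists>U. open U \<and> \<Gamma> \<subseteq> U \<and> arc_isolated_in F \<Gamma> U)"

definition composite_limit_cycle :: "(real \<Rightarrow> real) \<Rightarrow> (real \<times> real) set \<Rightarrow> bool" where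
  "composite_limit_cycle F \<Gamma> \<longleftrightarrow>
    periodic_orbit F \<Gamma> \<and>
    (crosses F \<Gamma> \<and> grazes F \<Gamma> \<or> crosses F \<Gamma> \<and> slides F \<Gamma> \<or> grazes F \<Gamma> \<and> slides F \<Gamma>) \<and>
    (\<exists>U. open U \<and> \<Gamma> \<subseteq> U \<and> arc_isolated_in F \<Gamma> U)"

definition limit_cycle :: "(real \<Rightarrow> real) \<Rightarrow> (real \<times> real) set \<Rightarrow> bool" where
  "limit_cycle F \<Gamma> \<longleftrightarrow>
    crossing_limit_cycle F \<Gamma> \<or> sliding_limit_cycle F \<Gamma> \<or>
    grazing_limit_cycle F \<Gamma> \<or> composite_limit_cycle F \<Gamma>"

end

theory Submission
  imports Defs
begin

text \<open>
  Take \<open>F x = 6/5 x\<close> for \<open>x < 1\<close> and \<open>F\<close> piecewise constant for \<open>x > 1\<close>, with downward jumps at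
  \<open>1 = \<xi>\<^sub>1 < \<dots> < \<xi>\<^sub>n\<close>: orbits are expanding spirals left of \<open>1\<close> and circular arcs in the other zones.
  Since all jumps go down, the inclusion is one-sided Lipschitz and hence forward unique.

  The jumps are chosen one after the other. An orbit through the line of the next jump at \<open>X\<close> is
  described, in terms of the total rotation \<open>\<theta>\<close> in the spiral zone, by its depth \<open>D \<theta>\<close> below and its
  height \<open>H \<theta>\<close> above \<open>F X\<close> on that line; both tend to infinity with the amplitude, and so does
  \<open>D - H\<close>, because the spirals expand. A jump of size \<open>\<Delta>\<close> closes the orbits with \<open>D \<theta> - H \<theta> = 2 \<Delta>\<close>
  to crossing cycles, and one with \<open>D - H\<close> strictly monotone at \<open>\<theta>\<close> is isolated. The orbit tangent
  to the line, \<open>H \<theta> = 0\<close>, becomes a sliding cycle as soon as \<open>D \<theta> < \<Delta>\<close>. So each jump contributes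
  two limit cycles, and it does not affect the previous ones, which stay to the left of \<open>X\<close>.
\<close>

subsection \<open>Trajectories of differential inclusions\<close>

text \<open>The slope \<open>6/5\<close> gives the spiral zone the eigenvalues
  \<open>3/5 + 4/5 i\<close> and \<open>3/5 - 4/5 i\<close>, which keeps its formulas rational. The
  main obstacle is that every jump wraps depth and height in another square root, so no explicit
  control of \<open>D\<close> and \<open>H\<close> survives the induction. Only qualitative facts
  are carried along: differentiability, strict monotonicity of \<open>H\<close>, and divergence of
  \<open>H\<close> and \<open>D - H\<close>. Divergence alone yields, by the mean value theorem,
  arbitrarily large values of \<open>D - H\<close> attained with negative derivative; the jump size
  is read off there instead of being prescribed. Isolation has to exclude arbitrary periodic orbits,
  not only members of the family. They are caught on the ray above \<open>(1, 6/5)\<close>, which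
  every periodic orbit hits. Orbits merge on sliding segments, so backward uniqueness fails there;
  forward uniqueness suffices, because on a periodic orbit every point is reached forward from every
  other one. Sliding cycles are isolated by finiteness: all periodic orbits sliding on one line
  share the upper end of its sliding segment.\<close>

definition traj :: "('a::euclidean_space \<Rightarrow> 'a set) \<Rightarrow> (real \<Rightarrow> 'a) \<Rightarrow> real \<Rightarrow> real \<Rightarrow> bool" where
  "traj G \<gamma> a b \<longleftrightarrow> (\<exists>v. (\<forall>t\<in>{a..b}. v t \<in> G (\<gamma> t)) \<and>
     (\<forall>s t. a \<le> s \<longrightarrow> s \<le> t \<longrightarrow> t \<le> b \<longrightarrow> (v has_integral (\<gamma> t - \<gamma> s)) {s..t}))"

text \<open>The set \<open>S\<close> is carried along because closed orbits are assembled from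
  several arcs, and where each arc stays decides afterwards whether the orbit avoids the sliding
  segments and where it hits the section.\<close>

definition reach :: "('a::euclidean_space \<Rightarrow> 'a set) \<Rightarrow> 'a set \<Rightarrow> 'a \<Rightarrow> 'a \<Rightarrow> bool" where
  "reach G S p q \<longleftrightarrow> (\<exists>\<gamma> a b. a \<le> b \<and> traj G \<gamma> a b \<and> \<gamma> a = p \<and> \<gamma> b = q \<and> \<gamma> ` {a..b} \<subseteq> S)"

lemma trajE:
  assumes "traj G \<gamma> a b"
  obtains v where "\<And>t. t \<in> {a..b} \<Longrightarrow> v t \<in> G (\<gamma> t)"
    "\<And>s t. a \<le> s \<Longrightarrow> s \<le> t \<Longrightarrow> t \<le> b \<Longrightarrow> (v has_integral (\<gamma> t - \<gamma> s)) {s..t}"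
  using assms unfolding traj_def by metis

lemma trajI:
  assumes "\<And>t. t \<in> {a..b} \<Longrightarrow> v t \<in> G (\<gamma> t)"
    "\<And>s t. a \<le> s \<Longrightarrow> s \<le> t \<Longrightarrow> t \<le> b \<Longrightarrow> (v has_integral (\<gamma> t - \<gamma> s)) {s..t}"
  shows "traj G \<gamma> a b"
  unfolding traj_def using assms by blast

lemma traj_shift:
  assumes "traj G \<gamma> a b"
  shows "traj G (\<lambda>t. \<gamma> (t - c)) (a + c) (b + c)"
proof -
  obtain v where v: "\<forall>t\<in>{a..b}. v t \<in> G (\<gamma> t)"
    "\<And>s t. a \<le> s \<Longrightarrow> s \<le> t \<Longrightarrow> t \<le> b \<Longrightarrow> (v has_integral (\<gamma> t - \<gamma> s)) {s..t}"
    using assms by (auto simp: traj_def)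
  have "((\<lambda>r. v (r - c)) has_integral (\<gamma> (t - c) - \<gamma> (s - c))) {s..t}"
    if "a + c \<le> s" "s \<le> t" "t \<le> b + c" for s t
    using has_integral_affinity[of v "\<gamma> (t - c) - \<gamma> (s - c)" "s - c" "t - c" 1 "- c"]
      v(2)[of "s - c" "t - c"] that by simp
  then show ?thesis
    unfolding traj_def using v(1) by (intro exI[of _ "\<lambda>t. v (t - c)"]) auto
qed

lemma traj_continuous:
  assumes "traj G \<gamma> a b"
  shows "continuous_on {a..b} \<gamma>"
proof (cases "a \<le> b")
  case True
  obtain v where v: "\<And>s t. a \<le> s \<Longrightarrow> s \<le> t \<Longrightarrow> t \<le> b \<Longrightarrow> (v has_integral (\<gamma> t - \<gamma> s)) {s..t}"
    using assms by (auto simp: traj_def)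
  have eq: "\<gamma> t = \<gamma> a + integral {a..t} v" if "t \<in> {a..b}" for t
    using v[of a t] that by (auto simp: integral_unique)
  have "v integrable_on {a..b}"
    using v[of a b] True by blast
  then have "continuous_on {a..b} (\<lambda>t. \<gamma> a + integral {a..t} v)"
    by (intro continuous_intros indefinite_integral_continuous_1)
  moreover have "continuous_on {a..b} \<gamma> \<longleftrightarrow> continuous_on {a..b} (\<lambda>t. \<gamma> a + integral {a..t} v)"
    by (rule continuous_on_cong[OF refl]) (rule eq)
  ultimately show ?thesis
    by simp
qed auto

lemma le_by_quadratic_increments:
  fixes g :: "real \<Rightarrow> real"
  assumes T: "0 \<le> T" and C: "0 \<le> C"
    and g: "\<And>s t. 0 \<le> s \<Longrightarrow> s \<le> t \<Longrightarrow> t \<le> T \<Longrightarrow> g t \<le> g s + C * (t - s)\<^sup>2"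
  shows "g T \<le> g 0"
proof -
  have *: "g T \<le> g 0 + C * T\<^sup>2 * inverse (real (Suc n))" for n
  proof -
    define h where "h = T / real (Suc n)"
    have h: "0 \<le> h" "real (Suc n) * h = T"
      using T by (auto simp: h_def)
    have "k \<le> Suc n \<Longrightarrow> g (real k * h) \<le> g 0 + real k * (C * h\<^sup>2)" for k
    proof (induction k)
      case (Suc k)
      have "real (Suc k) * h \<le> T"
        using h Suc.prems by (metis mult_right_mono of_nat_le_iff)
      then have "g (real (Suc k) * h) \<le> g (real k * h) + C * (real (Suc k) * h - real k * h)\<^sup>2"
        using h by (intro g) (auto intro: mult_right_mono)
      also have "real (Suc k) * h - real k * h = h"
        by (simp add: algebra_simps)
      finally show ?case
        using Suc by (auto simp: algebra_simps)
    qed simp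
    from this[of "Suc n"] have "g T \<le> g 0 + real (Suc n) * (C * h\<^sup>2)"
      using h by simp
    also have "real (Suc n) * (C * h\<^sup>2) = C * T\<^sup>2 * inverse (real (Suc n))"
      unfolding h_def power_divide by (simp add: divide_inverse power2_eq_square)
    finally show ?thesis .
  qed
  have "(\<lambda>n. g 0 + C * T\<^sup>2 * inverse (real (Suc n))) \<longlonglongrightarrow> g 0 + C * T\<^sup>2 * 0"
    by (intro tendsto_intros LIMSEQ_inverse_real_of_nat)
  then show ?thesis
    using * by (intro LIMSEQ_le_const) auto
qed

text \<open>The inner product bound is directed in time: it limits the growth of distances forward
  but says nothing backward, as suits attracting sliding, where orbits merge. \<open>bdd\<close>
  turns compactness of a trajectory into a bound on its velocities.\<close>

locale one_sided_lipschitz =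
  fixes G :: "'a::euclidean_space \<Rightarrow> 'a set" and K :: real
  assumes osl: "u \<in> G p \<Longrightarrow> w \<in> G q \<Longrightarrow> (u - w) \<bullet> (p - q) \<le> K * (norm (p - q))\<^sup>2"
    and bdd: "bounded P \<Longrightarrow> bounded (\<Union>p\<in>P. G p)"
    and nonempty: "G p \<noteq> {}"
    and K_nonneg: "0 \<le> K"
begin

text \<open>
  Solutions need not be differentiable at any given time, so Gronwall's argument is run on increments:
  the weighted squared distance decreases up to an error quadratic in the length of the time step.
\<close>
lemma traj_unique:
  assumes \<gamma>: "traj G \<gamma> 0 T" and \<delta>: "traj G \<delta> 0 T" and "\<gamma> 0 = \<delta> 0" and T: "0 \<le> T"
  shows "\<gamma> T = \<delta> T"
proof -
  obtain v where v: "\<And>t. t \<in> {0..T} \<Longrightarrow> v t \<in> G (\<gamma> t)"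
    "\<And>s t. 0 \<le> s \<Longrightarrow> s \<le> t \<Longrightarrow> t \<le> T \<Longrightarrow> (v has_integral (\<gamma> t - \<gamma> s)) {s..t}"
    using trajE[OF \<gamma>] by metis
  obtain w where w: "\<And>t. t \<in> {0..T} \<Longrightarrow> w t \<in> G (\<delta> t)"
    "\<And>s t. 0 \<le> s \<Longrightarrow> s \<le> t \<Longrightarrow> t \<le> T \<Longrightarrow> (w has_integral (\<delta> t - \<delta> s)) {s..t}"
    using trajE[OF \<delta>] by metis
  define e where "e = (\<lambda>t. \<gamma> t - \<delta> t)"
  define z where "z = (\<lambda>t. v t - w t)"
  have z: "(z has_integral (e t - e s)) {s..t}" if "0 \<le> s" "s \<le> t" "t \<le> T" for s t
    using has_integral_diff[OF v(2)[OF that] w(2)[OF that]]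
    by (simp add: z_def e_def algebra_simps)
  have "compact (\<gamma> ` {0..T})" "compact (\<delta> ` {0..T})"
    using traj_continuous[OF \<gamma>] traj_continuous[OF \<delta>] by (auto intro!: compact_continuous_image)
  then have "bounded (\<gamma> ` {0..T} \<union> \<delta> ` {0..T})"
    by (simp add: compact_imp_bounded)
  then have "bounded (\<Union>p\<in>\<gamma> ` {0..T} \<union> \<delta> ` {0..T}. G p)" 
    by (rule bdd)
  then obtain M0 where M0: "\<And>u. u \<in> (\<Union>p\<in>\<gamma> ` {0..T} \<union> \<delta> ` {0..T}. G p) \<Longrightarrow> norm u \<le> M0"
    by (meson bounded_iff)
  define M where "M = max 0 (2 * M0)"
  have M: "norm (z t) \<le> M" if "t \<in> {0..T}" for t
  proof -
    have "norm (v t) \<le> M0" "norm (w t) \<le> M0"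
      using v(1)[OF that] w(1)[OF that] that by (blast intro: M0)+
    then show ?thesis
      using norm_triangle_ineq4[of "v t" "w t"] by (auto simp: z_def M_def)
  qed
  have M_nonneg: "0 \<le> M"
    by (simp add: M_def)
  have lip: "norm (e t - e s) \<le> M * (t - s)" if "0 \<le> s" "s \<le> t" "t \<le> T" for s t
    using has_integral_bound[of M z "e t - e s" s t] M M_nonneg z[OF that] that
    by auto
  define B where "B = M * T"
  have e0: "e 0 = 0"
    by (simp add: e_def assms)
  have B: "norm (e t) \<le> B" if "t \<in> {0..T}" for t
    using lip[of 0 t] that e0 M_nonneg mult_left_mono[of t T M] by (auto simp: B_def)
  have B_nonneg: "0 \<le> B"
    by (simp add: B_def M_nonneg T)
  define f where "f = (\<lambda>t. (norm (e t))\<^sup>2)"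
  define C where "C = 2 * K * (2 * B * M) + 2 * M\<^sup>2"
  have f_diff: "f t - f s = (e t - e s) \<bullet> (e t + e s)" for s t
    by (simp add: f_def power2_norm_eq_inner algebra_simps inner_commute)
  have f_step: "f t - f s \<le> (2 * K * f s + C * (t - s)) * (t - s)"
    if st: "0 \<le> s" "s \<le> t" "t \<le> T" for s t
  proof -
    have int: "((\<lambda>r. z r \<bullet> (e t + e s)) has_integral (f t - f s)) {s..t}"
      unfolding f_diff using has_integral_linear[OF z[OF st] bounded_linear_inner_left] by (simp add: o_def)
    \<comment> \<open>The sum \<open>e t + e s\<close> differs from twice \<open>e r\<close> by at
      most \<open>M * (t - s)\<close>, so the one-sided bound at the single time \<open>r\<close>
      controls it with an error linear in the step; integration makes the error quadratic.\<close>
    have pw: "z r \<bullet> (e t + e s) \<le> 2 * K * f s + C * (t - s)" if r: "r \<in> {s..t}" for r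
    proof -
      have rT: "r \<in> {0..T}" using r st by auto
      have 1: "z r \<bullet> e r \<le> K * f r"
        unfolding z_def e_def f_def by (intro osl v w rT)
      have "norm (e t - e r) \<le> M * (t - r)" "norm (e r - e s) \<le> M * (r - s)"
        using r st by (auto intro: lip)
      moreover have "norm (e t - e r + (e s - e r)) \<le> norm (e t - e r) + norm (e r - e s)"
        by (metis norm_triangle_ineq norm_minus_commute)
      ultimately have "norm (e t - e r + (e s - e r)) \<le> M * (t - s)"
        by (simp add: algebra_simps)
      then have "norm (z r) * norm (e t - e r + (e s - e r)) \<le> M * (M * (t - s))"
        using M[OF rT] M_nonneg by (intro mult_mono) auto
      then have 2: "z r \<bullet> (e t - e r + (e s - e r)) \<le> M * (M * (t - s))"
        using norm_cauchy_schwarz order_trans by blast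
      have "f r - f s \<le> norm (e r - e s) * norm (e r + e s)"
        unfolding f_diff by (rule norm_cauchy_schwarz)
      also have "\<dots> \<le> (M * (t - s)) * (2 * B)"
      proof (intro mult_mono)
        show "norm (e r - e s) \<le> M * (t - s)"
          using lip[of s r] r st M_nonneg mult_left_mono[of "r - s" "t - s" M] by auto
        show "norm (e r + e s) \<le> 2 * B"
          using norm_triangle_ineq[of "e r" "e s"] B[of r] B[of s] rT st by auto
      qed (use M_nonneg st in auto)
      finally have "f r \<le> f s + 2 * B * M * (t - s)"
        by (simp add: algebra_simps)
      then have 3: "K * f r \<le> K * (f s + 2 * B * M * (t - s))"
        using K_nonneg by (rule mult_left_mono)
      have "z r \<bullet> (e t + e s) = 2 * (z r \<bullet> e r) + z r \<bullet> (e t - e r + (e s - e r))"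
        by (simp add: algebra_simps)
      also have "\<dots> \<le> 2 * (K * (f s + 2 * B * M * (t - s))) + M * (M * (t - s))"
        using 1 2 3 by linarith
      also have "\<dots> \<le> 2 * K * f s + C * (t - s)"
      proof -
        have "0 \<le> M * M * (t - s)"
          using st M_nonneg by auto
        then show ?thesis
          by (simp add: C_def algebra_simps power2_eq_square)
      qed
      finally show ?thesis .
    qed
    have "((\<lambda>r. 2 * K * f s + C * (t - s)) has_integral (t - s) * (2 * K * f s + C * (t - s))) {s..t}"
      using has_integral_const_real[of "2 * K * f s + C * (t - s)" s t] st by simp
    then have "f t - f s \<le> (t - s) * (2 * K * f s + C * (t - s))"
      by (rule has_integral_le[OF int]) (use pw in auto)
    then show ?thesis
      by (simp add: mult.commute)
  qed
  have C_nonneg: "0 \<le> C"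
    unfolding C_def using K_nonneg B_nonneg M_nonneg by auto
  define g where "g = (\<lambda>t. exp (- 2 * K * t) * f t)"
  have g_step: "g t \<le> g s + C * (t - s)\<^sup>2" if st: "0 \<le> s" "s \<le> t" "t \<le> T" for s t
  proof -
    have "f t \<le> (1 + 2 * K * (t - s)) * f s + C * (t - s)\<^sup>2"
      using f_step[OF st] by (simp add: algebra_simps power2_eq_square)
    also have "\<dots> \<le> exp (2 * K * (t - s)) * f s + C * (t - s)\<^sup>2"
      by (intro add_right_mono mult_right_mono exp_ge_add_one_self) (simp add: f_def)
    finally have "g t \<le> exp (- 2 * K * t) * (exp (2 * K * (t - s)) * f s + C * (t - s)\<^sup>2)"
      unfolding g_def by (intro mult_left_mono) auto
    also have "\<dots> = (exp (- 2 * K * t) * exp (2 * K * (t - s))) * f s + exp (- 2 * K * t) * (C * (t - s)\<^sup>2)"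
      by (simp add: algebra_simps)
    also have "exp (- 2 * K * t) * exp (2 * K * (t - s)) = exp (- 2 * K * s)"
      by (simp add: exp_add[symmetric] algebra_simps)
    also have "exp (- 2 * K * t) * (C * (t - s)\<^sup>2) \<le> 1 * (C * (t - s)\<^sup>2)"
      using C_nonneg K_nonneg st by (intro mult_right_mono) auto
    finally show ?thesis
      by (simp add: g_def)
  qed
  have "g T \<le> g 0"
    using le_by_quadratic_increments[OF T C_nonneg g_step] .
  then have "f T \<le> 0"
    using e0 by (simp add: g_def f_def mult_le_0_iff)
  then show ?thesis
    by (simp add: f_def e_def)
qed

end

section \<open>Concatenation of trajectories and reachability\<close>

lemma traj_join:
  assumes "traj G \<gamma> a b" "traj G \<delta> b c" "\<gamma> b = \<delta> b" "a \<le> b" "b \<le> c"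
  shows "traj G (\<lambda>t. if t \<le> b then \<gamma> t else \<delta> t) a c"
proof -
  obtain v where v: "\<And>t. t \<in> {a..b} \<Longrightarrow> v t \<in> G (\<gamma> t)"
    "\<And>s t. a \<le> s \<Longrightarrow> s \<le> t \<Longrightarrow> t \<le> b \<Longrightarrow> (v has_integral (\<gamma> t - \<gamma> s)) {s..t}"
    using trajE[OF assms(1)] by metis
  obtain w where w: "\<And>t. t \<in> {b..c} \<Longrightarrow> w t \<in> G (\<delta> t)"
    "\<And>s t. b \<le> s \<Longrightarrow> s \<le> t \<Longrightarrow> t \<le> c \<Longrightarrow> (w has_integral (\<delta> t - \<delta> s)) {s..t}"
    using trajE[OF assms(2)] by metis
  let ?z = "\<lambda>t. if t \<le> b then v t else w t"
  let ?\<eta> = "\<lambda>t. if t \<le> b then \<gamma> t else \<delta> t"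
  have 1: "(?z has_integral (?\<eta> t - ?\<eta> s)) {s..t}" if "a \<le> s" "s \<le> t" "t \<le> b" for s t
    using has_integral_eq[OF _ v(2)[OF that], of ?z] that by auto
  have 2: "(?z has_integral (?\<eta> t - ?\<eta> s)) {s..t}" if "b \<le> s" "s \<le> t" "t \<le> c" for s t
  proof -
    have "?\<eta> t - ?\<eta> s = \<delta> t - \<delta> s"
      using that assms(3) by (cases "t = b"; cases "s = b") auto
    then show ?thesis
      using has_integral_spike_finite[OF _ _ w(2)[OF that], of "{b}" ?z] that by auto
  qed
  have "(?z has_integral (?\<eta> t - ?\<eta> s)) {s..t}" if st: "a \<le> s" "s \<le> t" "t \<le> c" for s t
  proof (cases "t \<le> b \<or> b \<le> s")
    case True
    then show ?thesis using 1[of s t] 2[of s t] st by blast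
  next
    case False
    then have "(?z has_integral (?\<eta> b - ?\<eta> s) + (?\<eta> t - ?\<eta> b)) {s..t}"
      using st by (intro has_integral_combine[of s b t] 1 2) auto
    then show ?thesis by simp
  qed
  moreover have "\<forall>t\<in>{a..c}. ?z t \<in> G (?\<eta> t)"
    using v w by auto
  ultimately show ?thesis
    by (intro trajI[of _ _ ?z]) blast+
qed

lemma reach_append:
  assumes "reach G S p q" "reach G S q r"
  obtains \<gamma> a b c where "a \<le> b" "b \<le> c" "traj G \<gamma> a c" "\<gamma> a = p" "\<gamma> b = q" "\<gamma> c = r" "\<gamma> ` {a..c} \<subseteq> S"
proof -
  obtain \<gamma> a b where 1: "a \<le> b" "traj G \<gamma> a b" "\<gamma> a = p" "\<gamma> b = q" "\<gamma> ` {a..b} \<subseteq> S"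
    using assms by (auto simp: reach_def)
  obtain \<delta> c d where 2: "c \<le> d" "traj G \<delta> c d" "\<delta> c = q" "\<delta> d = r" "\<delta> ` {c..d} \<subseteq> S"
    using assms by (auto simp: reach_def)
  define \<eta> where "\<eta> = (\<lambda>t. \<delta> (t - (b - c)))"
  have "traj G \<eta> b (d + (b - c))"
    using traj_shift[OF 2(2), of "b - c"] by (simp add: \<eta>_def)
  then have "traj G (\<lambda>t. if t \<le> b then \<gamma> t else \<eta> t) a (d + (b - c))"
    using 1 2 by (intro traj_join) (auto simp: \<eta>_def)
  moreover have "(\<lambda>t. if t \<le> b then \<gamma> t else \<eta> t) ` {a..d + (b - c)} \<subseteq> S"
    using 1(5) 2(5) by (auto simp: \<eta>_def image_subset_iff)
  ultimately show ?thesis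
    using 1 2
    by (intro that[of a b "d + (b - c)" "\<lambda>t. if t \<le> b then \<gamma> t else \<eta> t"])
      (auto simp: \<eta>_def)
qed

lemma reach_trans:
  assumes "reach G S p q" "reach G S q r"
  shows "reach G S p r"
proof (rule reach_append[OF assms])
  fix \<gamma> a b c
  assume "a \<le> b" "b \<le> c" "traj G \<gamma> a c" "\<gamma> a = p" "\<gamma> c = r" "\<gamma> ` {a..c} \<subseteq> S"
  then show ?thesis
    unfolding reach_def by (intro exI[of _ \<gamma>] exI[of _ a] exI[of _ c]) auto
qed

lemma reach_mono:
  assumes "reach G S p q" "\<And>z. z \<in> S \<Longrightarrow> G z \<subseteq> G' z" "S \<subseteq> S'"
  shows "reach G' S' p q"
proof -
  obtain \<gamma> a b where 1: "a \<le> b" "traj G \<gamma> a b" "\<gamma> a = p" "\<gamma> b = q" "\<gamma> ` {a..b} \<subseteq> S"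
    using assms(1) by (auto simp: reach_def)
  have "traj G' \<gamma> a b"
  proof (rule trajE[OF 1(2)])
    fix v
    assume v: "\<And>t. t \<in> {a..b} \<Longrightarrow> v t \<in> G (\<gamma> t)"
      "\<And>s t. a \<le> s \<Longrightarrow> s \<le> t \<Longrightarrow> t \<le> b \<Longrightarrow> (v has_integral (\<gamma> t - \<gamma> s)) {s..t}"
    have "v t \<in> G' (\<gamma> t)" if "t \<in> {a..b}" for t
      using v(1)[OF that] assms(2)[of "\<gamma> t"] 1(5) that by blast
    then show ?thesis
      using v(2) by (rule trajI)
  qed
  then show ?thesis
    unfolding reach_def using 1 assms(3) by blast
qed

lemma reach_superset: "reach G S p q \<Longrightarrow> S \<subseteq> S' \<Longrightarrow> reach G S' p q"
  by (rule reach_mono) auto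

lemma reach_refl:
  assumes "p \<in> S" "G p \<noteq> {}"
  shows "reach G S p p"
proof -
  obtain u where "u \<in> G p" using assms by blast
  then have "traj G (\<lambda>_. p) 0 0"
    unfolding traj_def by (intro exI[of _ "\<lambda>_. u"]) (auto simp: has_integral_refl)
  then show ?thesis
    unfolding reach_def using assms by (intro exI[of _ "\<lambda>_. p"] exI[of _ 0]) auto
qed

text \<open>Arcs end on switching lines, where the velocity formula of the zone is not assumed to
  lie in \<open>G\<close>. At the two end times an arbitrary selection is used instead, which does
  not change the integrals.\<close>

lemma traj_of_derivative:
  assumes d: "\<And>t. t \<in> {a..b} \<Longrightarrow> (\<gamma> has_vector_derivative v t) (at t)"
    and v: "\<And>t. a < t \<Longrightarrow> t < b \<Longrightarrow> v t \<in> G (\<gamma> t)"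
    and ne: "\<And>z. G z \<noteq> {}"
  shows "traj G \<gamma> a b"
proof -
  let ?v = "\<lambda>t. if a < t \<and> t < b then v t else SOME u. u \<in> G (\<gamma> t)"
  have "?v t \<in> G (\<gamma> t)" for t
    using v[of t] some_in_eq[of "G (\<gamma> t)"] ne[of "\<gamma> t"] by simp
  moreover have "(?v has_integral (\<gamma> t - \<gamma> s)) {s..t}" if "a \<le> s" "s \<le> t" "t \<le> b" for s t
  proof -
    have "(v has_integral (\<gamma> t - \<gamma> s)) {s..t}"
      using that d by (intro fundamental_theorem_of_calculus)
        (auto intro: has_vector_derivative_at_within)
    from has_integral_spike_finite[OF _ _ this, of "{a, b}" ?v] show ?thesis
      using that by auto
  qed
  ultimately show "traj G \<gamma> a b"
    by (intro trajI[of _ _ ?v]) blast+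
qed

lemma reach_of_derivative:
  assumes "a \<le> b"
    and "\<And>t. t \<in> {a..b} \<Longrightarrow> (\<gamma> has_vector_derivative v t) (at t)"
    and "\<And>t. a < t \<Longrightarrow> t < b \<Longrightarrow> v t \<in> G (\<gamma> t)"
    and "\<And>z. G z \<noteq> {}" "\<gamma> ` {a..b} \<subseteq> S" "\<gamma> a = p" "\<gamma> b = q"
  shows "reach G S p q"
  unfolding reach_def using traj_of_derivative[OF assms(2-4)] assms(1,5-7) by blast

subsection \<open>Periodic orbits\<close>

lemma filippov_solution_traj:
  assumes "filippov_solution F \<gamma>"
  shows "traj (filippov_set F) \<gamma> a b"
  using assms unfolding filippov_solution_def traj_def by blast

text \<open>Time is reduced modulo \<open>T\<close>. Closedness makes both readings of a multiple of
  \<open>T\<close> agree, so each window of length \<open>T\<close> is a shifted copy of the arc, up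
  to the velocity at its right end. Windows are chained by induction from an integer index, so that
  negative times are covered.\<close>

lemma filippov_solution_periodic_extension:
  assumes tr: "traj (filippov_set F) \<gamma> 0 T" and T: "0 < T" and closed: "\<gamma> T = \<gamma> 0"
  defines "\<eta> \<equiv> \<lambda>t. \<gamma> (t - T * of_int \<lfloor>t / T\<rfloor>)"
  shows "filippov_solution F \<eta>" "\<eta> (t + T) = \<eta> t" "range \<eta> = \<gamma> ` {0..T}"
    "0 \<le> t \<Longrightarrow> t \<le> T \<Longrightarrow> \<eta> t = \<gamma> t"
proof -
  define r where "r = (\<lambda>t. t - T * of_int \<lfloor>t / T\<rfloor>)"
  have r: "0 \<le> r t" "r t < T" for t
  proof -
    have "of_int \<lfloor>t / T\<rfloor> \<le> t / T" "t / T < of_int \<lfloor>t / T\<rfloor> + 1"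
      by linarith+
    then have "of_int \<lfloor>t / T\<rfloor> * T \<le> t" "t < (of_int \<lfloor>t / T\<rfloor> + 1) * T"
      using T pos_le_divide_eq pos_divide_less_eq by blast+
    then show "0 \<le> r t" "r t < T"
      by (auto simp: r_def algebra_simps)
  qed
  have r_eq: "r t = t - T * of_int m" if "T * of_int m \<le> t" "t < T * of_int m + T" for t m
  proof -
    have "\<lfloor>t / T\<rfloor> = m"
      using that T by (intro floor_unique) (auto simp: field_simps)
    then show ?thesis
      by (simp add: r_def)
  qed
  have \<eta>: "\<eta> t = \<gamma> (r t)" for t
    by (simp add: \<eta>_def r_def)
  have \<eta>_eq: "\<eta> t = \<gamma> (t - T * of_int m)" if "T * of_int m \<le> t" "t \<le> T * of_int m + T" for t m
  proof (cases "t = T * of_int m + T")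
    case True
    have "r t = t - T * of_int (m + 1)"
      using True T by (intro r_eq) (auto simp: algebra_simps)
    then show ?thesis
      using True closed by (simp add: \<eta> algebra_simps)
  qed (use that r_eq[of m t] in \<open>auto simp: \<eta>\<close>)
  show "0 \<le> t \<Longrightarrow> t \<le> T \<Longrightarrow> \<eta> t = \<gamma> t"
    using \<eta>_eq[of 0 t] by simp
  have "r (t + T) = r t"
    using T by (simp add: r_def add_divide_distrib algebra_simps)
  then show "\<eta> (t + T) = \<eta> t"
    by (simp add: \<eta>)
  have "\<gamma> s \<in> range \<eta>" if "s \<in> {0..T}" for s
    using \<eta>_eq[of 0 s] that by (intro range_eqI[of _ _ s]) simp
  moreover have "\<eta> t \<in> \<gamma> ` {0..T}" for t
    unfolding \<eta> using r[of t] by (intro imageI) auto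
  ultimately show "range \<eta> = \<gamma> ` {0..T}"
    by blast
  obtain v where v: "\<And>t. t \<in> {0..T} \<Longrightarrow> v t \<in> filippov_set F (\<gamma> t)"
    "\<And>s t. 0 \<le> s \<Longrightarrow> s \<le> t \<Longrightarrow> t \<le> T \<Longrightarrow> (v has_integral (\<gamma> t - \<gamma> s)) {s..t}"
    using trajE[OF tr] by metis
  define w where "w = (\<lambda>t. v (r t))"
  have w: "w t \<in> filippov_set F (\<eta> t)" for t
    using v(1)[of "r t"] r[of t] by (simp add: w_def \<eta>)
  have window: "(w has_integral (\<eta> t - \<eta> s)) {s..t}"
    if st: "T * of_int m \<le> s" "s \<le> t" "t \<le> T * of_int m + T" for s t m
  proof -
    let ?c = "T * of_int m"
    have "((\<lambda>x. v (x - ?c)) has_integral (\<eta> t - \<eta> s)) {s..t}"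
      using has_integral_affinity[of v "\<gamma> (t - ?c) - \<gamma> (s - ?c)" "s - ?c" "t - ?c" 1 "- ?c"]
        v(2)[of "s - ?c" "t - ?c"] st \<eta>_eq[of m s] \<eta>_eq[of m t] by simp
    from has_integral_spike_finite[OF _ _ this, of "{?c + T}" w] show ?thesis
      using st r_eq[of m] by (auto simp: w_def)
  qed
  have windows: "\<forall>s t. T * of_int m \<le> s \<longrightarrow> s \<le> t \<longrightarrow> t \<le> T * of_int m + T * real k \<longrightarrow>
      (w has_integral (\<eta> t - \<eta> s)) {s..t}" for m k
  proof (induction k)
    case 0
    have "(w has_integral (\<eta> t - \<eta> s)) {s..t}"
      if "T * of_int m \<le> s" "s \<le> t" "t \<le> T * of_int m" for s t
    proof -
      have "t = s" using that by linarith
      then show ?thesis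
        using has_integral_refl(2)[of w s] by simp
    qed
    then show ?case
      by simp
  next
    case (Suc k)
    show ?case
    proof (intro allI impI)
      fix s t
      let ?c = "T * of_int m + T * real k"
      assume st: "T * of_int m \<le> s" "s \<le> t" "t \<le> T * of_int m + T * real (Suc k)"
      have win: "(w has_integral (\<eta> t' - \<eta> s')) {s'..t'}"
        if "?c \<le> s'" "s' \<le> t'" "t' \<le> T * of_int m + T * real (Suc k)" for s' t'
        using window[of "m + int k" s' t'] that by (simp add: algebra_simps)
      consider "t \<le> ?c" | "?c \<le> s" | "s \<le> ?c" "?c \<le> t"
        by linarith
      then show "(w has_integral (\<eta> t - \<eta> s)) {s..t}"
      proof cases
        case 3
        then have "(w has_integral (\<eta> ?c - \<eta> s) + (\<eta> t - \<eta> ?c)) {s..t}"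
          using Suc st win[of ?c t] by (intro has_integral_combine[of s ?c t]) auto
        then show ?thesis by simp
      qed (use Suc st win in auto)
    qed
  qed
  have "(w has_integral (\<eta> t - \<eta> s)) {s..t}" if "s \<le> t" for s t
  proof -
    obtain k where "(t - T * of_int \<lfloor>s / T\<rfloor>) / T \<le> real k"
      using real_arch_simple by blast
    then have "t \<le> T * of_int \<lfloor>s / T\<rfloor> + T * real k"
      using T by (simp add: field_simps)
    moreover have "T * of_int \<lfloor>s / T\<rfloor> \<le> s"
      using r(1)[of s] by (simp add: r_def)
    ultimately show ?thesis
      using windows[of "\<lfloor>s / T\<rfloor>" k] that by blast
  qed
  then show "filippov_solution F \<eta>"
    unfolding filippov_solution_def using w by blast
qed

text \<open>The condition \<open>p \<noteq> q\<close> forces both a positive duration of the closed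
  arc and a nonconstant solution.\<close>

lemma periodic_orbit_through:
  assumes "reach (filippov_set F) S p q" "reach (filippov_set F) S q p" "p \<noteq> q"
  obtains \<Gamma> where "periodic_orbit F \<Gamma>" "p \<in> \<Gamma>" "q \<in> \<Gamma>" "\<Gamma> \<subseteq> S"
proof -
  obtain \<delta> a b c where \<delta>: "a \<le> b" "b \<le> c" "traj (filippov_set F) \<delta> a c" "\<delta> a = p" "\<delta> b = q"
    "\<delta> c = p" "\<delta> ` {a..c} \<subseteq> S"
    using reach_append[OF assms(1,2)] .
  define T where "T = c - a"
  define \<gamma> where "\<gamma> = (\<lambda>t. \<delta> (t + a))"
  have tr: "traj (filippov_set F) \<gamma> 0 T"
    using traj_shift[OF \<delta>(3), of "- a"] by (simp add: \<gamma>_def T_def)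
  have "a \<noteq> c"
    using \<delta> assms(3) by auto
  then have T: "0 < T"
    using \<delta> by (simp add: T_def)
  have closed: "\<gamma> T = \<gamma> 0"
    using \<delta> by (simp add: \<gamma>_def T_def)
  define \<eta> where "\<eta> = (\<lambda>t. \<gamma> (t - T * of_int \<lfloor>t / T\<rfloor>))"
  note ext = filippov_solution_periodic_extension[OF tr T closed, folded \<eta>_def]
  have "\<eta> 0 = \<gamma> 0" "\<eta> (b - a) = \<gamma> (b - a)"
    unfolding \<eta>_def by (rule ext(4); use T \<delta>(1,2) in \<open>simp add: T_def\<close>)+
  then have 0: "\<eta> 0 = p" and b: "\<eta> (b - a) = q"
    using \<delta> by (auto simp: \<gamma>_def)
  have "periodic_solution F \<eta>"
    unfolding periodic_solution_def
  proof (intro conjI)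
    show "filippov_solution F \<eta>"
      by (rule ext(1))
    show "\<exists>T>0. \<forall>t. \<eta> (t + T) = \<eta> t"
      using T ext(2) unfolding \<eta>_def by blast
    show "\<exists>t. \<eta> t \<noteq> \<eta> 0"
      using 0 b assms(3) by metis
  qed
  then have "periodic_orbit F (range \<eta>)"
    unfolding periodic_orbit_def by blast
  moreover have "range \<eta> \<subseteq> S"
    unfolding ext(3) using \<delta>(7) by (auto simp: \<gamma>_def T_def image_subset_iff)
  ultimately show ?thesis
    using that 0 b by (metis rangeI)
qed

lemma periodic_orbit_compact:
  assumes "periodic_orbit F \<Gamma>"
  shows "compact \<Gamma>"
proof -
  obtain \<gamma> T where \<gamma>: "filippov_solution F \<gamma>" "T > 0" "\<And>t. \<gamma> (t + T) = \<gamma> t" "\<Gamma> = range \<gamma>"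
    using assms by (auto simp: periodic_orbit_def periodic_solution_def)
  have per: "\<gamma> (t + real k * T) = \<gamma> t" for t k
  proof (induction k)
    case (Suc k)
    then show ?case
      using \<gamma>(3)[of "t + real k * T"] by (simp add: algebra_simps)
  qed simp
  have "\<gamma> t \<in> \<gamma> ` {0..T}" for t
  proof -
    define m where "m = \<lfloor>t / T\<rfloor>"
    have m: "of_int m \<le> t / T" "t / T < of_int m + 1"
      unfolding m_def by linarith+
    then have "of_int m * T \<le> t" "t < (of_int m + 1) * T"
      using \<gamma>(2) pos_le_divide_eq pos_divide_less_eq by blast+
    then have s: "t - T * of_int m \<in> {0..T}"
      by (auto simp: algebra_simps)
    have "\<gamma> (t - T * of_int m) = \<gamma> t"
    proof (cases "0 \<le> m")
      case True
      then show ?thesis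
        using per[of "t - T * of_int m" "nat m"] by (simp add: algebra_simps)
    next
      case False
      then show ?thesis
        using per[of t "nat (- m)"] by (simp add: algebra_simps)
    qed
    then show ?thesis
      using s by (metis imageI)
  qed
  then have "\<Gamma> = \<gamma> ` {0..T}"
    using \<gamma>(4) by auto
  then show ?thesis
    using traj_continuous[OF filippov_solution_traj[OF \<gamma>(1)]] by (auto intro: compact_continuous_image)
qed

text \<open>Adding whole periods moves the target time past the starting time; thus forward
  reachability is symmetric on a periodic orbit.\<close>

lemma reach_within_periodic_orbit:
  assumes "periodic_orbit F \<Gamma>" "p \<in> \<Gamma>" "q \<in> \<Gamma>"
  shows "reach (filippov_set F) \<Gamma> p q"
proof -
  obtain \<gamma> T where \<gamma>: "filippov_solution F \<gamma>" "T > 0" "\<And>t. \<gamma> (t + T) = \<gamma> t" "\<Gamma> = range \<gamma>"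
    using assms(1) by (auto simp: periodic_orbit_def periodic_solution_def)
  have per: "\<gamma> (t + real k * T) = \<gamma> t" for t k
  proof (induction k)
    case (Suc k)
    then show ?case
      using \<gamma>(3)[of "t + real k * T"] by (simp add: algebra_simps)
  qed simp
  obtain s t where st: "p = \<gamma> s" "q = \<gamma> t"
    using assms \<gamma>(4) by blast
  obtain k where "(s - t) / T \<le> real k"
    using real_arch_simple by blast
  then have "s \<le> t + real k * T"
    using \<gamma>(2) by (simp add: field_simps)
  then show ?thesis
    unfolding reach_def using filippov_solution_traj[OF \<gamma>(1)] per[of t k] st \<gamma>(4) by blast
qed

lemma periodic_orbit_forward_invariant:
  assumes "one_sided_lipschitz (filippov_set F) K"
    and "periodic_orbit F \<Gamma>" "p \<in> \<Gamma>" "reach (filippov_set F) S p q"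
  shows "q \<in> \<Gamma>"
proof -
  obtain \<gamma> where \<gamma>: "filippov_solution F \<gamma>" "\<Gamma> = range \<gamma>"
    using assms(2) by (auto simp: periodic_orbit_def periodic_solution_def)
  obtain s where s: "p = \<gamma> s"
    using assms \<gamma>(2) by blast
  obtain \<delta> a b where \<delta>: "a \<le> b" "traj (filippov_set F) \<delta> a b" "\<delta> a = p" "\<delta> b = q"
    using assms(4) by (auto simp: reach_def)
  have "traj (filippov_set F) (\<lambda>t. \<delta> (t + a)) 0 (b - a)"
    using traj_shift[OF \<delta>(2), of "- a"] by simp
  moreover have "traj (filippov_set F) (\<lambda>t. \<gamma> (t + s)) 0 (b - a)"
    using traj_shift[OF filippov_solution_traj[OF \<gamma>(1), of s "b - a + s"], of "- s"] by simp
  ultimately have "\<delta> b = \<gamma> (b - a + s)"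
    using one_sided_lipschitz.traj_unique[OF assms(1), of "\<lambda>t. \<delta> (t + a)" "b - a" "\<lambda>t. \<gamma> (t + s)"] \<delta> s
    by simp
  then show ?thesis
    using \<delta>(4) \<gamma>(2) by auto
qed

text \<open>Forward uniqueness keeps everything reachable from the common point inside the other
  orbit, and from that point a periodic orbit reaches all of itself.\<close>

lemma periodic_orbits_eq:
  assumes "one_sided_lipschitz (filippov_set F) K"
    and "periodic_orbit F \<Gamma>" "periodic_orbit F \<Gamma>'" "p \<in> \<Gamma>" "p \<in> \<Gamma>'"
  shows "\<Gamma> = \<Gamma>'"
proof
  show "\<Gamma> \<subseteq> \<Gamma>'"
    using periodic_orbit_forward_invariant[OF assms(1) assms(3,5)]
      reach_within_periodic_orbit[OF assms(2,4)] by blast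
  show "\<Gamma>' \<subseteq> \<Gamma>"
    using periodic_orbit_forward_invariant[OF assms(1) assms(2,4)]
      reach_within_periodic_orbit[OF assms(3,5)] by blast
qed

lemma periodic_orbit_cong:
  assumes "\<And>z. z \<in> \<Gamma> \<Longrightarrow> filippov_set F' z = filippov_set F z"
  shows "periodic_orbit F' \<Gamma> \<longleftrightarrow> periodic_orbit F \<Gamma>"
proof -
  have "filippov_solution F' \<gamma> \<longleftrightarrow> filippov_solution F \<gamma>" if "\<Gamma> = range \<gamma>" for \<gamma>
    unfolding filippov_solution_def using assms that by simp
  then show ?thesis
    unfolding periodic_orbit_def periodic_solution_def by blast
qed

subsection \<open>One-sided limits and circular arcs\<close>

text \<open>Filippov's set in terms of the one-sided limits as functions: the value of
  \<open>F\<close> at a jump does not enter, and membership becomes an interval condition.\<close>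

definition jump_field :: "(real \<Rightarrow> real) \<Rightarrow> (real \<Rightarrow> real) \<Rightarrow> real \<times> real \<Rightarrow> (real \<times> real) set" where
  "jump_field L R p = {R (fst p) - snd p..L (fst p) - snd p} \<times> {fst p}"

text \<open>The inequality for \<open>x < x'\<close> is the one-sided Lipschitz condition on the
  graph with its jumps filled in; \<open>6/5\<close> is the slope in the spiral zone. The linear
  growth bound makes the field bounded on bounded sets.\<close>

definition downward_jumps :: "(real \<Rightarrow> real) \<Rightarrow> (real \<Rightarrow> real) \<Rightarrow> (real \<Rightarrow> real) \<Rightarrow> bool" where
  "downward_jumps F L R \<longleftrightarrow> (\<forall>x. (F \<longlongrightarrow> L x) (at_left x) \<and> (F \<longlongrightarrow> R x) (at_right x)) \<and>
     (\<forall>x. R x \<le> L x) \<and> (\<forall>x x'. x < x' \<longrightarrow> L x' - R x \<le> 6/5 * (x' - x)) \<and>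
     (\<exists>C. \<forall>x. \<bar>L x\<bar> \<le> C + 6/5 * \<bar>x\<bar> \<and> \<bar>R x\<bar> \<le> C + 6/5 * \<bar>x\<bar>)"

lemma jump_field_nonempty: "R (fst p) \<le> L (fst p) \<Longrightarrow> jump_field L R p \<noteq> {}"
  by (auto simp: jump_field_def)

lemma closed_segment_horizontal:
  fixes a b x :: real
  assumes "b \<le> a"
  shows "closed_segment (a, x) (b, x) = {b..a} \<times> {x}"
proof -
  have "closed_segment (a, x) (b, x) = (\<lambda>u. (u, x)) ` closed_segment a b"
  proof (intro equalityI subsetI)
    fix p assume "p \<in> closed_segment (a, x) (b, x)"
    then obtain u where "0 \<le> u" "u \<le> 1" "p = (1 - u) *\<^sub>R (a, x) + u *\<^sub>R (b, x)"
      by (auto simp: closed_segment_def)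
    then show "p \<in> (\<lambda>u. (u, x)) ` closed_segment a b"
      by (intro image_eqI[of _ _ "(1 - u) *\<^sub>R a + u *\<^sub>R b"]) (auto simp: closed_segment_def algebra_simps)
  next
    fix p assume "p \<in> (\<lambda>u. (u, x)) ` closed_segment a b"
    then obtain u where "0 \<le> u" "u \<le> 1" "p = ((1 - u) *\<^sub>R a + u *\<^sub>R b, x)"
      by (auto simp: closed_segment_def)
    then show "p \<in> closed_segment (a, x) (b, x)"
      unfolding closed_segment_def by (auto intro!: exI[of _ u] simp: algebra_simps)
  qed
  also have "closed_segment a b = {b..a}"
    using assms by (simp add: closed_segment_eq_real_ivl)
  finally show ?thesis by auto
qed

lemma filippov_set_jump_field:
  assumes "downward_jumps F L R"
  shows "filippov_set F = jump_field L R"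
proof
  fix p :: "real \<times> real"
  obtain x y where p: "p = (x, y)" by fastforce
  show "filippov_set F p = jump_field L R p"
    using assms unfolding p downward_jumps_def
    by (subst filippov_set_eq[of F "L x" _ "R x"]) (auto simp: closed_segment_horizontal jump_field_def)
qed

lemma downward_jumps_jump_iff:
  assumes "downward_jumps F L R"
  shows "jump_at F x \<longleftrightarrow> R x < L x"
proof -
  have lim: "(F \<longlongrightarrow> L x) (at_left x)" "(F \<longlongrightarrow> R x) (at_right x)" and "R x \<le> L x"
    using assms by (auto simp: downward_jumps_def)
  show ?thesis
  proof
    assume "jump_at F x"
    then obtain l r where "(F \<longlongrightarrow> l) (at_left x)" "(F \<longlongrightarrow> r) (at_right x)" "l \<noteq> r"
      by (auto simp: jump_at_def)
    then have "L x \<noteq> R x"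
      using lim tendsto_unique[OF trivial_limit_at_left_real] tendsto_unique[OF trivial_limit_at_right_real] by metis
    then show "R x < L x"
      using \<open>R x \<le> L x\<close> by simp
  next
    assume "R x < L x"
    then show "jump_at F x"
      unfolding jump_at_def using lim by (intro exI[of _ "L x"] exI[of _ "R x"]) auto
  qed
qed

lemma downward_jumps_lims:
  assumes "downward_jumps F L R"
  shows "left_lim F x = L x" "right_lim F x = R x"
  using assms by (auto simp: downward_jumps_def left_lim_def right_lim_def intro!: tendsto_Lim)

text \<open>The rotational part of the field contributes \<open>- (x - x') * (y - y')\<close> and
  \<open>(x - x') * (y - y')\<close>, which cancel. What is left is the horizontal estimate, where
  downward jumps have the favourable sign.\<close>

lemma one_sided_lipschitz_jump_field:
  assumes "downward_jumps F L R"
  shows "one_sided_lipschitz (jump_field L R) (6/5)"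
proof
  fix u p w q :: "real \<times> real"
  assume uw: "u \<in> jump_field L R p" "w \<in> jump_field L R q"
  obtain x y where p: "p = (x, y)" by fastforce
  obtain x' y' where q: "q = (x', y')" by fastforce
  obtain a where a: "u = (a, x)" "R x - y \<le> a" "a \<le> L x - y"
    using uw by (auto simp: jump_field_def p)
  obtain b where b: "w = (b, x')" "R x' - y' \<le> b" "b \<le> L x' - y'"
    using uw by (auto simp: jump_field_def q)
  have "(a - b) * (x - x') \<le> (6/5 * (x - x') - (y - y')) * (x - x')"
  proof (cases x x' rule: linorder_cases)
    case less
    then have "L x' - R x \<le> 6/5 * (x' - x)"
      using assms by (auto simp: downward_jumps_def)
    then have "6/5 * (x - x') - (y - y') \<le> a - b"
      using a b unfolding right_diff_distrib by linarith
    then show ?thesis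
      using less by (intro mult_right_mono_neg) auto
  next
    case greater
    then have "L x - R x' \<le> 6/5 * (x - x')"
      using assms by (auto simp: downward_jumps_def)
    then have "a - b \<le> 6/5 * (x - x') - (y - y')"
      using a b unfolding right_diff_distrib by linarith
    then show ?thesis
      using greater by (intro mult_right_mono) auto
  qed auto
  moreover have "(6/5 * (x - x') - (y - y')) * (x - x') = 6/5 * (x - x')\<^sup>2 - (x - x') * (y - y')"
    by (simp add: field_simps power2_eq_square)
  ultimately have "(a - b) * (x - x') + (x - x') * (y - y') \<le> 6/5 * (x - x')\<^sup>2"
    by linarith
  also have "\<dots> \<le> 6/5 * ((x - x')\<^sup>2 + (y - y')\<^sup>2)"
    by simp
  finally show "(u - w) \<bullet> (p - q) \<le> 6/5 * (norm (p - q))\<^sup>2"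
    by (simp add: a b p q norm_Pair)
next
  fix P :: "(real \<times> real) set"
  assume "bounded P"
  then obtain B where B: "\<And>p. p \<in> P \<Longrightarrow> norm p \<le> B"
    by (auto simp: bounded_iff)
  obtain C where C: "\<And>x. \<bar>L x\<bar> \<le> C + 6/5 * \<bar>x\<bar>" "\<And>x. \<bar>R x\<bar> \<le> C + 6/5 * \<bar>x\<bar>"
    using assms unfolding downward_jumps_def by blast
  have "norm u \<le> \<bar>C\<bar> + 4 * B" if u: "u \<in> (\<Union>p\<in>P. jump_field L R p)" for u
  proof -
    obtain p where p: "p \<in> P" "u \<in> jump_field L R p"
      using u by blast
    obtain x y where "p = (x, y)" by fastforce
    with p obtain a where xy: "(x, y) \<in> P" "u = (a, x)" "R x - y \<le> a" "a \<le> L x - y"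
      by (auto simp: jump_field_def)
    have "\<bar>x\<bar> \<le> norm (x, y)" "\<bar>y\<bar> \<le> norm (x, y)"
      by (auto simp: norm_Pair)
    then have "\<bar>x\<bar> \<le> B" "\<bar>y\<bar> \<le> B"
      using B[OF xy(1)] by linarith+
    moreover have "norm u \<le> \<bar>a\<bar> + \<bar>x\<bar>"
      using norm_Pair_le[of a x] by (simp add: xy)
    ultimately show ?thesis
      using xy(3,4) C[of x] by linarith
  qed
  then show "bounded (\<Union>p\<in>P. jump_field L R p)"
    unfolding bounded_iff by blast
next
  show "jump_field L R p \<noteq> {}" for p
    using assms by (intro jump_field_nonempty) (auto simp: downward_jumps_def)
qed simp

lemma has_vector_derivative_Pair_real:
  assumes "(f has_real_derivative f') (at t)" "(g has_real_derivative g') (at t)"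
  shows "((\<lambda>t. (f t, g t)) has_vector_derivative (f', g')) (at t)"
  using assms by (intro has_vector_derivative_Pair) (auto simp: has_real_derivative_iff_has_vector_derivative)

text \<open>Where \<open>F\<close> equals \<open>c\<close> the system is the rotation about
  \<open>(0, c)\<close> with unit angular speed, so the angle is the time. Flatness is assumed at
  interior times only, since the ends may lie on jump lines.\<close>

lemma reach_circle:
  assumes RL: "\<And>x. R x \<le> L x" and "t1 \<le> t2"
    and flat: "\<And>t. t1 < t \<Longrightarrow> t < t2 \<Longrightarrow> L (\<rho> * sin t) = c \<and> R (\<rho> * sin t) = c"
    and S: "\<And>t. t1 \<le> t \<Longrightarrow> t \<le> t2 \<Longrightarrow> (\<rho> * sin t, c - \<rho> * cos t) \<in> S"
  shows "reach (jump_field L R) S (\<rho> * sin t1, c - \<rho> * cos t1) (\<rho> * sin t2, c - \<rho> * cos t2)"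
proof (rule reach_of_derivative[OF \<open>t1 \<le> t2\<close>])
  show "((\<lambda>t. (\<rho> * sin t, c - \<rho> * cos t)) has_vector_derivative (\<rho> * cos t, \<rho> * sin t)) (at t)" for t
    by (intro has_vector_derivative_Pair_real) (auto intro!: derivative_eq_intros)
qed (use flat S RL in \<open>auto simp: jump_field_def\<close>)

context
  fixes L R :: "real \<Rightarrow> real" and x x' \<rho> c :: real
  assumes RL: "\<And>x. R x \<le> L x" and x: "0 < x" "x \<le> x'" "x' \<le> \<rho>"
    and flat: "\<And>u. x < u \<Longrightarrow> u < x' \<Longrightarrow> L u = c \<and> R u = c"
begin

private lemma arcsin_param:
  assumes "0 < u" "u \<le> \<rho>"
  shows "\<rho> * sin (arcsin (u / \<rho>)) = u" "\<rho> * cos (arcsin (u / \<rho>)) = sqrt (\<rho>\<^sup>2 - u\<^sup>2)"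
proof -
  have u: "- 1 \<le> u / \<rho>" "u / \<rho> \<le> 1"
    using assms by (auto simp: field_simps)
  then show "\<rho> * sin (arcsin (u / \<rho>)) = u"
    using assms arcsin[OF u] by simp
  have "\<rho> * cos (arcsin (u / \<rho>)) = sqrt (\<rho>\<^sup>2) * sqrt (1 - (u / \<rho>)\<^sup>2)"
    using u assms by (simp add: cos_arcsin)
  also have "\<dots> = sqrt (\<rho>\<^sup>2 * (1 - (u / \<rho>)\<^sup>2))"
    by (simp add: real_sqrt_mult)
  also have "\<rho>\<^sup>2 * (1 - (u / \<rho>)\<^sup>2) = \<rho>\<^sup>2 - u\<^sup>2"
    using assms by (simp add: field_simps)
  finally show "\<rho> * cos (arcsin (u / \<rho>)) = sqrt (\<rho>\<^sup>2 - u\<^sup>2)" .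
qed

private lemma arcsin_between:
  assumes "arcsin (x / \<rho>) < t" "t < arcsin (x' / \<rho>)"
  shows "x < \<rho> * sin t" "\<rho> * sin t < x'"
proof -
  have r: "- 1 \<le> x / \<rho>" "x / \<rho> \<le> 1" "- 1 \<le> x' / \<rho>" "x' / \<rho> \<le> 1"
    using x by (auto simp: field_simps)
  have *: "- (pi / 2) \<le> arcsin (x / \<rho>)" "arcsin (x' / \<rho>) \<le> pi / 2"
    using arcsin[OF r(1,2)] arcsin[OF r(3,4)] by auto
  have "sin (arcsin (x / \<rho>)) < sin t" "sin t < sin (arcsin (x' / \<rho>))"
    using * assms by (auto intro!: sin_monotone_2pi)
  then have "x / \<rho> < sin t" "sin t < x' / \<rho>"
    using arcsin[OF r(1,2)] arcsin[OF r(3,4)] by auto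
  then show "x < \<rho> * sin t" "\<rho> * sin t < x'"
    using x by (auto simp: field_simps)
qed

private lemma arcsin_param_le: "arcsin (x / \<rho>) \<le> arcsin (x' / \<rho>)"
  using x by (intro arcsin_le_arcsin) (auto simp: divide_right_mono field_simps)

lemma reach_lower_arc:
  assumes S: "\<And>z. x < fst z \<Longrightarrow> fst z < x' \<Longrightarrow> z \<in> S"
    "(x, c - sqrt (\<rho>\<^sup>2 - x\<^sup>2)) \<in> S" "(x', c - sqrt (\<rho>\<^sup>2 - x'\<^sup>2)) \<in> S"
  shows "reach (jump_field L R) S (x, c - sqrt (\<rho>\<^sup>2 - x\<^sup>2)) (x', c - sqrt (\<rho>\<^sup>2 - x'\<^sup>2))"
proof -
  let ?s = "arcsin (x / \<rho>)" and ?t = "arcsin (x' / \<rho>)"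
  have "reach (jump_field L R) S (\<rho> * sin ?s, c - \<rho> * cos ?s) (\<rho> * sin ?t, c - \<rho> * cos ?t)"
  proof (rule reach_circle[OF RL arcsin_param_le])
    show "L (\<rho> * sin t) = c \<and> R (\<rho> * sin t) = c" if "?s < t" "t < ?t" for t
      using arcsin_between[OF that] flat by auto
    show "(\<rho> * sin t, c - \<rho> * cos t) \<in> S" if "?s \<le> t" "t \<le> ?t" for t
    proof -
      have "t = ?s \<or> t = ?t \<or> ?s < t \<and> t < ?t"
        using that by linarith
      then show ?thesis
        using S arcsin_between arcsin_param[of x] arcsin_param[of x'] x by auto
    qed
  qed
  then show ?thesis
    using arcsin_param[of x] arcsin_param[of x'] x by simp
qed

text \<open>Replacing \<open>t\<close> by \<open>pi - t\<close> reflects the lower arc and reverses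
  its order in \<open>x\<close>; upper arcs therefore run from right to left.\<close>

lemma reach_upper_arc:
  assumes S: "\<And>z. x < fst z \<Longrightarrow> fst z < x' \<Longrightarrow> z \<in> S"
    "(x, c + sqrt (\<rho>\<^sup>2 - x\<^sup>2)) \<in> S" "(x', c + sqrt (\<rho>\<^sup>2 - x'\<^sup>2)) \<in> S"
  shows "reach (jump_field L R) S (x', c + sqrt (\<rho>\<^sup>2 - x'\<^sup>2)) (x, c + sqrt (\<rho>\<^sup>2 - x\<^sup>2))"
proof -
  let ?s = "arcsin (x / \<rho>)" and ?t = "arcsin (x' / \<rho>)"
  have "reach (jump_field L R) S (\<rho> * sin (pi - ?t), c - \<rho> * cos (pi - ?t)) (\<rho> * sin (pi - ?s), c - \<rho> * cos (pi - ?s))"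
  proof (rule reach_circle[OF RL])
    show "L (\<rho> * sin t) = c \<and> R (\<rho> * sin t) = c" if "pi - ?t < t" "t < pi - ?s" for t
      using arcsin_between[of "pi - t"] that flat by auto
    show "(\<rho> * sin t, c - \<rho> * cos t) \<in> S" if "pi - ?t \<le> t" "t \<le> pi - ?s" for t
    proof -
      have "t = pi - ?s \<or> t = pi - ?t \<or> ?s < pi - t \<and> pi - t < ?t"
        using that by linarith
      then show ?thesis
        using S arcsin_between[of "pi - t"] arcsin_param[of x] arcsin_param[of x'] x by auto
    qed
  qed (use arcsin_param_le in simp)
  then show ?thesis
    using arcsin_param[of x] arcsin_param[of x'] x by simp
qed

end

text \<open>The vertical velocity \<open>(0, x)\<close> belongs to the field as long as the height
  lies between the one-sided limits, ends included. So sliding arrives at the upper end, where the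
  field from the left is tangent to the line.\<close>

lemma reach_slide:
  assumes RL: "\<And>x. R x \<le> L x" and "0 < x" "y \<le> y'" "R x \<le> y" "y' \<le> L x"
    and S: "{x} \<times> {y..y'} \<subseteq> S"
  shows "reach (jump_field L R) S (x, y) (x, y')"
proof (rule reach_of_derivative[of 0 "(y' - y) / x" "\<lambda>t. (x, y + x * t)" "\<lambda>t. (0, x)"])
  show "((\<lambda>t. (x, y + x * t)) has_vector_derivative (0, x)) (at t)" for t
    by (intro has_vector_derivative_Pair_real) (auto intro!: derivative_eq_intros)
  have *: "y \<le> y + x * t \<and> y + x * t \<le> y'" if "0 \<le> t" "t \<le> (y' - y) / x" for t
  proof -
    have "0 \<le> x * t" "x * t \<le> y' - y"
      using that \<open>0 < x\<close> by (auto simp: field_simps)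
    then show ?thesis
      by simp
  qed
  show "(0, x) \<in> jump_field L R (x, y + x * t)" if "0 < t" "t < (y' - y) / x" for t
    using *[of t] that assms(4,5) by (auto simp: jump_field_def)
  show "(\<lambda>t. (x, y + x * t)) ` {0..(y' - y) / x} \<subseteq> S"
    using * S by auto
qed (use assms in \<open>auto intro!: jump_field_nonempty\<close>)

subsection \<open>The spiral zone\<close>

text \<open>Spirals grow by the factor \<open>exp (3/4)\<close> per radian, the ratio of real to
  imaginary part of the eigenvalue. \<open>exit_height\<close> and \<open>entry_depth\<close>
  locate, relative to the height \<open>6/5\<close> on the line \<open>x = 1\<close>, the start and
  the end of an arc through \<open>x < 1\<close> of rotation \<theta>; they equal minus the
  horizontal velocity at the start and the horizontal velocity at the end.\<close>

definition exit_height :: "real \<Rightarrow> real" where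
  "exit_height \<theta> = 4/5 * ((exp (- (3/4 * \<theta>)) - cos \<theta>) / (- sin \<theta>) - 3/4)"

definition entry_depth :: "real \<Rightarrow> real" where
  "entry_depth \<theta> = 4/5 * (3/4 + (exp (3/4 * \<theta>) - cos \<theta>) / (- sin \<theta>))"

text \<open>Eliminating \<open>y\<close> in the spiral zone gives
  \<open>x'' - 6/5 x' + x = 0\<close>. This is the solution with initial value
  \<open>x\<^sub>0\<close> and sine coefficient \<open>v\<close>; the second coordinate is recovered
  as \<open>6/5 x - x'\<close>.\<close>

definition spiral_x :: "real \<Rightarrow> real \<Rightarrow> real \<Rightarrow> real" where
  "spiral_x x\<^sub>0 v t = exp (3/5 * t) * (x\<^sub>0 * cos (4/5 * t) + v * sin (4/5 * t))"

definition spiral_dx :: "real \<Rightarrow> real \<Rightarrow> real \<Rightarrow> real" where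
  "spiral_dx x\<^sub>0 v t = exp (3/5 * t) * ((3/5 * x\<^sub>0 + 4/5 * v) * cos (4/5 * t) + (3/5 * v - 4/5 * x\<^sub>0) * sin (4/5 * t))"

lemma has_real_derivative_spiral_x:
  "(spiral_x x\<^sub>0 v has_real_derivative spiral_dx x\<^sub>0 v t) (at t)"
  unfolding spiral_x_def spiral_dx_def
  by (auto intro!: derivative_eq_intros simp: algebra_simps)

lemma has_real_derivative_spiral_dx:
  "(spiral_dx x\<^sub>0 v has_real_derivative 6/5 * spiral_dx x\<^sub>0 v t - spiral_x x\<^sub>0 v t) (at t)"
  unfolding spiral_x_def spiral_dx_def
  by (auto intro!: derivative_eq_intros simp: field_simps)

definition spiral :: "real \<Rightarrow> real \<Rightarrow> real \<Rightarrow> real \<times> real" where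
  "spiral x\<^sub>0 v t = (spiral_x x\<^sub>0 v t, 6/5 * spiral_x x\<^sub>0 v t - spiral_dx x\<^sub>0 v t)"

lemma has_vector_derivative_spiral:
  "(spiral x\<^sub>0 v has_vector_derivative (spiral_dx x\<^sub>0 v t, spiral_x x\<^sub>0 v t)) (at t)"
proof -
  have "((\<lambda>t. (spiral_x x\<^sub>0 v t, 6/5 * spiral_x x\<^sub>0 v t - spiral_dx x\<^sub>0 v t)) has_vector_derivative
    (spiral_dx x\<^sub>0 v t, spiral_x x\<^sub>0 v t)) (at t)"
    by (intro has_vector_derivative_Pair_real)
      (auto intro!: derivative_eq_intros has_real_derivative_spiral_x has_real_derivative_spiral_dx)
  then show ?thesis
    by (simp add: spiral_def[abs_def])
qed

lemma entry_depth_pos: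
  assumes "pi < \<theta>" "\<theta> < 2 * pi"
  shows "0 < entry_depth \<theta>"
proof -
  have "sin \<theta> < 0"
    using assms by (intro sin_lt_zero) auto
  moreover have "1 < exp (3/4 * \<theta>)"
    using assms pi_gt_zero by auto
  then have "0 < exp (3/4 * \<theta>) - cos \<theta>"
    using cos_le_one[of \<theta>] by linarith
  ultimately show ?thesis
    unfolding entry_depth_def by (intro mult_pos_pos add_pos_pos divide_pos_pos) auto
qed

text \<open>
  A spiral arc through \<open>x = 1\<close> at two times with total rotation \<open>\<theta>\<close> solves a linear boundary value
  problem, which gives its data at both ends in closed form in terms of \<open>\<theta>\<close>.
\<close>
lemma spiral_boundary:
  fixes \<theta> :: real
  assumes \<theta>: "pi < \<theta>" "\<theta> < 2 * pi"
  defines "v \<equiv> (exp (- (3/4 * \<theta>)) - cos \<theta>) / sin \<theta>" and "\<tau> \<equiv> 5/4 * \<theta>"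
  shows "spiral_x 1 v 0 = 1" "spiral_dx 1 v 0 = - exit_height \<theta>"
    "spiral_x 1 v \<tau> = 1" "spiral_dx 1 v \<tau> = entry_depth \<theta>"
proof -
  have s: "sin \<theta> < 0"
    using \<theta> by (intro sin_lt_zero) auto
  have vs: "v * sin \<theta> = exp (- (3/4 * \<theta>)) - cos \<theta>"
    using s by (simp add: v_def)
  have ee: "exp (3/4 * \<theta>) * exp (- (3/4 * \<theta>)) = 1"
    by (simp add: exp_minus)
  show "spiral_x 1 v 0 = 1"
    by (simp add: spiral_x_def)
  show "spiral_dx 1 v 0 = - exit_height \<theta>"
    by (simp add: spiral_dx_def exit_height_def v_def algebra_simps)
  show "spiral_x 1 v \<tau> = 1"
    using vs ee by (simp add: spiral_x_def \<tau>_def)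
  have "exp (3/4 * \<theta>) * (v * cos \<theta> - sin \<theta>) * sin \<theta> = exp (3/4 * \<theta>) * ((v * sin \<theta>) * cos \<theta> - (sin \<theta>)\<^sup>2)"
    by (simp add: algebra_simps power2_eq_square)
  also have "\<dots> = exp (3/4 * \<theta>) * (exp (- (3/4 * \<theta>)) * cos \<theta> - 1)"
    unfolding vs using sin_cos_squared_add[of \<theta>] by (simp add: algebra_simps power2_eq_square)
  also have "\<dots> = cos \<theta> - exp (3/4 * \<theta>)"
    using ee by (simp add: right_diff_distrib mult.assoc[symmetric])
  finally have "exp (3/4 * \<theta>) * (v * cos \<theta> - sin \<theta>) = (exp (3/4 * \<theta>) - cos \<theta>) / (- sin \<theta>)"
    using s by (simp add: field_simps)
  moreover have "exp (3/4 * \<theta>) * (cos \<theta> + v * sin \<theta>) = 1"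
    using vs ee by simp
  moreover have "spiral_dx 1 v \<tau> = 3/5 * (exp (3/4 * \<theta>) * (cos \<theta> + v * sin \<theta>))
      + 4/5 * (exp (3/4 * \<theta>) * (v * cos \<theta> - sin \<theta>))"
    by (simp add: spiral_dx_def \<tau>_def algebra_simps)
  ultimately show "spiral_dx 1 v \<tau> = entry_depth \<theta>"
    unfolding entry_depth_def by algebra
qed

text \<open>Otherwise the horizontal velocity, up to a positive factor a sinusoid \<open>g\<close>
  of the angle, would have the signs \<open>\<le> 0\<close>, \<open>\<ge> 0\<close>,
  \<open>\<le> 0\<close>, \<open>> 0\<close> at four successive angles within less than a full turn,
  whereas zeros of a sinusoid are \<open>pi\<close> apart. Trigonometric identities take care of the
  weak inequalities.\<close>

lemma spiral_below_1:
  fixes \<theta> :: real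
  assumes \<theta>: "pi < \<theta>" "\<theta> < 2 * pi" and h: "0 \<le> exit_height \<theta>"
  defines "v \<equiv> (exp (- (3/4 * \<theta>)) - cos \<theta>) / sin \<theta>" and "\<tau> \<equiv> 5/4 * \<theta>"
  assumes t: "0 < t" "t < \<tau>"
  shows "spiral_x 1 v t < 1"
proof (rule ccontr)
  assume ge: "\<not> spiral_x 1 v t < 1"
  note bd = spiral_boundary[OF \<theta>, folded v_def \<tau>_def]
  define A where "A = 3/5 + 4/5 * v"
  define B where "B = 3/5 * v - 4/5"
  define g where "g = (\<lambda>\<phi>. A * cos \<phi> + B * sin \<phi>)"
  have dx: "spiral_dx 1 v r = exp (3/5 * r) * g (4/5 * r)" for r
    by (simp add: spiral_dx_def g_def A_def B_def)
  have A: "A \<le> 0"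
    using bd(2) h dx[of 0] by (simp add: g_def)
  have "0 < spiral_dx 1 v \<tau>"
    using bd(4) entry_depth_pos[OF \<theta>] by simp
  then have G: "0 < g \<theta>"
    by (simp add: dx \<tau>_def zero_less_mult_iff)
  obtain r where r: "0 < r" "r < t" "spiral_x 1 v t - spiral_x 1 v 0 = (t - 0) * spiral_dx 1 v r"
    using MVT2[OF t(1) has_real_derivative_spiral_x] by blast
  obtain q where q: "t < q" "q < \<tau>" "spiral_x 1 v \<tau> - spiral_x 1 v t = (\<tau> - t) * spiral_dx 1 v q"
    using MVT2[OF t(2) has_real_derivative_spiral_x] by blast
  have "0 \<le> t * spiral_dx 1 v r"
    using r ge bd by simp
  then have "0 \<le> spiral_dx 1 v r"
    using t by (simp add: zero_le_mult_iff)
  then have gr: "0 \<le> g (4/5 * r)"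
    by (simp add: dx zero_le_mult_iff)
  have "(\<tau> - t) * spiral_dx 1 v q \<le> 0"
    using q ge bd by simp
  then have "spiral_dx 1 v q \<le> 0"
    using t by (simp add: mult_le_0_iff)
  then have gq: "g (4/5 * q) \<le> 0"
    by (simp add: dx mult_le_0_iff)
  define a where "a = 4/5 * r"
  define b where "b = 4/5 * q"
  have ab: "0 < a" "a < b" "b < \<theta>"
    using r q by (auto simp: a_def b_def \<tau>_def)
  have s: "sin \<theta> < 0"
    using \<theta> by (intro sin_lt_zero) auto
  \<comment> \<open>The sinusoid is interpolated from its values \<open>A\<close> at
    \<open>0\<close> and \<open>g \<theta>\<close> at \<theta>; the factor
    \<open>sin \<theta>\<close> is negative and flips inequalities.\<close>
  have id: "sin \<theta> * g \<phi> = A * sin (\<theta> - \<phi>) + g \<theta> * sin \<phi>" for \<phi>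
    by (simp add: g_def sin_diff algebra_simps)
  have "sin \<theta> * g a \<le> 0" "0 \<le> sin \<theta> * g b"
    using gr gq s by (auto simp: a_def b_def mult_le_0_iff zero_le_mult_iff)
  then have 1: "g \<theta> * sin a \<le> - A * sin (\<theta> - a)" and 2: "- A * sin (\<theta> - b) \<le> g \<theta> * sin b"
    by (simp_all add: id)
  \<comment> \<open>If \<open>a < pi\<close>, all sides of 1 and 2 turn out positive, and
    multiplying them contradicts \<open>sin \<theta> * sin (b - a) < 0\<close>. Otherwise
    \<open>b\<close> lies beyond \<open>pi\<close>, and 2 fails by signs.\<close>
  show False
  proof (cases "a < pi")
    case True
    then have sa: "0 < sin a"
      using ab by (intro sin_gt_zero) auto
    then have *: "0 < - A * sin (\<theta> - a)"
      using 1 mult_pos_pos[OF G sa] by linarith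
    then have A': "0 < - A" and sta: "0 < sin (\<theta> - a)"
      using A by (auto simp: zero_less_mult_iff mult_less_0_iff)
    have "\<theta> - a < pi"
    proof (rule ccontr)
      assume "\<not> \<theta> - a < pi"
      then have "sin (\<theta> - a) \<le> 0"
        using \<theta> ab by (intro sin_le_zero) auto
      then show False using sta by simp
    qed
    then have stb: "0 < sin (\<theta> - b)"
      using ab by (intro sin_gt_zero) auto
    then have "0 < g \<theta> * sin b"
      using 2 mult_pos_pos[OF A' stb] by linarith
    then have sb: "0 < sin b"
      using G by (auto simp: zero_less_mult_iff)
    have bpi: "b - a < pi"
    proof -
      have "b < pi"
      proof (rule ccontr)
        assume "\<not> b < pi"
        then have "sin b \<le> 0"
          using \<theta> ab by (intro sin_le_zero) auto
        then show False using sb by simp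
      qed
      then show ?thesis using ab by simp
    qed
    have "(g \<theta> * sin a) * (- A * sin (\<theta> - b)) \<le> (- A * sin (\<theta> - a)) * (g \<theta> * sin b)"
      using 1 2 * mult_pos_pos[OF A' stb] by (intro mult_mono[of "g \<theta> * sin a" "- A * sin (\<theta> - a)"]) auto
    then have "(g \<theta> * (- A)) * (sin a * sin (\<theta> - b)) \<le> (g \<theta> * (- A)) * (sin (\<theta> - a) * sin b)"
      by (simp add: algebra_simps)
    then have "sin a * sin (\<theta> - b) \<le> sin (\<theta> - a) * sin b"
      using mult_pos_pos[OF G A'] by (simp only: mult_le_cancel_left_pos)
    moreover have "sin b * sin (\<theta> - a) - sin a * sin (\<theta> - b) = sin \<theta> * sin (b - a)"
      by (simp add: sin_diff algebra_simps)
    moreover have "sin \<theta> * sin (b - a) < 0"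
      using s ab bpi by (intro mult_neg_pos sin_gt_zero) auto
    ultimately show False
      by (simp add: mult.commute)
  next
    case False
    have "sin b < 0"
      using False ab \<theta> by (intro sin_lt_zero) auto
    then have "g \<theta> * sin b < 0"
      using G by (simp add: mult_less_0_iff)
    moreover have "0 \<le> - A * sin (\<theta> - b)"
      using A ab \<theta> False by (intro mult_nonneg_nonneg sin_ge_zero) auto
    ultimately show False
      using 2 by simp
  qed
qed

lemma reach_spiral:
  assumes RL: "\<And>x. R x \<le> L x" and lin: "\<And>x. x < 1 \<Longrightarrow> L x = 6/5 * x \<and> R x = 6/5 * x"
    and \<theta>: "pi < \<theta>" "\<theta> < 2 * pi" and h: "0 \<le> exit_height \<theta>"
    and S: "\<And>z. fst z < 1 \<Longrightarrow> z \<in> S" "(1, 6/5 + exit_height \<theta>) \<in> S" "(1, 6/5 - entry_depth \<theta>) \<in> S"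
  shows "reach (jump_field L R) S (1, 6/5 + exit_height \<theta>) (1, 6/5 - entry_depth \<theta>)"
proof -
  define v where "v = (exp (- (3/4 * \<theta>)) - cos \<theta>) / sin \<theta>"
  define \<tau> where "\<tau> = 5/4 * \<theta>"
  note bd = spiral_boundary[OF \<theta>, folded v_def \<tau>_def]
  note lt = spiral_below_1[OF \<theta> h, folded v_def \<tau>_def]
  have ends: "spiral 1 v 0 = (1, 6/5 + exit_height \<theta>)" "spiral 1 v \<tau> = (1, 6/5 - entry_depth \<theta>)"
    using bd by (simp_all add: spiral_def)
  show ?thesis
  proof (rule reach_of_derivative[OF _ has_vector_derivative_spiral])
    show "0 \<le> \<tau>"
      using \<theta> pi_gt_zero unfolding \<tau>_def by linarith
    show "(spiral_dx 1 v t, spiral_x 1 v t) \<in> jump_field L R (spiral 1 v t)" if "0 < t" "t < \<tau>" for t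
      using lin[OF lt[OF that]] by (auto simp: jump_field_def spiral_def)
    show "spiral 1 v ` {0..\<tau>} \<subseteq> S"
    proof
      fix z assume "z \<in> spiral 1 v ` {0..\<tau>}"
      then obtain t where t: "z = spiral 1 v t" "0 \<le> t" "t \<le> \<tau>" by auto
      show "z \<in> S"
      proof (cases "t = 0 \<or> t = \<tau>")
        case False
        then show ?thesis
          using t lt[of t] by (intro S(1)) (auto simp: spiral_def)
      qed (use t S ends in auto)
    qed
  qed (use RL ends in \<open>auto intro!: jump_field_nonempty\<close>)
qed

section \<open>Monotonicity and asymptotics of the spiral data\<close>

lemma sin_neg_between:
  fixes \<theta> :: real
  assumes "pi < \<theta>" "\<theta> < 2 * pi"
  shows "sin \<theta> < 0"
  using assms by (intro sin_lt_zero) auto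

lemma has_real_derivative_exit_height:
  assumes "pi < \<theta>" "\<theta> < 2 * pi"
  shows "(exit_height has_real_derivative
    4/5 * ((exp (- (3/4 * \<theta>)) * (3/4 * sin \<theta> + cos \<theta>) - 1) / (sin \<theta>)\<^sup>2)) (at \<theta>)"
proof -
  have *: "exp (- (3/4 * \<theta>)) * (3/4 * sin \<theta> + cos \<theta>) - 1 =
      (- (3/4 * exp (- (3/4 * \<theta>))) + sin \<theta>) * (- sin \<theta>) - (exp (- (3/4 * \<theta>)) - cos \<theta>) * (- cos \<theta>)"
    using sin_cos_squared_add[of \<theta>] by (simp add: algebra_simps power2_eq_square)
  show ?thesis
    unfolding exit_height_def[abs_def] * using sin_neg_between[OF assms]
    by (auto intro!: derivative_eq_intros simp: power2_eq_square field_simps)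
qed

text \<open>A larger rotation belongs to a smaller orbit. Strictness makes \<theta> a faithful,
  order reversing label for points of the section.\<close>

lemma exit_height_strict_antimono:
  assumes "pi < \<theta>" "\<theta> < \<theta>'" "\<theta>' < 2 * pi"
  shows "exit_height \<theta>' < exit_height \<theta>"
proof (rule DERIV_neg_imp_decreasing[OF assms(2)])
  fix x assume "\<theta> \<le> x" "x \<le> \<theta>'"
  then have x: "pi < x" "x < 2 * pi"
    using assms by auto
  have s: "sin x < 0"
    by (rule sin_neg_between[OF x])
  have "exp (- (3/4 * x)) < 1"
    using x pi_gt_zero by auto
  moreover have "exp (- (3/4 * x)) * (3/4 * sin x + cos x) \<le> exp (- (3/4 * x)) * 1"
    using s cos_le_one[of x] by (intro mult_left_mono) (auto simp del: cos_le_one)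
  ultimately have "exp (- (3/4 * x)) * (3/4 * sin x + cos x) - 1 < 0"
    by linarith
  then have "4/5 * ((exp (- (3/4 * x)) * (3/4 * sin x + cos x) - 1) / (sin x)\<^sup>2) < 0"
    using s by (intro mult_pos_neg divide_neg_pos) auto
  then show "\<exists>y. (exit_height has_real_derivative y) (at x) \<and> y < 0"
    using has_real_derivative_exit_height[OF x] by blast
qed

lemma differentiable_exit_height:
  assumes "pi < \<theta>" "\<theta> < 2 * pi"
  shows "exit_height differentiable (at \<theta>)"
  using has_real_derivative_exit_height[OF assms] real_differentiable_def by blast

lemma differentiable_entry_depth:
  assumes "pi < \<theta>" "\<theta> < 2 * pi"
  shows "entry_depth differentiable (at \<theta>)"
  unfolding entry_depth_def[abs_def] real_differentiable_def using sin_neg_between[OF assms]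
  by (auto intro!: derivative_eq_intros exI)

lemma inverse_sin_at_top: "filterlim (\<lambda>\<theta>::real. inverse (- sin \<theta>)) at_top (at_right pi)"
proof (rule filterlim_inverse_at_top)
  have "((\<lambda>\<theta>::real. - sin \<theta>) \<longlongrightarrow> - sin pi) (at_right pi)"
    by (intro tendsto_intros)
  then show "((\<lambda>\<theta>::real. - sin \<theta>) \<longlongrightarrow> 0) (at_right pi)"
    by simp
  show "eventually (\<lambda>\<theta>::real. 0 < - sin \<theta>) (at_right pi)"
    unfolding eventually_at_right_field
    by (intro exI[of _ "2 * pi"]) (use sin_neg_between in \<open>auto simp: pi_gt_zero\<close>)
qed

lemma exit_height_at_top: "filterlim exit_height at_top (at_right pi)"
proof -
  have "((\<lambda>\<theta>. exp (- (3/4 * \<theta>)) - cos \<theta>) \<longlongrightarrow> exp (- (3/4 * pi)) - cos pi) (at_right pi)"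
    by (intro tendsto_intros)
  then have "filterlim (\<lambda>\<theta>. (exp (- (3/4 * \<theta>)) - cos \<theta>) * inverse (- sin \<theta>)) at_top (at_right pi)"
    by (rule filterlim_tendsto_pos_mult_at_top[OF _ _ inverse_sin_at_top]) (auto intro: add_pos_pos)
  then have "filterlim (\<lambda>\<theta>. - (3/4) + (exp (- (3/4 * \<theta>)) - cos \<theta>) * inverse (- sin \<theta>)) at_top (at_right pi)"
    by (rule filterlim_tendsto_add_at_top[OF tendsto_const])
  then have "filterlim (\<lambda>\<theta>. 4/5 * (- (3/4) + (exp (- (3/4 * \<theta>)) - cos \<theta>) * inverse (- sin \<theta>))) at_top (at_right pi)"
    by (rule filterlim_tendsto_pos_mult_at_top[OF tendsto_const, rotated]) simp
  moreover have "exit_height = (\<lambda>\<theta>. 4/5 * (- (3/4) + (exp (- (3/4 * \<theta>)) - cos \<theta>) * inverse (- sin \<theta>)))"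
    unfolding exit_height_def divide_inverse[of "exp _ - _"] by (rule ext) algebra
  ultimately show ?thesis
    by (simp only:)
qed

text \<open>In the difference the cosines cancel and
  \<open>exp (3/4 * \<theta>) - exp (- (3/4 * \<theta>))\<close> remains. Its limit is positive
  because the spirals expand, so the pole of \<open>1 / (- sin \<theta>)\<close> at
  \<open>pi\<close> survives.\<close>

lemma entry_minus_exit_at_top: "filterlim (\<lambda>\<theta>. entry_depth \<theta> - exit_height \<theta>) at_top (at_right pi)"
proof -
  have "((\<lambda>\<theta>. exp (3/4 * \<theta>) - exp (- (3/4 * \<theta>))) \<longlongrightarrow> exp (3/4 * pi) - exp (- (3/4 * pi))) (at_right pi)"
    by (intro tendsto_intros)
  then have "filterlim (\<lambda>\<theta>. (exp (3/4 * \<theta>) - exp (- (3/4 * \<theta>))) * inverse (- sin \<theta>)) at_top (at_right pi)"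
    by (rule filterlim_tendsto_pos_mult_at_top[OF _ _ inverse_sin_at_top]) auto
  then have "filterlim (\<lambda>\<theta>. 3/2 + (exp (3/4 * \<theta>) - exp (- (3/4 * \<theta>))) * inverse (- sin \<theta>)) at_top (at_right pi)"
    by (rule filterlim_tendsto_add_at_top[OF tendsto_const])
  then have "filterlim (\<lambda>\<theta>. 4/5 * (3/2 + (exp (3/4 * \<theta>) - exp (- (3/4 * \<theta>))) * inverse (- sin \<theta>))) at_top (at_right pi)"
    by (rule filterlim_tendsto_pos_mult_at_top[OF tendsto_const, rotated]) simp
  moreover have "(\<lambda>\<theta>. entry_depth \<theta> - exit_height \<theta>) =
      (\<lambda>\<theta>. 4/5 * (3/2 + (exp (3/4 * \<theta>) - exp (- (3/4 * \<theta>))) * inverse (- sin \<theta>)))"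
    unfolding entry_depth_def exit_height_def divide_inverse[of "exp _ - _"] by (rule ext) algebra
  ultimately show ?thesis
    by (simp only:)
qed

text \<open>The root belongs to the arc that leaves \<open>(1, 6/5)\<close> tangentially. At
  \<open>3/2 * pi\<close> the formula reduces to \<open>4/5 * (exp (- (9/8 * pi)) - 3/4)\<close>,
  which is not positive, and towards \<open>pi\<close> the exit height diverges.\<close>

lemma exit_height_root:
  obtains m where "pi < m" "m < 2 * pi" "exit_height m = 0"
proof -
  have "sin (3/2 * pi) = -1" "cos (3/2 * pi) = 0"
    using sin_3over2_pi cos_3over2_pi by auto
  moreover have "exp (- (3/4 * (3/2 * pi))) \<le> 3/4"
  proof -
    have "2 \<le> 1 + 3/4 * (3/2 * pi)"
      using pi_gt3 by simp
    also have "\<dots> \<le> exp (3/4 * (3/2 * pi))"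
      by (rule exp_ge_add_one_self)
    finally have "inverse (exp (3/4 * (3/2 * pi))) \<le> inverse 2"
      by (intro le_imp_inverse_le) auto
    then show ?thesis
      unfolding exp_minus by simp
  qed
  ultimately have right: "exit_height (3/2 * pi) \<le> 0"
    by (simp add: exit_height_def)
  have "eventually (\<lambda>\<theta>. 0 \<le> exit_height \<theta>) (at_right pi)"
    using exit_height_at_top by (simp add: filterlim_at_top)
  moreover have "eventually (\<lambda>\<theta>. \<theta> < 3/2 * pi) (at_right pi)" "eventually (\<lambda>\<theta>. pi < \<theta>) (at_right pi)"
    unfolding eventually_at_right_field using pi_gt_zero
    by (auto intro!: exI[of _ "3/2 * pi"])
  ultimately have "eventually (\<lambda>\<theta>. 0 \<le> exit_height \<theta> \<and> \<theta> < 3/2 * pi \<and> pi < \<theta>) (at_right pi)"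
    by eventually_elim auto
  then obtain a where a: "0 \<le> exit_height a" "a < 3/2 * pi" "pi < a"
    using eventually_happens' trivial_limit_at_right_real by (metis (mono_tags, lifting))
  have "\<forall>x. a \<le> x \<and> x \<le> 3/2 * pi \<longrightarrow> isCont exit_height x"
    using a pi_gt_zero by (auto intro!: DERIV_isCont[OF has_real_derivative_exit_height])
  then obtain m where "a \<le> m" "m \<le> 3/2 * pi" "exit_height m = 0"
    using IVT2[of exit_height "3/2 * pi" 0 a] right a by force
  then show ?thesis
    using a pi_gt_zero by (intro that[of m]) auto
qed

section \<open>Periodic orbits and the section above \<open>(1, 6/5)\<close>\<close>

lemma downward_jumps_linear: "downward_jumps (\<lambda>x. 6/5 * x) (\<lambda>x. 6/5 * x) (\<lambda>x. 6/5 * x)"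
proof -
  have *: "((\<lambda>x. 6/5 * x) \<longlongrightarrow> 6/5 * x) (at x within A)" for x :: real and A
    by (intro tendsto_intros)
  show ?thesis
    unfolding downward_jumps_def by (intro conjI allI impI *) (auto intro!: exI[of _ 0])
qed

text \<open>In the coordinates \<open>x\<^sub>0\<close> and \<open>v\<close> the linear flow is a
  rotation times the factor \<open>e > 1\<close>, so the sum of squares can only return to its
  initial value if it is zero.\<close>

lemma spiral_closed_imp_zero:
  assumes "0 < T" and closed: "spiral x\<^sub>0 v T = spiral x\<^sub>0 v 0"
  shows "spiral x\<^sub>0 v 0 = (0, 0)"
proof -
  define e where "e = exp (3/5 * T)"
  define C where "C = cos (4/5 * T)"
  define S where "S = sin (4/5 * T)"
  have "spiral_x x\<^sub>0 v T = spiral_x x\<^sub>0 v 0" "spiral_dx x\<^sub>0 v T = spiral_dx x\<^sub>0 v 0"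
    using closed by (auto simp: spiral_def)
  then have 1: "e * (x\<^sub>0 * C + v * S) = x\<^sub>0"
    and 2: "e * ((3/5 * x\<^sub>0 + 4/5 * v) * C + (3/5 * v - 4/5 * x\<^sub>0) * S) = 3/5 * x\<^sub>0 + 4/5 * v"
    by (simp_all add: spiral_x_def spiral_dx_def e_def C_def S_def)
  have "e * ((3/5 * x\<^sub>0 + 4/5 * v) * C + (3/5 * v - 4/5 * x\<^sub>0) * S) =
      3/5 * (e * (x\<^sub>0 * C + v * S)) + 4/5 * (e * (v * C - x\<^sub>0 * S))"
    by algebra
  then have 3: "e * (v * C - x\<^sub>0 * S) = v"
    using 1 2 by linarith
  have "C\<^sup>2 + S\<^sup>2 = 1"
    by (simp add: C_def S_def)
  moreover have "(e * (x\<^sub>0 * C + v * S))\<^sup>2 + (e * (v * C - x\<^sub>0 * S))\<^sup>2 = e\<^sup>2 * ((x\<^sub>0\<^sup>2 + v\<^sup>2) * (C\<^sup>2 + S\<^sup>2))"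
    by algebra
  ultimately have "x\<^sub>0\<^sup>2 + v\<^sup>2 = e\<^sup>2 * (x\<^sub>0\<^sup>2 + v\<^sup>2)"
    unfolding 1 3 by simp
  moreover have "1 < e"
    using assms by (simp add: e_def)
  then have "e\<^sup>2 \<noteq> 1"
    by (simp add: power2_eq_1_iff)
  ultimately have "x\<^sub>0\<^sup>2 + v\<^sup>2 = 0"
    by simp
  then have "x\<^sub>0 = 0" "v = 0"
    by (simp_all add: sum_power2_eq_zero_iff)
  then show ?thesis
    by (simp add: spiral_def spiral_x_def spiral_dx_def)
qed

text \<open>An orbit confined to \<open>x < 1\<close> would follow an expanding spiral and could not
  close. One that stays in \<open>x \<ge> 1\<close> gains height at rate at least \<open>1\<close>
  and could not close either. So some passage leads from \<open>x \<ge> 1\<close> to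
  \<open>x < 1\<close>; at its last time with \<open>x \<ge> 1\<close> the orbit is on
  \<open>x = 1\<close>, and below \<open>6/5\<close> the field of the spiral zone would push it back
  to the right.\<close>

lemma periodic_orbit_meets_section:
  assumes adm: "downward_jumps F L R" and lin: "\<And>x. x < 1 \<Longrightarrow> L x = 6/5 * x \<and> R x = 6/5 * x"
    and "periodic_orbit F \<Gamma>"
  obtains y where "6/5 \<le> y" "(1, y) \<in> \<Gamma>"
proof -
  obtain \<gamma> T where sol: "filippov_solution F \<gamma>" and T: "T > 0" and per: "\<And>t. \<gamma> (t + T) = \<gamma> t"
    and nonconst: "\<exists>t. \<gamma> t \<noteq> \<gamma> 0" and \<Gamma>: "\<Gamma> = range \<gamma>"
    using assms(3) by (auto simp: periodic_orbit_def periodic_solution_def)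
  obtain v where v: "\<And>t. v t \<in> jump_field L R (\<gamma> t)" "\<And>s t. s \<le> t \<Longrightarrow> (v has_integral (\<gamma> t - \<gamma> s)) {s..t}"
    using sol unfolding filippov_solution_def filippov_set_jump_field[OF adm] by blast
  have v1: "((\<lambda>t. fst (v t)) has_integral (fst (\<gamma> t) - fst (\<gamma> s))) {s..t}"
    and v2: "((\<lambda>t. fst (\<gamma> t)) has_integral (snd (\<gamma> t) - snd (\<gamma> s))) {s..t}" if "s \<le> t" for s t
  proof -
    show "((\<lambda>t. fst (v t)) has_integral (fst (\<gamma> t) - fst (\<gamma> s))) {s..t}"
      using has_integral_linear[OF v(2)[OF that] bounded_linear_fst] by (simp add: o_def)
    have "snd (v t) = fst (\<gamma> t)" for t
      using v(1)[of t] by (auto simp: jump_field_def)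
    then show "((\<lambda>t. fst (\<gamma> t)) has_integral (snd (\<gamma> t) - snd (\<gamma> s))) {s..t}"
      using has_integral_linear[OF v(2)[OF that] bounded_linear_snd] by (simp add: o_def)
  qed
  have cont: "continuous_on {a..b} \<gamma>" for a b
    by (rule traj_continuous[OF filippov_solution_traj[OF sol]])
  have "\<exists>t. 1 \<le> fst (\<gamma> t)"
  proof (rule ccontr)
    assume "\<nexists>t. 1 \<le> fst (\<gamma> t)"
    then have lt: "fst (\<gamma> t) < 1" for t
      by (simp add: not_le)
    let ?lin = "jump_field (\<lambda>x. 6/5 * x) (\<lambda>x. 6/5 * x)"
    have v_lin: "v t \<in> ?lin (\<gamma> t)" for t
      using v(1)[of t] lin[OF lt] by (auto simp: jump_field_def)
    have "\<gamma> s = (0, 0)" for s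
    proof -
      obtain x\<^sub>0 y\<^sub>0 where xy: "\<gamma> s = (x\<^sub>0, y\<^sub>0)" by fastforce
      define w where "w = 5/4 * (3/5 * x\<^sub>0 - y\<^sub>0)"
      have init: "spiral x\<^sub>0 w 0 = \<gamma> s"
        by (simp add: spiral_def spiral_x_def spiral_dx_def xy w_def field_simps)
      have "traj ?lin \<gamma> s (s + T)"
        using v_lin v(2) by (intro trajI) auto
      then have "traj ?lin (\<lambda>t. \<gamma> (t + s)) 0 T"
        using traj_shift[of ?lin \<gamma> s "s + T" "- s"] by simp
      moreover have "traj ?lin (spiral x\<^sub>0 w) 0 T"
        by (rule traj_of_derivative[OF has_vector_derivative_spiral])
          (auto simp: jump_field_def spiral_def)
      ultimately have "\<gamma> (T + s) = spiral x\<^sub>0 w T"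
        using one_sided_lipschitz.traj_unique[OF one_sided_lipschitz_jump_field[OF downward_jumps_linear],
            of "\<lambda>t. \<gamma> (t + s)" T "spiral x\<^sub>0 w"] init T by simp
      then have "spiral x\<^sub>0 w T = spiral x\<^sub>0 w 0"
        using init per[of s] by (simp add: add.commute)
      from spiral_closed_imp_zero[OF T this] show ?thesis
        using init by simp
    qed
    then show False
      using nonconst by simp
  qed
  then obtain a where a: "1 \<le> fst (\<gamma> a)" by blast
  have "\<exists>b>a. fst (\<gamma> b) < 1"
  proof (rule ccontr)
    assume "\<not> (\<exists>b>a. fst (\<gamma> b) < 1)"
    then have ge: "1 \<le> fst (\<gamma> t)" if "t \<in> {a..a + T}" for t
      using a that by (metis atLeastAtMost_iff le_less not_less)
    have "((\<lambda>_. 1) has_integral T) {a..a + T}"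
      using has_integral_const_real[of "1::real" a "a + T"] T by simp
    then have "T \<le> snd (\<gamma> (a + T)) - snd (\<gamma> a)"
      using v2[of a "a + T"] T ge by (intro has_integral_le[of "\<lambda>_. 1" T "{a..a + T}" "\<lambda>t. fst (\<gamma> t)"]) auto
    then show False
      using per[of a] T by simp
  qed
  then obtain b where b: "a < b" "fst (\<gamma> b) < 1" by blast
  define A where "A = {t\<in>{a..b}. 1 \<le> fst (\<gamma> t)}"
  have "closed A"
    unfolding A_def by (intro continuous_on_closed_Collect_le continuous_intros cont)
  moreover have "bounded A"
    by (rule bounded_subset[of "{a..b}"]) (auto simp: A_def)
  moreover have "a \<in> A"
    using a b by (simp add: A_def)
  ultimately obtain c where c: "c \<in> A" "\<And>t. t \<in> A \<Longrightarrow> t \<le> c"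
    using compact_attains_sup[of A] compact_eq_bounded_closed by blast
  then have cab: "a \<le> c" "c < b" "1 \<le> fst (\<gamma> c)"
    using b by (auto simp: A_def less_le)
  have after: "fst (\<gamma> t) < 1" if "c < t" "t \<le> b" for t
    using c(2)[of t] that cab by (force simp: A_def)
  have "fst (\<gamma> c) \<le> 1"
  proof (rule ccontr)
    assume "\<not> fst (\<gamma> c) \<le> 1"
    then have pos: "0 < fst (\<gamma> c) - 1"
      by simp
    have "continuous_on {c..b} (\<lambda>t. fst (\<gamma> t))"
      by (intro continuous_intros cont)
    then obtain d where d: "0 < d" "\<And>t. t \<in> {c..b} \<Longrightarrow> dist t c < d \<Longrightarrow>
        dist (fst (\<gamma> t)) (fst (\<gamma> c)) < fst (\<gamma> c) - 1"
      using pos cab unfolding continuous_on_iff by (metis atLeastAtMost_iff less_le order_refl)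
    define e where "e = min b (c + d / 2)"
    have e: "c < e" "e \<le> b" "e < c + d"
      using d cab by (auto simp: e_def)
    then show False
      using d(2)[of e] after[of e] by (auto simp: dist_real_def)
  qed
  then have c1: "fst (\<gamma> c) = 1"
    using cab by simp
  have "6/5 \<le> snd (\<gamma> c)"
  proof (rule ccontr)
    assume "\<not> 6/5 \<le> snd (\<gamma> c)"
    then have pos: "0 < 6/5 * fst (\<gamma> c) - snd (\<gamma> c)"
      using c1 by simp
    have "continuous_on {c..b} (\<lambda>t. 6/5 * fst (\<gamma> t) - snd (\<gamma> t))"
      by (intro continuous_intros cont)
    then obtain d where d: "0 < d" "\<And>t. t \<in> {c..b} \<Longrightarrow> dist t c < d \<Longrightarrow>
        dist (6/5 * fst (\<gamma> t) - snd (\<gamma> t)) (6/5 * fst (\<gamma> c) - snd (\<gamma> c)) < 6/5 * fst (\<gamma> c) - snd (\<gamma> c)"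
      using pos cab unfolding continuous_on_iff by (metis atLeastAtMost_iff less_le order_refl)
    define e where "e = min b (c + d / 2)"
    have e: "c < e" "e \<le> b" "e < c + d"
      using d cab by (auto simp: e_def)
    \<comment> \<open>On the line itself the field may be multivalued, so the velocity at the single
      time \<open>c\<close> is replaced by \<open>0\<close>.\<close>
    have "0 \<le> fst (if t = c then 0 else v t)" if "t \<in> {c..e}" for t
    proof (cases "t = c")
      case False
      then have "fst (\<gamma> t) < 1"
        using that e by (intro after) auto
      then have "fst (v t) = 6/5 * fst (\<gamma> t) - snd (\<gamma> t)"
        using v(1)[of t] lin by (auto simp: jump_field_def)
      moreover have "0 < 6/5 * fst (\<gamma> t) - snd (\<gamma> t)"
        using d(2)[of t] that e by (auto simp: dist_real_def abs_less_iff)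
      ultimately show ?thesis
        using False by simp
    qed auto
    moreover have "((\<lambda>t. fst (if t = c then 0 else v t)) has_integral (fst (\<gamma> e) - fst (\<gamma> c))) {c..e}"
      using v1[of c e] e by (intro has_integral_spike_finite[OF _ _ v1[of c e], of "{c}"]) auto
    ultimately have "0 \<le> fst (\<gamma> e) - fst (\<gamma> c)"
      using has_integral_nonneg by blast
    then show False
      using after[of e] e c1 by simp
  qed
  then show ?thesis
    using that[of "snd (\<gamma> c)"] c1 \<Gamma> by (metis prod.collapse rangeI)
qed

subsection \<open>Adding a jump\<close>

definition top_pt :: "real \<Rightarrow> real \<times> real" where
  "top_pt \<theta> = (1, 6/5 + exit_height \<theta>)"

text \<open>The one-sided limits themselves are excluded as well: the ends of a sliding segment lie
  on a switching line but not in the crossing set.\<close>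

definition off_sliding :: "(real \<Rightarrow> real) \<Rightarrow> (real \<Rightarrow> real) \<Rightarrow> real \<Rightarrow> (real \<times> real) set" where
  "off_sliding L R X = {(x, y). x < X \<and> (R x < L x \<longrightarrow> y < R x \<or> L x < y)}"

text \<open>Removing the section lets an arc inside \<open>safe\<close> together with one
  \<open>top_pt\<close> meet the section at that point only. This is what later leaves room for a
  window around the hit of a crossing cycle.\<close>

definition safe :: "(real \<Rightarrow> real) \<Rightarrow> (real \<Rightarrow> real) \<Rightarrow> real \<Rightarrow> (real \<times> real) set" where
  "safe L R X = off_sliding L R X - {1} \<times> {6/5..}"

definition isolated_crossing :: "(real \<Rightarrow> real) \<Rightarrow> (real \<Rightarrow> real) \<Rightarrow> (real \<Rightarrow> real) \<Rightarrow> real \<Rightarrow> (real \<times> real) set \<Rightarrow> bool" where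
  "isolated_crossing F L R X \<Gamma> \<longleftrightarrow> periodic_orbit F \<Gamma> \<and> \<Gamma> \<subseteq> off_sliding L R X \<and>
     (\<exists>z\<in>\<Gamma>. R (fst z) < L (fst z)) \<and>
     (\<exists>U. open U \<and> \<Gamma> \<subseteq> U \<and> (\<forall>\<Gamma>'. periodic_orbit F \<Gamma>' \<and> \<Gamma>' \<noteq> \<Gamma> \<longrightarrow> \<not> \<Gamma>' \<subseteq> U))"

text \<open>Isolation is not recorded here: it comes at the end, from the finiteness of the set of
  all sliding periodic orbits.\<close>

definition sliding_orbit :: "(real \<Rightarrow> real) \<Rightarrow> (real \<Rightarrow> real) \<Rightarrow> (real \<Rightarrow> real) \<Rightarrow> real \<Rightarrow> (real \<times> real) set \<Rightarrow> bool" where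
  "sliding_orbit F L R X \<Gamma> \<longleftrightarrow> periodic_orbit F \<Gamma> \<and> \<Gamma> \<subseteq> {..<X} \<times> UNIV \<and>
     (\<exists>z\<in>\<Gamma>. R (fst z) < snd z \<and> snd z < L (fst z))"

text \<open>Divergence at \<open>l\<close> puts a larger value at some \<open>a\<close> to the left
  of a chosen \<open>b\<close>; the mean value theorem between them gives a negative derivative, and
  staying left of \<open>e\<close> keeps the value above \<open>K\<close>.\<close>

lemma exists_decreasing_point:
  fixes f :: "real \<Rightarrow> real"
  assumes top: "filterlim f at_top (at_right l)" and "l < m"
    and diff: "\<And>x. l < x \<Longrightarrow> x < m \<Longrightarrow> f differentiable (at x)"
  obtains x f' where "l < x" "x < m" "K < f x" "(f has_real_derivative f') (at x)" "f' < 0"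
proof -
  have "eventually (\<lambda>x. K < f x) (at_right l)"
    using top by (simp add: filterlim_at_top_dense)
  then obtain e where e: "l < e" "\<And>x. l < x \<Longrightarrow> x < e \<Longrightarrow> K < f x"
    unfolding eventually_at_right_field by blast
  obtain b where b: "l < b" "b < min e m"
    using dense[of l "min e m"] e \<open>l < m\<close> by auto
  have "eventually (\<lambda>x. f b < f x) (at_right l)"
    using top by (simp add: filterlim_at_top_dense)
  then obtain d where d: "l < d" "\<And>x. l < x \<Longrightarrow> x < d \<Longrightarrow> f b < f x"
    unfolding eventually_at_right_field by blast
  obtain a where a: "l < a" "a < min d b"
    using dense[of l "min d b"] d b by auto
  have "\<exists>z' z. a < z \<and> z < b \<and> (f has_real_derivative z') (at z) \<and> f b - f a = (b - a) * z'"
  proof (rule MVT)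
    show "continuous_on {a..b} f"
      using a b diff by (intro continuous_at_imp_continuous_on ballI differentiable_imp_continuous_within) auto
  qed (use a b diff in auto)
  then obtain z z' where z: "a < z" "z < b" "(f has_real_derivative z') (at z)" "f b - f a = (b - a) * z'"
    by blast
  have "(b - a) * z' < 0"
    using z d(2)[of a] a by simp
  then have "z' < 0"
    using a by (simp add: mult_less_0_iff)
  then show ?thesis
    using that[of z z'] z a b e(2)[of z] by auto
qed

text \<open>
  \<open>F\<close> has all its jumps left of \<open>X\<close>, where the next one will be. The parameter \<open>\<theta>\<close> decreases to \<open>pi\<close> as
  the amplitude grows to infinity, and \<open>m\<close> belongs to the orbit that is tangent to the line at \<open>X\<close>.
\<close>
locale stage =
  fixes F L R :: "real \<Rightarrow> real" and X c :: real and D H :: "real \<Rightarrow> real" and m :: real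
  assumes adm: "downward_jumps F L R" and X1: "1 \<le> X"
    and lin: "\<And>x. x < 1 \<Longrightarrow> L x = 6/5 * x \<and> R x = 6/5 * x" and L1: "L 1 = 6/5"
    and flat: "\<And>x. X \<le> x \<Longrightarrow> L x = c \<and> R x = c"
    and m: "pi < m" "m < 2 * pi" "0 \<le> exit_height m"
    and down: "\<And>\<theta>. pi < \<theta> \<Longrightarrow> \<theta> \<le> m \<Longrightarrow>
      reach (jump_field L R) (safe L R X \<union> {top_pt \<theta>, (X, c - D \<theta>)}) (top_pt \<theta>) (X, c - D \<theta>)"
    and up: "\<And>\<theta>. pi < \<theta> \<Longrightarrow> \<theta> \<le> m \<Longrightarrow>
      reach (jump_field L R) (safe L R X \<union> {top_pt \<theta>, (X, c + H \<theta>)}) (X, c + H \<theta>) (top_pt \<theta>)"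
    and first: "X = 1 \<Longrightarrow> H \<theta> = exit_height \<theta>"
    and Hm: "H m = 0" and Dm: "0 < D m"
    and diff_D: "\<And>\<theta>. pi < \<theta> \<Longrightarrow> \<theta> < m \<Longrightarrow> D differentiable (at \<theta>)"
    and diff_H: "\<And>\<theta>. pi < \<theta> \<Longrightarrow> \<theta> < m \<Longrightarrow> H differentiable (at \<theta>)"
    and cont_H: "continuous_on {pi<..m} H"
    and anti_H: "\<And>s t. pi < s \<Longrightarrow> s < t \<Longrightarrow> t \<le> m \<Longrightarrow> H t < H s"
    and D_minus_H: "filterlim (\<lambda>\<theta>. D \<theta> - H \<theta>) at_top (at_right pi)"
    and H_at_top: "filterlim H at_top (at_right pi)"
begin

lemma RL: "R x \<le> L x"
  using adm by (simp add: downward_jumps_def)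

lemma exit_height_anti: "pi < s \<Longrightarrow> s < t \<Longrightarrow> t \<le> m \<Longrightarrow> exit_height t < exit_height s"
  using m by (intro exit_height_strict_antimono) auto

lemma exit_height_pos: "pi < \<theta> \<Longrightarrow> \<theta> < m \<Longrightarrow> 0 < exit_height \<theta>"
  using exit_height_anti[of \<theta> m] m by simp

lemma H_pos: "pi < \<theta> \<Longrightarrow> \<theta> < m \<Longrightarrow> 0 < H \<theta>"
  using anti_H[of \<theta> m] Hm by simp

text \<open>Together with its companion to the right, this assigns a parameter to the point where a
  return lands on the line at \<open>X\<close>.\<close>

lemma H_onto_left:
  assumes "pi < \<theta>" "\<theta> \<le> m" "H \<theta> < y"
  obtains \<theta>' where "pi < \<theta>'" "\<theta>' < \<theta>" "H \<theta>' = y"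
proof -
  have "eventually (\<lambda>x. y < H x) (at_right pi)"
    using H_at_top by (simp add: filterlim_at_top_dense)
  then obtain e where e: "pi < e" "\<And>x. pi < x \<Longrightarrow> x < e \<Longrightarrow> y < H x"
    unfolding eventually_at_right_field by blast
  obtain b where b: "pi < b" "b < min e \<theta>"
    using dense[of pi "min e \<theta>"] e assms by auto
  have "\<exists>x\<ge>b. x \<le> \<theta> \<and> H x = y"
    using b e(2)[of b] assms
    by (intro IVT2') (auto intro: continuous_on_subset[OF cont_H])
  then obtain x where "b \<le> x" "x \<le> \<theta>" "H x = y" by blast
  then show ?thesis
    using that[of x] b assms by (cases "x = \<theta>") auto
qed

lemma H_onto_right:
  assumes "pi < \<theta>" "\<theta> \<le> m" "y < H \<theta>" "0 < y"
  obtains \<theta>' where "\<theta> < \<theta>'" "\<theta>' \<le> m" "H \<theta>' = y"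
proof -
  have "\<exists>x\<ge>\<theta>. x \<le> m \<and> H x = y"
    using assms Hm by (intro IVT2') (auto intro: continuous_on_subset[OF cont_H])
  then obtain x where "\<theta> \<le> x" "x \<le> m" "H x = y" by blast
  then show ?thesis
    using that[of x] assms by (cases "x = \<theta>") auto
qed

end

text \<open>
  The jump at \<open>X\<close> has size \<open>\<Delta>\<close>. The crossing cycle belongs to \<open>a\<close>, and the next line is placed where
  the orbit belonging to \<open>b\<close> is tangent to it.
\<close>
locale jump_stage = stage +
  fixes \<Delta> a b :: real
  assumes \<Delta>: "D m < \<Delta>" and a: "pi < a" "a < m" "D a - H a = 2 * \<Delta>"
    and b: "pi < b" "b < a" and beyond: "\<And>\<theta>. pi < \<theta> \<Longrightarrow> \<theta> \<le> b \<Longrightarrow> 2 * \<Delta> < D \<theta> - H \<theta>"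
begin

text \<open>The factor \<open>1 + sgn (x - X)\<close> vanishes left of \<open>X\<close>, so earlier
  orbits keep their field, and it fits the normal form with \<open>sgn\<close>.\<close>

definition F' :: "real \<Rightarrow> real" where "F' = (\<lambda>x. F x - \<Delta> / 2 * (1 + sgn (x - X)))"
definition L' :: "real \<Rightarrow> real" where "L' = (\<lambda>x. L x - (if X < x then \<Delta> else 0))"
definition R' :: "real \<Rightarrow> real" where "R' = (\<lambda>x. R x - (if X \<le> x then \<Delta> else 0))"
text \<open>Beyond \<open>X\<close> orbits are circles about \<open>(0, c')\<close>. The circle
  through \<open>(X, c + H b)\<close> is at vertical distance \<open>w\<close> from the centre
  there, so its radius is \<open>X'\<close> and it touches the line at \<open>X'\<close>.\<close>

definition w :: real where "w = H b + \<Delta>"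
definition X' :: real where "X' = sqrt (X\<^sup>2 + w\<^sup>2)"
definition c' :: real where "c' = c - \<Delta>"
text \<open>Pythagoras: \<open>D'\<close> and \<open>H'\<close> are the vertical distances from
  \<open>c'\<close>, on the line at \<open>X'\<close>, of the circles about \<open>(0, c')\<close>
  through \<open>(X, c - D \<theta>)\<close> and \<open>(X, c + H \<theta>)\<close>.\<close>

definition D' :: "real \<Rightarrow> real" where "D' = (\<lambda>\<theta>. sqrt ((D \<theta> - \<Delta>)\<^sup>2 - w\<^sup>2))"
definition H' :: "real \<Rightarrow> real" where "H' = (\<lambda>\<theta>. sqrt ((H \<theta> + \<Delta>)\<^sup>2 - w\<^sup>2))"

section \<open>Geometry of the enlarged system\<close>

lemma \<Delta>_pos: "0 < \<Delta>"
  using \<Delta> Dm by simp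

lemma w_pos: "0 < w"
  unfolding w_def using H_pos[of b] \<Delta>_pos a b by simp

lemma X_less: "X < X'"
proof -
  have "X = sqrt (X\<^sup>2)"
    using X1 by simp
  also have "\<dots> < X'"
    unfolding X'_def using w_pos by (intro real_sqrt_less_mono) simp
  finally show ?thesis .
qed

lemma X'_sq: "X'\<^sup>2 = X\<^sup>2 + w\<^sup>2"
  by (simp add: X'_def)

lemma adm': "downward_jumps F' L' R'"
proof -
  have sgn: "((\<lambda>u. sgn (u - X)) \<longlongrightarrow> (if X < x then 1 else - 1)) (at_left x)"
    "((\<lambda>u. sgn (u - X)) \<longlongrightarrow> (if X \<le> x then 1 else - 1)) (at_right x)" for x
  proof -
    have "eventually (\<lambda>u. sgn (u - X) = (if X < x then 1 else - 1)) (at_left x)"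
      unfolding eventually_at_left_field
      by (intro exI[of _ "if X < x then X else x - 1"]) auto
    then show "((\<lambda>u. sgn (u - X)) \<longlongrightarrow> (if X < x then 1 else - 1)) (at_left x)"
      by (rule tendsto_eventually)
    have "eventually (\<lambda>u. sgn (u - X) = (if X \<le> x then 1 else - 1)) (at_right x)"
      unfolding eventually_at_right_field
      by (intro exI[of _ "if X \<le> x then x + 1 else X"]) auto
    then show "((\<lambda>u. sgn (u - X)) \<longlongrightarrow> (if X \<le> x then 1 else - 1)) (at_right x)"
      by (rule tendsto_eventually)
  qed
  have "(F' \<longlongrightarrow> L' x) (at_left x)" "(F' \<longlongrightarrow> R' x) (at_right x)" for x
  proof -
    have "(F \<longlongrightarrow> L x) (at_left x)" "(F \<longlongrightarrow> R x) (at_right x)"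
      using adm by (auto simp: downward_jumps_def)
    note lim = this[THEN tendsto_diff, OF tendsto_mult_left[OF tendsto_add[OF tendsto_const]]]
    have "(F' \<longlongrightarrow> L x - \<Delta> / 2 * (1 + (if X < x then 1 else - 1))) (at_left x)"
      "(F' \<longlongrightarrow> R x - \<Delta> / 2 * (1 + (if X \<le> x then 1 else - 1))) (at_right x)"
      unfolding F'_def by (rule lim(1)[OF sgn(1)], rule lim(2)[OF sgn(2)])
    moreover have "L x - \<Delta> / 2 * (1 + (if X < x then 1 else - 1)) = L' x"
      "R x - \<Delta> / 2 * (1 + (if X \<le> x then 1 else - 1)) = R' x"
      by (auto simp: L'_def R'_def)
    ultimately show "(F' \<longlongrightarrow> L' x) (at_left x)" "(F' \<longlongrightarrow> R' x) (at_right x)"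
      by simp_all
  qed
  moreover have "R' x \<le> L' x" for x
    using RL[of x] \<Delta>_pos by (auto simp: L'_def R'_def)
  moreover have "L' y - R' x \<le> 6/5 * (y - x)" if "x < y" for x y
  proof -
    have "L y - R x \<le> 6/5 * (y - x)"
      using adm that by (auto simp: downward_jumps_def)
    then show ?thesis
      using \<Delta>_pos that by (auto simp: L'_def R'_def)
  qed
  moreover have "\<exists>C. \<forall>x. \<bar>L' x\<bar> \<le> C + 6/5 * \<bar>x\<bar> \<and> \<bar>R' x\<bar> \<le> C + 6/5 * \<bar>x\<bar>"
  proof -
    obtain C where C: "\<And>x. \<bar>L x\<bar> \<le> C + 6/5 * \<bar>x\<bar>" "\<And>x. \<bar>R x\<bar> \<le> C + 6/5 * \<bar>x\<bar>"
      using adm unfolding downward_jumps_def by blast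
    have "\<bar>L' x\<bar> \<le> (C + \<Delta>) + 6/5 * \<bar>x\<bar> \<and> \<bar>R' x\<bar> \<le> (C + \<Delta>) + 6/5 * \<bar>x\<bar>" for x
      using C[of x] \<Delta>_pos by (auto simp: L'_def R'_def)
    then show ?thesis by blast
  qed
  ultimately show ?thesis
    unfolding downward_jumps_def by blast
qed

lemma RL': "R' x \<le> L' x"
  using adm' by (simp add: downward_jumps_def)

lemma osl': "one_sided_lipschitz (filippov_set F') (6/5)"
  unfolding filippov_set_jump_field[OF adm'] by (rule one_sided_lipschitz_jump_field[OF adm'])

lemma at_X: "L' X = c" "R' X = c - \<Delta>"
  using flat[of X] by (auto simp: L'_def R'_def)

lemma flat': "X < x \<Longrightarrow> L' x = c' \<and> R' x = c'"
  using flat[of x] by (auto simp: L'_def R'_def c'_def)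

text \<open>At \<open>X\<close> itself only the right limit drops, so the new set contains the old
  one and old arcs ending on the line remain trajectories.\<close>

lemma jump_field_mono: "fst z \<le> X \<Longrightarrow> jump_field L R z \<subseteq> jump_field L' R' z"
  using \<Delta>_pos by (auto simp: jump_field_def L'_def R'_def)

lemma off_sliding_mono: "off_sliding L R X \<subseteq> off_sliding L' R' X'"
  using X_less by (auto simp: off_sliding_def L'_def R'_def)

lemma safe_mono: "safe L R X \<subseteq> safe L' R' X'"
  using off_sliding_mono by (auto simp: safe_def)

lemma safe_beyond: "X < fst z \<Longrightarrow> fst z < X' \<Longrightarrow> z \<in> safe L' R' X'"
  using X1 flat'[of "fst z"] by (auto simp: safe_def off_sliding_def)

lemma c_first: "X = 1 \<Longrightarrow> c = 6/5"
  using L1 flat[of 1] by auto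

lemma lower_X_safe: "\<Delta> < y \<Longrightarrow> (X, c - y) \<in> safe L' R' X'"
  using X_less at_X \<Delta>_pos c_first by (auto simp: safe_def off_sliding_def)

text \<open>For \<open>X = 1\<close> the line of the jump is the section itself; the point is then
  \<open>top_pt \<theta>\<close>, which \<open>safe\<close> excludes.\<close>

lemma upper_X_safe: "pi < \<theta> \<Longrightarrow> \<theta> < m \<Longrightarrow> (X, c + H \<theta>) \<in> safe L' R' X' \<union> {top_pt \<theta>}"
  using X_less at_X \<Delta>_pos c_first H_pos[of \<theta>] first X1
  by (cases "X = 1") (auto simp: safe_def off_sliding_def top_pt_def)

lemma safe_le_X: "z \<in> safe L R X \<Longrightarrow> fst z \<le> X"
  by (auto simp: safe_def off_sliding_def)

lemma down_old:
  assumes "pi < \<theta>" "\<theta> \<le> m"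
  shows "reach (jump_field L' R') (safe L R X \<union> {top_pt \<theta>, (X, c - D \<theta>)}) (top_pt \<theta>) (X, c - D \<theta>)"
  by (rule reach_mono[OF down[OF assms] jump_field_mono order_refl])
    (use X1 safe_le_X in \<open>auto simp: top_pt_def\<close>)

lemma up_old:
  assumes "pi < \<theta>" "\<theta> \<le> m"
  shows "reach (jump_field L' R') (safe L R X \<union> {top_pt \<theta>, (X, c + H \<theta>)}) (X, c + H \<theta>) (top_pt \<theta>)"
  by (rule reach_mono[OF up[OF assms] jump_field_mono order_refl])
    (use X1 safe_le_X in \<open>auto simp: top_pt_def\<close>)

text \<open>\<open>D \<theta> - \<Delta>\<close> and \<open>H \<theta> + \<Delta>\<close> are the
  distances of the two arcs from the height \<open>c'\<close> on the line at \<open>X\<close>; the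
  arcs reach the line at \<open>X'\<close> when these are at least \<open>w\<close>.\<close>

lemma below_b:
  assumes "pi < \<theta>" "\<theta> \<le> b"
  shows "w \<le> H \<theta> + \<Delta>" "H \<theta> + \<Delta> < D \<theta> - \<Delta>" "w\<^sup>2 \<le> (H \<theta> + \<Delta>)\<^sup>2" "w\<^sup>2 < (D \<theta> - \<Delta>)\<^sup>2"
proof -
  show 1: "w \<le> H \<theta> + \<Delta>"
    using anti_H[of \<theta> b] assms a b by (cases "\<theta> = b") (auto simp: w_def)
  show 2: "H \<theta> + \<Delta> < D \<theta> - \<Delta>"
    using beyond[OF assms] by simp
  show "w\<^sup>2 \<le> (H \<theta> + \<Delta>)\<^sup>2" "w\<^sup>2 < (D \<theta> - \<Delta>)\<^sup>2"
    using 1 2 w_pos by (auto intro!: power_mono power_strict_mono)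
qed

lemma down':
  assumes "pi < \<theta>" "\<theta> \<le> b"
  shows "reach (jump_field L' R') (safe L' R' X' \<union> {top_pt \<theta>, (X', c' - D' \<theta>)}) (top_pt \<theta>) (X', c' - D' \<theta>)"
proof (rule reach_trans)
  have \<theta>: "\<theta> \<le> m"
    using assms a b by simp
  have pos: "0 < D \<theta> - \<Delta>"
    using below_b[OF assms] w_pos by simp
  have D: "\<Delta> < D \<theta>"
    using pos by simp
  show "reach (jump_field L' R') (safe L' R' X' \<union> {top_pt \<theta>, (X', c' - D' \<theta>)}) (top_pt \<theta>) (X, c - D \<theta>)"
    using lower_X_safe[OF D] safe_mono by (intro reach_superset[OF down_old[OF assms(1) \<theta>]]) auto
  define \<rho> where "\<rho> = sqrt (X\<^sup>2 + (D \<theta> - \<Delta>)\<^sup>2)"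
  have \<rho>: "\<rho>\<^sup>2 - X\<^sup>2 = (D \<theta> - \<Delta>)\<^sup>2" "\<rho>\<^sup>2 - X'\<^sup>2 = (D \<theta> - \<Delta>)\<^sup>2 - w\<^sup>2"
    by (simp_all add: \<rho>_def X'_sq)
  have e1: "(X, c' - sqrt (\<rho>\<^sup>2 - X\<^sup>2)) = (X, c - D \<theta>)" and e2: "(X', c' - sqrt (\<rho>\<^sup>2 - X'\<^sup>2)) = (X', c' - D' \<theta>)"
    unfolding \<rho> using pos by (auto simp: c'_def D'_def)
  have "X' \<le> \<rho>"
    unfolding X'_def \<rho>_def using below_b[OF assms] by simp
  then have "reach (jump_field L' R') (safe L' R' X' \<union> {top_pt \<theta>, (X', c' - D' \<theta>)})
      (X, c' - sqrt (\<rho>\<^sup>2 - X\<^sup>2)) (X', c' - sqrt (\<rho>\<^sup>2 - X'\<^sup>2))"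
    using X1 X_less RL' flat' safe_beyond lower_X_safe[OF D] unfolding e1 e2
    by (intro reach_lower_arc[of R' L' X X' \<rho> c', unfolded e1 e2]) auto
  then show "reach (jump_field L' R') (safe L' R' X' \<union> {top_pt \<theta>, (X', c' - D' \<theta>)}) (X, c - D \<theta>) (X', c' - D' \<theta>)"
    unfolding e1 e2 .
qed

lemma up':
  assumes "pi < \<theta>" "\<theta> \<le> b"
  shows "reach (jump_field L' R') (safe L' R' X' \<union> {top_pt \<theta>, (X', c' + H' \<theta>)}) (X', c' + H' \<theta>) (top_pt \<theta>)"
proof (rule reach_trans)
  have \<theta>: "\<theta> < m"
    using assms a b by simp
  have pos: "0 < H \<theta> + \<Delta>"
    using below_b[OF assms] w_pos by simp
  show "reach (jump_field L' R') (safe L' R' X' \<union> {top_pt \<theta>, (X', c' + H' \<theta>)}) (X, c + H \<theta>) (top_pt \<theta>)"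
    using upper_X_safe[OF assms(1) \<theta>] safe_mono \<theta>
    by (intro reach_superset[OF up_old[OF assms(1)]]) auto
  define \<rho> where "\<rho> = sqrt (X\<^sup>2 + (H \<theta> + \<Delta>)\<^sup>2)"
  have \<rho>: "\<rho>\<^sup>2 - X\<^sup>2 = (H \<theta> + \<Delta>)\<^sup>2" "\<rho>\<^sup>2 - X'\<^sup>2 = (H \<theta> + \<Delta>)\<^sup>2 - w\<^sup>2"
    by (simp_all add: \<rho>_def X'_sq)
  have e1: "(X, c' + sqrt (\<rho>\<^sup>2 - X\<^sup>2)) = (X, c + H \<theta>)" and e2: "(X', c' + sqrt (\<rho>\<^sup>2 - X'\<^sup>2)) = (X', c' + H' \<theta>)"
    unfolding \<rho> using pos by (auto simp: c'_def H'_def)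
  have "X' \<le> \<rho>"
    unfolding X'_def \<rho>_def using below_b[OF assms] by simp
  then have "reach (jump_field L' R') (safe L' R' X' \<union> {top_pt \<theta>, (X', c' + H' \<theta>)})
      (X', c' + sqrt (\<rho>\<^sup>2 - X'\<^sup>2)) (X, c' + sqrt (\<rho>\<^sup>2 - X\<^sup>2))"
    using X1 X_less RL' flat' safe_beyond upper_X_safe[OF assms(1) \<theta>] unfolding e1 e2
    by (intro reach_upper_arc[of R' L' X X' \<rho> c', unfolded e1 e2]) auto
  then show "reach (jump_field L' R') (safe L' R' X' \<union> {top_pt \<theta>, (X', c' + H' \<theta>)}) (X', c' + H' \<theta>) (X, c + H \<theta>)"
    unfolding e1 e2 .
qed

text \<open>At \<open>b\<close> the radicand of \<open>H'\<close> vanishes. That is why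
  \<open>stage\<close> asks for differentiability strictly left of \<open>m\<close> but for
  continuity of \<open>H\<close> up to \<open>m\<close>.\<close>

lemma stage': "stage F' L' R' X' c' D' H' b"
proof
  show "downward_jumps F' L' R'" by (rule adm')
  show "1 \<le> X'" using X1 X_less by simp
  show "L' x = 6/5 * x \<and> R' x = 6/5 * x" if "x < 1" for x
    using lin[OF that] that X1 by (auto simp: L'_def R'_def)
  show "L' 1 = 6/5"
    using L1 X1 by (auto simp: L'_def)
  show "L' x = c' \<and> R' x = c'" if "X' \<le> x" for x
    using X_less that by (intro flat') simp
  show "pi < b" "b < 2 * pi" "0 \<le> exit_height b"
    using a b m exit_height_pos[of b] by auto
  show "H' \<theta> = exit_height \<theta>" if "X' = 1" for \<theta>
    using that X1 X_less by simp
  show "H' b = 0"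
    by (simp add: H'_def w_def)
  show "0 < D' b"
    using below_b[of b] b by (simp add: D'_def)
  show "D' differentiable (at \<theta>)" if t: "pi < \<theta>" "\<theta> < b" for \<theta>
  proof -
    obtain d where d: "(D has_real_derivative d) (at \<theta>)"
      using diff_D[OF t(1)] t a b unfolding real_differentiable_def by force
    have "0 < (D \<theta> - \<Delta>)\<^sup>2 - w\<^sup>2"
      using below_b[of \<theta>] that by simp
    then show ?thesis
      unfolding D'_def real_differentiable_def using d
      by (auto intro!: derivative_eq_intros exI)
  qed
  show "H' differentiable (at \<theta>)" if t: "pi < \<theta>" "\<theta> < b" for \<theta>
  proof -
    obtain d where d: "(H has_real_derivative d) (at \<theta>)"
      using diff_H[OF t(1)] t a b unfolding real_differentiable_def by force
    have "w < H \<theta> + \<Delta>"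
      using anti_H[of \<theta> b] that a b by (simp add: w_def)
    then have "0 < (H \<theta> + \<Delta>)\<^sup>2 - w\<^sup>2"
      using w_pos by (simp add: power_strict_mono)
    then show ?thesis
      unfolding H'_def real_differentiable_def using d
      by (auto intro!: derivative_eq_intros exI)
  qed
  show "continuous_on {pi<..b} H'"
    unfolding H'_def by (intro continuous_intros continuous_on_subset[OF cont_H]) (use a b in auto)
  show "H' t < H' s" if "pi < s" "s < t" "t \<le> b" for s t
  proof -
    have "H t < H s"
      using that a b by (intro anti_H) auto
    moreover have "0 < H t + \<Delta>"
      using below_b[of t] that w_pos by simp
    ultimately have "(H t + \<Delta>)\<^sup>2 < (H s + \<Delta>)\<^sup>2"
      by (intro power_strict_mono) auto
    then show ?thesis
      by (simp add: H'_def)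
  qed
  have ev: "eventually (\<lambda>\<theta>. pi < \<theta> \<and> \<theta> \<le> b) (at_right pi)"
    unfolding eventually_at_right_field using b by (intro exI[of _ b]) auto
  have "filterlim (\<lambda>\<theta>. - 2 * \<Delta> + (D \<theta> - H \<theta>)) at_top (at_right pi)"
    by (rule filterlim_tendsto_add_at_top[OF tendsto_const D_minus_H])
  then show "filterlim (\<lambda>\<theta>. D' \<theta> - H' \<theta>) at_top (at_right pi)"
  proof (rule filterlim_at_top_mono)
    show "eventually (\<lambda>\<theta>. - 2 * \<Delta> + (D \<theta> - H \<theta>) \<le> D' \<theta> - H' \<theta>) (at_right pi)"
      using ev
    proof eventually_elim
      case (elim \<theta>)
      \<comment> \<open>The product of \<open>D' \<theta> - H' \<theta>\<close> and
        \<open>D' \<theta> + H' \<theta>\<close> is \<open>(u - v) * (u + v)\<close>, while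
        \<open>D' \<theta> + H' \<theta> \<le> u + v\<close>. So taking roots can only enlarge the
        difference.\<close>
      define u where "u = D \<theta> - \<Delta>"
      define v where "v = H \<theta> + \<Delta>"
      have uv: "v < u" "w \<le> v" "w\<^sup>2 \<le> v\<^sup>2" "w\<^sup>2 < u\<^sup>2"
        using below_b[of \<theta>] elim by (auto simp: u_def v_def)
      have le: "D' \<theta> \<le> u" "H' \<theta> \<le> v" and sq: "(D' \<theta>)\<^sup>2 = u\<^sup>2 - w\<^sup>2" "(H' \<theta>)\<^sup>2 = v\<^sup>2 - w\<^sup>2"
        and nonneg: "0 < D' \<theta>" "0 \<le> H' \<theta>"
        using uv w_pos by (auto simp: D'_def H'_def u_def[symmetric] v_def[symmetric] intro!: real_le_lsqrt)
      have "H' \<theta> \<le> D' \<theta>"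
        using uv w_pos by (auto simp: D'_def H'_def u_def[symmetric] v_def[symmetric] intro!: power_mono)
      then have "(D' \<theta> - H' \<theta>) * (D' \<theta> + H' \<theta>) \<le> (D' \<theta> - H' \<theta>) * (u + v)"
        using le by (intro mult_left_mono) auto
      moreover have "(D' \<theta> - H' \<theta>) * (D' \<theta> + H' \<theta>) = (u - v) * (u + v)"
        using sq by (simp add: algebra_simps power2_eq_square)
      ultimately have "u - v \<le> D' \<theta> - H' \<theta>"
        using uv w_pos by (simp add: mult_le_cancel_right)
      then show ?case
        by (simp add: u_def v_def)
    qed
  qed
  have "filterlim (\<lambda>\<theta>. (\<Delta> - w) + H \<theta>) at_top (at_right pi)"
    by (rule filterlim_tendsto_add_at_top[OF tendsto_const H_at_top])
  then show "filterlim H' at_top (at_right pi)"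
  proof (rule filterlim_at_top_mono)
    show "eventually (\<lambda>\<theta>. (\<Delta> - w) + H \<theta> \<le> H' \<theta>) (at_right pi)"
      using ev
    proof eventually_elim
      case (elim \<theta>)
      define v where "v = H \<theta> + \<Delta>"
      have v: "w \<le> v" "0 < w"
        using below_b[of \<theta>] elim w_pos by (auto simp: v_def)
      then have "w * w \<le> v * w"
        by (intro mult_right_mono) auto
      then have "(v - w)\<^sup>2 \<le> v\<^sup>2 - w\<^sup>2"
        by (simp add: power2_eq_square algebra_simps)
      then have "v - w \<le> H' \<theta>"
        by (simp add: H'_def v_def real_le_rsqrt)
      then show ?case
        by (simp add: v_def)
    qed
  qed
qed (use down' up' in auto)

text \<open>The descending arc of \<open>m\<close> lands strictly inside the sliding segment from
  \<open>c - \<Delta>\<close> to \<open>c\<close>. Sliding lifts it to \<open>(X, c)\<close>,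
  exactly where the ascending arc of \<open>m\<close> starts, since \<open>H m = 0\<close>.\<close>

lemma sliding_cycle:
  obtains \<Gamma> where "sliding_orbit F' L' R' X' \<Gamma>" "\<not> \<Gamma> \<subseteq> {..<X} \<times> UNIV"
proof -
  let ?S = "{..X} \<times> UNIV"
  have 1: "reach (jump_field L' R') ?S (top_pt m) (X, c - D m)" "reach (jump_field L' R') ?S (X, c) (top_pt m)"
  proof -
    have "safe L R X \<subseteq> ?S" "top_pt m \<in> ?S" "(X, y) \<in> ?S" for y
      using X1 by (auto simp: safe_def off_sliding_def top_pt_def)
    then have "safe L R X \<union> {top_pt m, (X, y)} \<subseteq> ?S" for y
      by blast
    then show "reach (jump_field L' R') ?S (top_pt m) (X, c - D m)" "reach (jump_field L' R') ?S (X, c) (top_pt m)"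
      using reach_superset[OF down_old[of m], of ?S] reach_superset[OF up_old[of m], of ?S] m Hm by simp_all
  qed
  have 2: "reach (jump_field L' R') ?S (X, c - D m) (X, c)"
    using X1 Dm \<Delta> at_X by (intro reach_slide RL') auto
  obtain \<Gamma> where \<Gamma>: "periodic_orbit F' \<Gamma>" "(X, c - D m) \<in> \<Gamma>" "(X, c) \<in> \<Gamma>" "\<Gamma> \<subseteq> ?S"
    using periodic_orbit_through[of F' ?S "(X, c - D m)" "(X, c)"] 2 reach_trans[OF 1(2) 1(1)] Dm
    unfolding filippov_set_jump_field[OF adm'] by auto
  have "\<exists>z\<in>\<Gamma>. R' (fst z) < snd z \<and> snd z < L' (fst z)"
    using \<Gamma>(2) Dm \<Delta> at_X by (intro bexI[of _ "(X, c - D m)"]) auto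
  then show ?thesis
    using \<Gamma> X_less by (intro that[of \<Gamma>]) (auto simp: sliding_orbit_def)
qed

text \<open>A circle about \<open>(0, c')\<close> meets the line at \<open>X\<close> symmetrically
  about \<open>c'\<close>; its lower and upper arcs are joined at the rightmost point.\<close>

lemma reach_through_last_zone:
  assumes \<kappa>: "0 < \<kappa>" and S: "\<And>z. X < fst z \<Longrightarrow> fst z \<le> sqrt (X\<^sup>2 + \<kappa>\<^sup>2) \<Longrightarrow> z \<in> S"
    "(X, c' - \<kappa>) \<in> S" "(X, c' + \<kappa>) \<in> S"
  shows "reach (jump_field L' R') S (X, c' - \<kappa>) (X, c' + \<kappa>)"
proof -
  define \<rho> where "\<rho> = sqrt (X\<^sup>2 + \<kappa>\<^sup>2)"
  have "\<rho>\<^sup>2 - X\<^sup>2 = \<kappa>\<^sup>2"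
    by (simp add: \<rho>_def)
  then have e: "sqrt (\<rho>\<^sup>2 - X\<^sup>2) = \<kappa>" "sqrt (\<rho>\<^sup>2 - \<rho>\<^sup>2) = 0"
    using \<kappa> by simp_all
  have "sqrt (X\<^sup>2) < \<rho>"
    unfolding \<rho>_def using \<kappa> by (intro real_sqrt_less_mono) simp
  then have \<rho>: "X < \<rho>"
    using X1 by simp
  have "reach (jump_field L' R') S (X, c' - sqrt (\<rho>\<^sup>2 - X\<^sup>2)) (\<rho>, c' - sqrt (\<rho>\<^sup>2 - \<rho>\<^sup>2))"
    by (rule reach_lower_arc) (use X1 \<rho> RL' flat' S in \<open>auto simp: e \<rho>_def[symmetric]\<close>)
  moreover have "reach (jump_field L' R') S (\<rho>, c' + sqrt (\<rho>\<^sup>2 - \<rho>\<^sup>2)) (X, c' + sqrt (\<rho>\<^sup>2 - X\<^sup>2))"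
    by (rule reach_upper_arc) (use X1 \<rho> RL' flat' S in \<open>auto simp: e \<rho>_def[symmetric]\<close>)
  ultimately show ?thesis
    unfolding e by (simp add: reach_trans)
qed

text \<open>Reflection at \<open>c' = c - \<Delta>\<close> turns the depth \<open>D \<theta>\<close>
  below \<open>c\<close> into the height \<open>D \<theta> - 2 * \<Delta>\<close> above it, to be
  compared with \<open>H \<theta>\<close>. The region is the whole plane, as the isolation argument
  uses only forward invariance.\<close>

lemma return_map:
  assumes "pi < \<theta>" "\<theta> \<le> m" "\<Delta> < D \<theta>"
  shows "reach (jump_field L' R') UNIV (top_pt \<theta>) (X, c + (D \<theta> - 2 * \<Delta>))"
proof (rule reach_trans)
  show "reach (jump_field L' R') UNIV (top_pt \<theta>) (X, c - D \<theta>)"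
    by (rule reach_superset[OF down_old[OF assms(1,2)]]) simp
  have "reach (jump_field L' R') UNIV (X, c' - (D \<theta> - \<Delta>)) (X, c' + (D \<theta> - \<Delta>))"
    using assms by (intro reach_through_last_zone) auto
  then show "reach (jump_field L' R') UNIV (X, c - D \<theta>) (X, c + (D \<theta> - 2 * \<Delta>))"
    by (simp add: c'_def algebra_simps)
qed

text \<open>Since \<open>b < a\<close>, this orbit is smaller than the one that defines
  \<open>X'\<close>, and it turns back before reaching the next line.\<close>

lemma crossing_orbit:
  obtains \<Gamma> where "periodic_orbit F' \<Gamma>" "top_pt a \<in> \<Gamma>" "(X, c - D a) \<in> \<Gamma>" "\<Gamma> \<subseteq> safe L' R' X' \<union> {top_pt a}"
proof -
  let ?S = "safe L' R' X' \<union> {top_pt a}"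
  have H: "0 < H a"
    using H_pos a by simp
  then have D: "\<Delta> < D a" "D a - \<Delta> = H a + \<Delta>"
    using a \<Delta>_pos by simp_all
  have 1: "reach (jump_field L' R') ?S (top_pt a) (X, c - D a)"
    using lower_X_safe[OF D(1)] safe_mono a by (intro reach_superset[OF down_old[of a]]) auto
  have 2: "reach (jump_field L' R') ?S (X, c + H a) (top_pt a)"
    using upper_X_safe[of a] safe_mono a by (intro reach_superset[OF up_old[of a]]) auto
  have "H a < H b"
    using anti_H b a by simp
  then have "(D a - \<Delta>)\<^sup>2 < w\<^sup>2"
    unfolding D w_def using H \<Delta>_pos by (intro power_strict_mono) auto
  then have "sqrt (X\<^sup>2 + (D a - \<Delta>)\<^sup>2) < X'"
    unfolding X'_def by (intro real_sqrt_less_mono) simp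
  moreover have ends: "(X, c' - (D a - \<Delta>)) = (X, c - D a)" "(X, c' + (D a - \<Delta>)) = (X, c + H a)"
    using D by (simp_all add: c'_def)
  ultimately have "reach (jump_field L' R') ?S (X, c' - (D a - \<Delta>)) (X, c' + (D a - \<Delta>))"
    using D safe_beyond lower_X_safe[OF D(1)] upper_X_safe[of a] a
    by (intro reach_through_last_zone; unfold ends) auto
  then have 3: "reach (jump_field L' R') ?S (X, c - D a) (X, c + H a)"
    unfolding ends .
  \<comment> \<open>For \<open>X = 1\<close> both points lie on the same line and only their heights
    tell them apart.\<close>
  have "top_pt a \<noteq> (X, c - D a)"
  proof
    assume eq: "top_pt a = (X, c - D a)"
    then have "c = 6/5"
      by (intro c_first) (simp add: top_pt_def)
    then show False
      using eq exit_height_pos[of a] a D \<Delta>_pos by (simp add: top_pt_def)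
  qed
  then show ?thesis
    using periodic_orbit_through[of F' ?S "top_pt a" "(X, c - D a)"] 1 reach_trans[OF 3 2] that
    unfolding filippov_set_jump_field[OF adm'] by metis
qed

lemma top_pt_image:
  assumes "pi < s" "s < t" "t \<le> m" and y: "exit_height t < y" "y < exit_height s"
  obtains \<theta> where "s < \<theta>" "\<theta> < t" "exit_height \<theta> = y"
proof -
  have "\<exists>x\<ge>s. x \<le> t \<and> exit_height x = y"
    using assms m by (intro IVT2')
      (auto intro!: continuous_at_imp_continuous_on DERIV_isCont[OF has_real_derivative_exit_height])
  then obtain x where "s \<le> x" "x \<le> t" "exit_height x = y" by blast
  then show ?thesis
    using that[of x] y by (cases "x = s"; cases "x = t") auto
qed

text \<open>
  A decreasing excess \<open>D - H\<close> at \<open>a\<close> makes the return map expanding there: among the hits of a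
  periodic orbit with the section above \<open>(1, 6/5)\<close> the highest one cannot lie above the hit of
  the crossing orbit, and the lowest one cannot lie below it.
\<close>
lemma crossing_cycle:
  assumes deriv: "((\<lambda>\<theta>. D \<theta> - H \<theta>) has_real_derivative f') (at a)" "f' < 0"
  obtains \<Gamma> where "isolated_crossing F' L' R' X' \<Gamma>" "\<not> \<Gamma> \<subseteq> {..<X} \<times> UNIV"
proof -
  obtain \<Gamma> where \<Gamma>: "periodic_orbit F' \<Gamma>" "top_pt a \<in> \<Gamma>" "(X, c - D a) \<in> \<Gamma>"
    "\<Gamma> \<subseteq> safe L' R' X' \<union> {top_pt a}"
    using crossing_orbit .
  have Ha: "0 < H a"
    using H_pos a by simp
  obtain e1 where e1: "0 < e1" "\<And>h. 0 < h \<Longrightarrow> h < e1 \<Longrightarrow> D a - H a < D (a - h) - H (a - h)"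
    using DERIV_neg_dec_left[OF deriv] by blast
  obtain e2 where e2: "0 < e2" "\<And>h. 0 < h \<Longrightarrow> h < e2 \<Longrightarrow> D (a + h) - H (a + h) < D a - H a"
    using DERIV_neg_dec_right[OF deriv] by blast
  have "isCont D a"
    using diff_D[of a] a by (auto intro: differentiable_imp_continuous_within)
  \<comment> \<open>At \<open>a\<close> itself \<open>D a = 2 * \<Delta> + H a\<close>, so returns
    of nearby orbits land above \<open>c\<close>, where values of \<open>H\<close> can label
    them.\<close>
  then have "eventually (\<lambda>\<theta>. 2 * \<Delta> < D \<theta>) (at a)"
    using a Ha by (intro order_tendstoD(1)[of D "D a"]) (auto simp: isCont_def)
  then obtain e3 where e3: "0 < e3" "\<And>\<theta>. \<theta> \<noteq> a \<Longrightarrow> dist \<theta> a < e3 \<Longrightarrow> 2 * \<Delta> < D \<theta>"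
    unfolding eventually_at by auto
  define e where "e = Min {e1, e2, e3, a - pi, m - a}"
  have e: "0 < e" "e \<le> e1" "e \<le> e2" "e \<le> e3" "e \<le> a - pi" "e \<le> m - a"
    using e1(1) e2(1) e3(1) a by (auto simp: e_def)
  define s where "s = a - e / 2"
  define t where "t = a + e / 2"
  have st: "pi < s" "s < a" "a < t" "t < m"
    using e by (auto simp: s_def t_def)
  have left: "2 * \<Delta> < D \<theta> - H \<theta>" if "s < \<theta>" "\<theta> < a" for \<theta>
    using e1(2)[of "a - \<theta>"] that e a by (auto simp: s_def)
  have right: "D \<theta> - H \<theta> < 2 * \<Delta>" if "a < \<theta>" "\<theta> < t" for \<theta>
    using e2(2)[of "\<theta> - a"] that e a by (auto simp: t_def)
  have D_gt: "2 * \<Delta> < D \<theta>" if "s < \<theta>" "\<theta> < t" for \<theta>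
    using e3(2)[of \<theta>] that e a Ha by (cases "\<theta> = a") (auto simp: s_def t_def dist_real_def abs_less_iff)
  \<comment> \<open>The section is blocked except for an open window around the hit of \<Gamma>.
    Orbits inside \<open>U\<close> hit it only at parameters between \<open>s\<close> and
    \<open>t\<close>, where the sign of \<open>D \<theta> - H \<theta> - 2 * \<Delta>\<close> is
    known.\<close>
  define V where "V = ({1} \<times> {6/5..6/5 + exit_height t} \<union> {1} \<times> {6/5 + exit_height s..} :: (real \<times> real) set)"
  define U where "U = {..<X'} \<times> UNIV - V"
  have "open U"
    unfolding U_def V_def by (intro open_Diff open_Times closed_Un closed_Times) auto
  have ord: "exit_height t < exit_height a" "exit_height a < exit_height s"
    using exit_height_anti st by auto
  have subU: "\<Gamma> \<subseteq> U"
  proof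
    fix z assume "z \<in> \<Gamma>"
    then have "z \<in> safe L' R' X' \<or> z = top_pt a"
      using \<Gamma>(4) by auto
    then show "z \<in> U"
    proof
      assume "z \<in> safe L' R' X'"
      then show ?thesis
        using exit_height_pos[of s] exit_height_anti[of s m] st m
        by (auto simp: safe_def off_sliding_def U_def V_def)
    next
      assume "z = top_pt a"
      then show ?thesis
        using X1 X_less ord by (auto simp: U_def V_def top_pt_def)
    qed
  qed
  have iso: "\<Gamma>' = \<Gamma>" if per: "periodic_orbit F' \<Gamma>'" and sub: "\<Gamma>' \<subseteq> U" for \<Gamma>'
  proof -
    note forward = periodic_orbit_forward_invariant[OF osl' per, unfolded filippov_set_jump_field[OF adm']]
    have "compact \<Gamma>'"
      by (rule periodic_orbit_compact[OF per])
    define A where "A = snd ` (\<Gamma>' \<inter> {1} \<times> {6/5..})"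
    have "compact (\<Gamma>' \<inter> {1} \<times> {6/5..})"
      by (intro compact_Int_closed \<open>compact \<Gamma>'\<close> closed_Times) auto
    then have "compact A"
      unfolding A_def by (intro compact_continuous_image continuous_intros)
    have "\<And>x. x < 1 \<Longrightarrow> L' x = 6/5 * x \<and> R' x = 6/5 * x"
      by (rule stage.lin[OF stage'])
    then have "A \<noteq> {}"
      by (rule periodic_orbit_meets_section[OF adm' _ per]) (force simp: A_def)+
    have A_iff: "y \<in> A \<longleftrightarrow> (1, y) \<in> \<Gamma>' \<and> 6/5 \<le> y" for y
      unfolding A_def by force
    have A_param: "\<exists>\<theta>. s < \<theta> \<and> \<theta> < t \<and> y = 6/5 + exit_height \<theta>" if "y \<in> A" for y
    proof -
      have "(1, y) \<in> U" "6/5 \<le> y"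
        using that sub by (auto simp: A_iff)
      then have "exit_height t < y - 6/5" "y - 6/5 < exit_height s"
        by (auto simp: U_def V_def)
      then obtain \<theta> where "s < \<theta>" "\<theta> < t" "exit_height \<theta> = y - 6/5"
        using st by (elim top_pt_image[of s t "y - 6/5", rotated 3]) auto
      then show ?thesis
        by (intro exI[of _ \<theta>]) auto
    qed
    have top_A: "6/5 + exit_height \<theta> \<in> A" if "top_pt \<theta> \<in> \<Gamma>'" "pi < \<theta>" "\<theta> \<le> m" for \<theta>
      using that m exit_height_pos[of \<theta>] by (cases "\<theta> = m") (auto simp: A_iff top_pt_def)
    have ret: "6/5 + exit_height \<theta>' \<in> A"
      if \<theta>: "6/5 + exit_height \<theta> \<in> A" "s < \<theta>" "\<theta> < t" and \<theta>': "pi < \<theta>'" "\<theta>' \<le> m" "H \<theta>' = D \<theta> - 2 * \<Delta>"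
      for \<theta> \<theta>'
    proof -
      have "top_pt \<theta> \<in> \<Gamma>'"
        using \<theta> by (simp add: A_iff top_pt_def)
      moreover have "reach (jump_field L' R') UNIV (top_pt \<theta>) (X, c + H \<theta>')"
        unfolding \<theta>'(3) using \<theta> st D_gt[of \<theta>] \<Delta>_pos by (intro return_map) auto
      moreover have "reach (jump_field L' R') UNIV (X, c + H \<theta>') (top_pt \<theta>')"
        by (rule reach_superset[OF up_old[OF \<theta>'(1,2)]]) simp
      ultimately have "top_pt \<theta>' \<in> \<Gamma>'"
        using forward by blast
      then show ?thesis
        by (rule top_A[OF _ \<theta>'(1,2)])
    qed
    obtain y1 where y1: "y1 \<in> A" "\<And>y. y \<in> A \<Longrightarrow> y \<le> y1"
      using compact_attains_sup[OF \<open>compact A\<close> \<open>A \<noteq> {}\<close>] by blast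
    obtain y0 where y0: "y0 \<in> A" "\<And>y. y \<in> A \<Longrightarrow> y0 \<le> y"
      using compact_attains_inf[OF \<open>compact A\<close> \<open>A \<noteq> {}\<close>] by blast
    obtain \<theta>1 where \<theta>1: "s < \<theta>1" "\<theta>1 < t" "y1 = 6/5 + exit_height \<theta>1"
      using A_param[OF y1(1)] by blast
    obtain \<theta>0 where \<theta>0: "s < \<theta>0" "\<theta>0 < t" "y0 = 6/5 + exit_height \<theta>0"
      using A_param[OF y0(1)] by blast
    have "a \<le> \<theta>1"
    proof (rule ccontr)
      assume "\<not> a \<le> \<theta>1"
      then have "H \<theta>1 < D \<theta>1 - 2 * \<Delta>"
        using left[of \<theta>1] \<theta>1 by simp
      then obtain \<theta>' where \<theta>': "pi < \<theta>'" "\<theta>' < \<theta>1" "H \<theta>' = D \<theta>1 - 2 * \<Delta>"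
        using \<theta>1 st by (elim H_onto_left[rotated 2]) auto
      then have "6/5 + exit_height \<theta>' \<in> A"
        using ret[of \<theta>1 \<theta>'] \<theta>1 y1(1) st by simp
      from y1(2)[OF this] show False
        using exit_height_anti[of \<theta>' \<theta>1] \<theta>' \<theta>1 st by simp
    qed
    have "\<theta>0 \<le> a"
    proof (rule ccontr)
      assume "\<not> \<theta>0 \<le> a"
      then have "D \<theta>0 - 2 * \<Delta> < H \<theta>0" "0 < D \<theta>0 - 2 * \<Delta>"
        using right[of \<theta>0] D_gt[of \<theta>0] \<theta>0 by simp_all
      then obtain \<theta>' where \<theta>': "\<theta>0 < \<theta>'" "\<theta>' \<le> m" "H \<theta>' = D \<theta>0 - 2 * \<Delta>"
        using \<theta>0 st by (elim H_onto_right[rotated 2]) auto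
      then have "6/5 + exit_height \<theta>' \<in> A"
        using ret[of \<theta>0 \<theta>'] \<theta>0 y0(1) st by simp
      from y0(2)[OF this] show False
        using exit_height_anti[of \<theta>0 \<theta>'] \<theta>' \<theta>0 st by simp
    qed
    \<comment> \<open>Greater heights have smaller parameters, so
      \<open>a \<le> \<theta>1 \<le> \<theta>0 \<le> a\<close>, and both orbits contain
      \<open>top_pt a\<close>.\<close>
    have "y0 \<le> y1"
      using y0 y1 by simp
    then have "\<theta>1 \<le> \<theta>0"
      using exit_height_anti[of \<theta>0 \<theta>1] \<theta>0 \<theta>1 st by force
    then have "\<theta>0 = a"
      using \<open>a \<le> \<theta>1\<close> \<open>\<theta>0 \<le> a\<close> by simp
    then have "top_pt a \<in> \<Gamma>'"
      using y0(1) \<theta>0 by (simp add: A_iff top_pt_def)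
    then show ?thesis
      using periodic_orbits_eq[OF osl' per \<Gamma>(1)] \<Gamma>(2) by blast
  qed
  have top_off: "top_pt a \<in> off_sliding L' R' X'"
    using X1 X_less L1 exit_height_pos[of a] a by (auto simp: off_sliding_def top_pt_def L'_def)
  have "isolated_crossing F' L' R' X' \<Gamma>"
    unfolding isolated_crossing_def
  proof (intro conjI)
    show "\<Gamma> \<subseteq> off_sliding L' R' X'"
      using \<Gamma>(4) top_off by (auto simp: safe_def)
    show "\<exists>z\<in>\<Gamma>. R' (fst z) < L' (fst z)"
      using \<Gamma>(3) at_X \<Delta>_pos by (intro bexI[of _ "(X, c - D a)"]) auto
    show "\<exists>U. open U \<and> \<Gamma> \<subseteq> U \<and> (\<forall>\<Gamma>'. periodic_orbit F' \<Gamma>' \<and> \<Gamma>' \<noteq> \<Gamma> \<longrightarrow> \<not> \<Gamma>' \<subseteq> U)"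
      using \<open>open U\<close> subU iso by blast
  qed (rule \<Gamma>(1))
  moreover have "\<not> \<Gamma> \<subseteq> {..<X} \<times> UNIV"
    using \<Gamma>(3) by auto
  ultimately show ?thesis
    by (rule that)
qed

section \<open>Persistence of the earlier cycles\<close>

lemma jump_field_left_of_X: "fst z < X \<Longrightarrow> jump_field L' R' z = jump_field L R z"
  by (auto simp: jump_field_def L'_def R'_def)

lemma periodic_orbit_iff:
  assumes "\<Gamma> \<subseteq> {..<X} \<times> UNIV"
  shows "periodic_orbit F' \<Gamma> \<longleftrightarrow> periodic_orbit F \<Gamma>"
proof -
  have "filippov_set F' z = filippov_set F z" if "z \<in> \<Gamma>" for z
    unfolding filippov_set_jump_field[OF adm] filippov_set_jump_field[OF adm'] using that assms
    by (intro jump_field_left_of_X) auto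
  then show ?thesis
    using periodic_orbit_cong by blast
qed

text \<open>The neighbourhood is cut down to \<open>x < X\<close>, where both systems have the same
  Filippov sets and hence the same periodic orbits.\<close>

lemma isolated_crossing_extend:
  assumes "isolated_crossing F L R X \<Gamma>"
  shows "isolated_crossing F' L' R' X' \<Gamma>"
proof -
  obtain U where U: "open U" "\<Gamma> \<subseteq> U" "\<And>\<Gamma>'. periodic_orbit F \<Gamma>' \<Longrightarrow> \<Gamma>' \<noteq> \<Gamma> \<Longrightarrow> \<not> \<Gamma>' \<subseteq> U"
    and \<Gamma>: "periodic_orbit F \<Gamma>" "\<Gamma> \<subseteq> off_sliding L R X" "\<exists>z\<in>\<Gamma>. R (fst z) < L (fst z)"
    using assms by (auto simp: isolated_crossing_def)
  have sub: "\<Gamma> \<subseteq> {..<X} \<times> UNIV"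
    using \<Gamma>(2) by (auto simp: off_sliding_def)
  let ?U = "U \<inter> {..<X} \<times> UNIV"
  have "open ?U" "\<Gamma> \<subseteq> ?U"
    using U sub by (auto intro!: open_Int open_Times)
  moreover have "\<not> \<Gamma>' \<subseteq> ?U" if "periodic_orbit F' \<Gamma>'" "\<Gamma>' \<noteq> \<Gamma>" for \<Gamma>'
    using U(3)[of \<Gamma>'] that periodic_orbit_iff[of \<Gamma>'] by blast
  moreover have "\<exists>z\<in>\<Gamma>. R' (fst z) < L' (fst z)"
    using \<Gamma>(3) sub by (force simp: R'_def L'_def)
  ultimately show ?thesis
    unfolding isolated_crossing_def
    using periodic_orbit_iff[OF sub] \<Gamma> off_sliding_mono by blast
qed

lemma sliding_orbit_extend:
  assumes "sliding_orbit F L R X \<Gamma>"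
  shows "sliding_orbit F' L' R' X' \<Gamma>"
proof -
  have sub: "\<Gamma> \<subseteq> {..<X} \<times> UNIV" and "periodic_orbit F \<Gamma>" "\<exists>z\<in>\<Gamma>. R (fst z) < snd z \<and> snd z < L (fst z)"
    using assms by (auto simp: sliding_orbit_def)
  moreover from this have "\<exists>z\<in>\<Gamma>. R' (fst z) < snd z \<and> snd z < L' (fst z)"
    by (force simp: R'_def L'_def)
  moreover have "\<Gamma> \<subseteq> {..<X'} \<times> UNIV"
    using sub X_less by auto
  ultimately show ?thesis
    using periodic_orbit_iff[OF sub] by (auto simp: sliding_orbit_def)
qed

end

context stage
begin

text \<open>The order of choices matters: \<open>a\<close> comes first, with
  \<open>D a - H a\<close> above \<open>2 * D m\<close>, so that half of it is an admissible
  \<Delta>; then \<open>b\<close> is put so close to \<open>pi\<close> that the difference exceeds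
  \<open>2 * \<Delta>\<close> from there on. Neither new orbit stays left of \<open>X\<close>, which
  distinguishes it from all earlier cycles.\<close>

lemma exists_jump:
  obtains \<Delta> X' c' D' H' m' \<Gamma>\<^sub>c \<Gamma>\<^sub>s F' L' R' where
    "0 < \<Delta>" "X < X'"
    "F' = (\<lambda>x. F x - \<Delta> / 2 * (1 + sgn (x - X)))"
    "{x. R' x < L' x} = insert X {x. R x < L x}"
    "stage F' L' R' X' c' D' H' m'"
    "isolated_crossing F' L' R' X' \<Gamma>\<^sub>c" "\<not> \<Gamma>\<^sub>c \<subseteq> {..<X} \<times> UNIV"
    "sliding_orbit F' L' R' X' \<Gamma>\<^sub>s" "\<not> \<Gamma>\<^sub>s \<subseteq> {..<X} \<times> UNIV"
    "\<And>\<Gamma>. isolated_crossing F L R X \<Gamma> \<Longrightarrow> isolated_crossing F' L' R' X' \<Gamma>"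
    "\<And>\<Gamma>. sliding_orbit F L R X \<Gamma> \<Longrightarrow> sliding_orbit F' L' R' X' \<Gamma>"
proof -
  have diff: "(\<lambda>\<theta>. D \<theta> - H \<theta>) differentiable (at x)" if "pi < x" "x < m" for x
    using diff_D[OF that] diff_H[OF that] by simp
  obtain a f' where a: "pi < a" "a < m" "2 * D m < D a - H a"
    and f': "((\<lambda>\<theta>. D \<theta> - H \<theta>) has_real_derivative f') (at a)" "f' < 0"
    by (rule exists_decreasing_point[OF D_minus_H m(1) diff, of "2 * D m"])
  define \<Delta> where "\<Delta> = (D a - H a) / 2"
  have "eventually (\<lambda>\<theta>. 2 * \<Delta> < D \<theta> - H \<theta>) (at_right pi)"
    using D_minus_H by (simp add: filterlim_at_top_dense)
  then obtain e where e: "pi < e" "\<And>\<theta>. pi < \<theta> \<Longrightarrow> \<theta> < e \<Longrightarrow> 2 * \<Delta> < D \<theta> - H \<theta>"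
    unfolding eventually_at_right_field by blast
  obtain b where b: "pi < b" "b < min e a"
    using dense[of pi "min e a"] e a by auto
  interpret jump_stage F L R X c D H m \<Delta> a b
    by unfold_locales (use a b e(2) in \<open>auto simp: \<Delta>_def\<close>)
  obtain \<Gamma>\<^sub>c where c: "isolated_crossing F' L' R' X' \<Gamma>\<^sub>c" "\<not> \<Gamma>\<^sub>c \<subseteq> {..<X} \<times> UNIV"
    using crossing_cycle[OF f'] .
  obtain \<Gamma>\<^sub>s where s: "sliding_orbit F' L' R' X' \<Gamma>\<^sub>s" "\<not> \<Gamma>\<^sub>s \<subseteq> {..<X} \<times> UNIV"
    using sliding_cycle .
  have "{x. R' x < L' x} = insert X {x. R x < L x}"
    using flat \<Delta>_pos by (force simp: R'_def L'_def)
  then show ?thesis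
    using that[OF \<Delta>_pos X_less F'_def _ stage' c s isolated_crossing_extend sliding_orbit_extend] by blast
qed

end

text \<open>Before any jump the current line is the section itself: ascending connections are single
  points, and \<open>m\<close> belongs to the spiral arc leaving tangentially.\<close>

lemma stage_0:
  obtains m where "stage (\<lambda>x. 6/5 * min x 1) (\<lambda>x. 6/5 * min x 1) (\<lambda>x. 6/5 * min x 1) 1 (6/5) entry_depth exit_height m"
proof -
  obtain m where m: "pi < m" "m < 2 * pi" "exit_height m = 0"
    using exit_height_root .
  let ?F = "\<lambda>x::real. 6/5 * min x 1"
  have nonneg: "0 \<le> exit_height \<theta>" if "pi < \<theta>" "\<theta> \<le> m" for \<theta>
    using exit_height_strict_antimono[of \<theta> m] that m by (cases "\<theta> = m") auto
  have lim: "(?F \<longlongrightarrow> ?F x) (at x within A)" for x A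
    by (intro tendsto_intros)
  have "downward_jumps ?F ?F ?F"
    unfolding downward_jumps_def by (intro conjI allI impI lim exI[of _ "6/5"]) (auto simp: min_def)
  moreover have "reach (jump_field ?F ?F) (safe ?F ?F 1 \<union> {top_pt \<theta>, (1, 6/5 - entry_depth \<theta>)}) (top_pt \<theta>) (1, 6/5 - entry_depth \<theta>)"
    if "pi < \<theta>" "\<theta> \<le> m" for \<theta>
    unfolding top_pt_def using that m nonneg[OF that]
    by (intro reach_spiral) (auto simp: safe_def off_sliding_def)
  moreover have "reach (jump_field ?F ?F) (safe ?F ?F 1 \<union> {top_pt \<theta>, (1, 6/5 + exit_height \<theta>)}) (1, 6/5 + exit_height \<theta>) (top_pt \<theta>)" for \<theta>
    unfolding top_pt_def by (intro reach_refl) (auto simp: jump_field_def)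
  moreover have "continuous_on {pi<..m} exit_height"
    using m by (intro continuous_at_imp_continuous_on ballI DERIV_isCont[OF has_real_derivative_exit_height]) auto
  ultimately have "stage ?F ?F ?F 1 (6/5) entry_depth exit_height m"
    using m entry_depth_pos[of m] differentiable_entry_depth differentiable_exit_height
      exit_height_strict_antimono entry_minus_exit_at_top exit_height_at_top
    by (intro stage.intro) auto
  then show ?thesis
    by (rule that)
qed

subsection \<open>Limit cycles\<close>

text \<open>The corner of \<open>min x 1\<close> would be a fold; it is hidden under the first jump,
  which is placed at \<open>1\<close>.\<close>

definition jump_sum :: "nat \<Rightarrow> (nat \<Rightarrow> real) \<Rightarrow> (nat \<Rightarrow> real) \<Rightarrow> real \<Rightarrow> real" where
  "jump_sum n \<beta> \<xi> = (\<lambda>x. 6/5 * min x 1 + (\<Sum>i=1..n. \<beta> i * (1 + sgn (x - \<xi> i))))"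

text \<open>The conditional clause fixes the first jump at \<open>1\<close> and, for
  \<open>n = 0\<close>, the line where it is going to be.\<close>

definition tower :: "nat \<Rightarrow> (nat \<Rightarrow> real) \<Rightarrow> (nat \<Rightarrow> real) \<Rightarrow> (real \<Rightarrow> real) \<Rightarrow> (real \<Rightarrow> real) \<Rightarrow> real \<Rightarrow>
    (real \<times> real) set set \<Rightarrow> (real \<times> real) set set \<Rightarrow> bool" where
  "tower n \<beta> \<xi> L R X \<C> \<S> \<longleftrightarrow>
     (\<exists>c D H m. stage (jump_sum n \<beta> \<xi>) L R X c D H m) \<and>
     (\<forall>i\<in>{1..n}. \<beta> i \<noteq> 0 \<and> 1 \<le> \<xi> i \<and> \<xi> i < X) \<and> strict_mono_on {1..n} \<xi> \<and>
     (if n = 0 then X else \<xi> 1) = 1 \<and> {x. R x < L x} = \<xi> ` {1..n} \<and>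
     finite \<C> \<and> card \<C> = n \<and> (\<forall>\<Gamma>\<in>\<C>. isolated_crossing (jump_sum n \<beta> \<xi>) L R X \<Gamma>) \<and>
     finite \<S> \<and> card \<S> = n \<and> (\<forall>\<Gamma>\<in>\<S>. sliding_orbit (jump_sum n \<beta> \<xi>) L R X \<Gamma>)"

lemma tower_exists: "\<exists>\<beta> \<xi> L R X \<C> \<S>. tower n \<beta> \<xi> L R X \<C> \<S>"
proof (induction n)
  case 0
  obtain m where m: "stage (\<lambda>x. 6/5 * min x 1) (\<lambda>x. 6/5 * min x 1) (\<lambda>x. 6/5 * min x 1) 1 (6/5) entry_depth exit_height m"
    using stage_0 .
  have "tower 0 (\<lambda>_. 0) (\<lambda>_. 0) (\<lambda>x. 6/5 * min x 1) (\<lambda>x. 6/5 * min x 1) 1 {} {}"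
    unfolding tower_def jump_sum_def using m by (auto simp: monotone_on_def)
  then show ?case by blast
next
  case (Suc n)
  then obtain \<beta> \<xi> L R X \<C> \<S> where t: "tower n \<beta> \<xi> L R X \<C> \<S>" by blast
  let ?F = "jump_sum n \<beta> \<xi>"
  obtain c D H m where "stage ?F L R X c D H m"
    using t by (auto simp: tower_def)
  then interpret stage ?F L R X c D H m .
  obtain \<Delta> X' c' D' H' m' \<Gamma>\<^sub>c \<Gamma>\<^sub>s F' L' R' where
    pos: "0 < \<Delta>" "X < X'"
    and F': "F' = (\<lambda>x. ?F x - \<Delta> / 2 * (1 + sgn (x - X)))"
    and J: "{x. R' x < L' x} = insert X {x. R x < L x}"
    and st: "stage F' L' R' X' c' D' H' m'"
    and c: "isolated_crossing F' L' R' X' \<Gamma>\<^sub>c" "\<not> \<Gamma>\<^sub>c \<subseteq> {..<X} \<times> UNIV"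
    and s: "sliding_orbit F' L' R' X' \<Gamma>\<^sub>s" "\<not> \<Gamma>\<^sub>s \<subseteq> {..<X} \<times> UNIV"
    and ext: "\<And>\<Gamma>. isolated_crossing ?F L R X \<Gamma> \<Longrightarrow> isolated_crossing F' L' R' X' \<Gamma>"
      "\<And>\<Gamma>. sliding_orbit ?F L R X \<Gamma> \<Longrightarrow> sliding_orbit F' L' R' X' \<Gamma>"
    by (rule exists_jump) blast
  define \<beta>' where "\<beta>' = \<beta>(Suc n := - \<Delta> / 2)"
  define \<xi>' where "\<xi>' = \<xi>(Suc n := X)"
  have F'_eq: "F' = jump_sum (Suc n) \<beta>' \<xi>'"
  proof -
    have "(\<Sum>i=1..n. \<beta>' i * (1 + sgn (x - \<xi>' i))) = (\<Sum>i=1..n. \<beta> i * (1 + sgn (x - \<xi> i)))" for x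
      by (intro sum.cong) (auto simp: \<beta>'_def \<xi>'_def)
    then show ?thesis
      unfolding F' jump_sum_def by (auto simp: \<beta>'_def \<xi>'_def)
  qed
  have \<xi>: "\<forall>i\<in>{1..n}. \<beta> i \<noteq> 0 \<and> 1 \<le> \<xi> i \<and> \<xi> i < X" "strict_mono_on {1..n} \<xi>"
    "(if n = 0 then X else \<xi> 1) = 1" "{x. R x < L x} = \<xi> ` {1..n}"
    and \<C>: "finite \<C>" "card \<C> = n" "\<And>\<Gamma>. \<Gamma> \<in> \<C> \<Longrightarrow> isolated_crossing ?F L R X \<Gamma>"
    and \<S>: "finite \<S>" "card \<S> = n" "\<And>\<Gamma>. \<Gamma> \<in> \<S> \<Longrightarrow> sliding_orbit ?F L R X \<Gamma>"
    using t unfolding tower_def by blast+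
  have "\<Gamma>\<^sub>c \<notin> \<C>"
    using c(2) \<C>(3)[of \<Gamma>\<^sub>c] by (force simp: isolated_crossing_def off_sliding_def)
  moreover have "\<Gamma>\<^sub>s \<notin> \<S>"
    using s(2) \<S>(3)[of \<Gamma>\<^sub>s] by (auto simp: sliding_orbit_def)
  moreover have "strict_mono_on {1..Suc n} \<xi>'"
  proof (rule strict_mono_onI)
    fix i j assume "i \<in> {1..Suc n}" "j \<in> {1..Suc n}" "i < j"
    then show "\<xi>' i < \<xi>' j"
      using \<xi>(1,2) by (cases "j = Suc n") (auto simp: \<xi>'_def strict_mono_on_def)
  qed
  moreover have "\<xi>' ` {1..Suc n} = insert X (\<xi> ` {1..n})"
    by (force simp: \<xi>'_def image_iff atLeastAtMostSuc_conv)
  moreover have "\<forall>i\<in>{1..Suc n}. \<beta>' i \<noteq> 0 \<and> 1 \<le> \<xi>' i \<and> \<xi>' i < X'"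
    using \<xi>(1) pos X1 by (force simp: \<beta>'_def \<xi>'_def)
  moreover have "\<xi>' 1 = 1"
    using \<xi>(3) by (auto simp: \<xi>'_def)
  ultimately have "tower (Suc n) \<beta>' \<xi>' L' R' X' (insert \<Gamma>\<^sub>c \<C>) (insert \<Gamma>\<^sub>s \<S>)"
    unfolding tower_def F'_eq[symmetric] using st J \<xi>(4) \<C> \<S> c(1) s(1) ext by auto
  then show ?case by blast
qed

section \<open>Absence of folds and the normal form\<close>

lemma has_real_derivative_sgn_shift:
  assumes "x \<noteq> (\<xi>::real)"
  shows "((\<lambda>u. sgn (u - \<xi>)) has_real_derivative 0) (at x)"
proof -
  have "eventually (\<lambda>u. u \<noteq> \<xi> \<and> (\<xi> < u \<longleftrightarrow> \<xi> < x)) (nhds x)"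
  proof (cases "\<xi> < x")
    case True
    then have "eventually (\<lambda>u. u \<in> {\<xi><..}) (nhds x)"
      by (intro eventually_nhds_in_open) auto
    then show ?thesis
      by eventually_elim (use True in auto)
  next
    case False
    then have "eventually (\<lambda>u. u \<in> {..<\<xi>}) (nhds x)"
      using assms by (intro eventually_nhds_in_open) auto
    then show ?thesis
      by eventually_elim (use False in auto)
  qed
  then have "eventually (\<lambda>u. sgn (u - \<xi>) = sgn (x - \<xi>)) (nhds x)"
    by eventually_elim (use assms in \<open>auto simp: sgn_if\<close>)
  then have "((\<lambda>u. sgn (u - \<xi>)) has_real_derivative 0) (at x) \<longleftrightarrow> ((\<lambda>u. sgn (x - \<xi>)) has_real_derivative 0) (at x)"
    by (intro DERIV_cong_ev) auto
  then show ?thesis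
    by simp
qed

text \<open>Writing the corner through \<open>sgn\<close> lets one derivative rule serve both the
  corner and the jumps.\<close>

lemma min_eq_sgn: "min x 1 = (x + 1 - sgn (x - 1) * (x - 1)) / (2::real)"
  by (auto simp: min_def sgn_if)

lemma jump_sum_differentiable:
  assumes "x \<noteq> 1" "\<And>i. i \<in> {1..n} \<Longrightarrow> x \<noteq> \<xi> i"
  obtains d where "(jump_sum n \<beta> \<xi> has_real_derivative d) (at x)"
proof -
  have sum: "((\<lambda>x. \<Sum>i=1..n. \<beta> i * (1 + sgn (x - \<xi> i))) has_real_derivative (\<Sum>i=1..n. 0)) (at x)"
    using assms by (intro DERIV_sum) (auto intro!: derivative_eq_intros has_real_derivative_sgn_shift)
  have "((\<lambda>x. sgn (x - 1) * (x - 1)) has_real_derivative 0 * (x - 1) + (1 - 0) * sgn (x - 1)) (at x)"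
    using assms(1) by (intro DERIV_mult has_real_derivative_sgn_shift DERIV_diff DERIV_ident DERIV_const)
  then have "((\<lambda>x. 6/5 * ((x + 1 - sgn (x - 1) * (x - 1)) / 2)) has_real_derivative
      6/5 * ((1 + 0 - (0 * (x - 1) + (1 - 0) * sgn (x - 1))) / 2)) (at x)"
    by (intro DERIV_cmult DERIV_cdivide DERIV_diff DERIV_add DERIV_ident DERIV_const)
  from DERIV_add[OF this sum] show ?thesis
    unfolding min_eq_sgn[symmetric] jump_sum_def[symmetric] by (rule that)
qed

lemma not_fold_of_derivative:
  assumes "(F has_real_derivative d) (at x)"
  shows "\<not> fold_at F x"
proof
  assume "fold_at F x"
  then obtain l r where lr: "(F has_real_derivative l) (at_left x)" "(F has_real_derivative r) (at_right x)" "l \<noteq> r"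
    by (auto simp: fold_at_def)
  have "(F has_real_derivative d) (at_left x)" "(F has_real_derivative d) (at_right x)"
    using assms by (auto intro: has_field_derivative_at_within)
  then have "l = d" "r = d"
    using lr tendsto_unique[OF trivial_limit_at_left_real] tendsto_unique[OF trivial_limit_at_right_real]
    unfolding has_field_derivative_iff by blast+
  then show False
    using lr by simp
qed

lemma not_fold_of_jump:
  assumes "downward_jumps F L R" "R x < L x"
  shows "\<not> fold_at F x"
proof
  assume "fold_at F x"
  then have "(F \<longlongrightarrow> F x) (at x)"
    by (simp add: fold_at_def isCont_def)
  then have "(F \<longlongrightarrow> F x) (at_left x)" "(F \<longlongrightarrow> F x) (at_right x)"
    by (auto simp: filterlim_at_split)
  then have "F x = L x" "F x = R x"
    using assms(1) tendsto_unique[OF trivial_limit_at_left_real] tendsto_unique[OF trivial_limit_at_right_real]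
    unfolding downward_jumps_def by blast+
  then show False
    using assms by simp
qed

lemma piecewise_linear_jump_sum:
  assumes "1 \<le> n" "\<And>i. i \<in> {1..n} \<Longrightarrow> \<beta> i \<noteq> 0 \<and> 1 \<le> \<xi> i" "strict_mono_on {1..n} \<xi>" "\<xi> 1 = 1"
  shows "piecewise_linear n (jump_sum n \<beta> \<xi>)"
proof -
  \<comment> \<open>As \<open>min x 1 = (x + 1 - \<bar>x - 1\<bar>) / 2\<close>, the only absolute
    value sits at \<open>\<xi> 1 = 1\<close>, with coefficient \<open>- (3/5)\<close>.\<close>
  define \<alpha> where "\<alpha> = (\<lambda>i::nat. if i = 1 then - (3/5) else 0 :: real)"
  have "(\<Sum>i=1..n. \<alpha> i * \<bar>x - \<xi> i\<bar>) = - (3/5) * \<bar>x - 1\<bar>" for x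
  proof -
    have "(\<Sum>i=1..n. \<alpha> i * \<bar>x - \<xi> i\<bar>) = (\<Sum>i=1..n. if i = 1 then - (3/5) * \<bar>x - \<xi> i\<bar> else 0)"
      by (intro sum.cong) (auto simp: \<alpha>_def)
    then show ?thesis
      using assms by simp
  qed
  moreover have "6/5 * min x 1 = 3/5 * x + 3/5 - 3/5 * \<bar>x - 1\<bar>" for x :: real
    by (auto simp: min_def)
  ultimately have "jump_sum n \<beta> \<xi> = (\<lambda>x. 3/5 * x + (3/5 + (\<Sum>i=1..n. \<beta> i)) + (\<Sum>i=1..n. \<alpha> i * \<bar>x - \<xi> i\<bar>)
      + (\<Sum>i=1..n. \<beta> i * sgn (x - \<xi> i)))"
    by (auto simp: jump_sum_def algebra_simps sum.distrib)
  moreover have "((\<alpha> i)\<^sup>2 + (\<beta> i)\<^sup>2) * \<xi> i \<noteq> 0" if "i \<in> {1..n}" for i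
    using assms(2)[OF that] by (auto simp: sum_power2_eq_zero_iff)
  ultimately show ?thesis
    unfolding piecewise_linear_def using assms(3) by blast
qed

section \<open>From the constructed orbits to limit cycles\<close>

lemma crossing_limit_cycleI:
  assumes "downward_jumps F L R" "\<And>x. \<not> fold_at F x" "isolated_crossing F L R X \<Gamma>"
  shows "crossing_limit_cycle F \<Gamma>"
proof -
  have sw: "switching_lines F = {(x, y). R x < L x}"
    using assms(2) by (auto simp: switching_lines_def downward_jumps_jump_iff[OF assms(1)])
  have cr: "crossing_set F = {(x, y). R x < L x \<and> (y < R x \<or> L x < y)}"
    using assms(2) by (auto simp: crossing_set_def downward_jumps_jump_iff[OF assms(1)] downward_jumps_lims[OF assms(1)])
  have per: "periodic_orbit F \<Gamma>" and off: "\<Gamma> \<subseteq> off_sliding L R X"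
    and meets: "\<exists>z\<in>\<Gamma>. R (fst z) < L (fst z)"
    and iso: "\<exists>U. open U \<and> \<Gamma> \<subseteq> U \<and> (\<forall>\<Gamma>'. periodic_orbit F \<Gamma>' \<and> \<Gamma>' \<noteq> \<Gamma> \<longrightarrow> \<not> \<Gamma>' \<subseteq> U)"
    using assms(3) unfolding isolated_crossing_def by blast+
  have "\<Gamma> \<inter> switching_lines F \<subseteq> crossing_set F"
    using off unfolding sw cr off_sliding_def by blast
  moreover have "\<Gamma> \<inter> switching_lines F \<noteq> {}"
    using meets unfolding sw by auto
  ultimately show ?thesis
    unfolding crossing_limit_cycle_def using per iso by simp
qed

lemma sliding_set_eq:
  assumes "downward_jumps F L R"
  shows "sliding_set F = {(x, y). R x < y \<and> y < L x}"
  using assms unfolding sliding_set_def downward_jumps_jump_iff[OF assms] downward_jumps_lims[OF assms]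
  by (auto simp: downward_jumps_def min_def max_def)

text \<open>Sliding moves upwards as \<open>x > 0\<close>, and forward uniqueness forces a periodic
  orbit to follow it. Hence all periodic orbits that slide on one line share the point
  \<open>(x, L x)\<close>.\<close>

lemma sliding_orbit_contains_exit:
  assumes adm: "downward_jumps F L R" and "0 < x" "periodic_orbit F \<Gamma>" "(x, y) \<in> \<Gamma>" "R x < y" "y \<le> y'" "y' \<le> L x"
  shows "(x, y') \<in> \<Gamma>"
proof -
  have RL: "R x \<le> L x" for x
    using adm by (simp add: downward_jumps_def)
  have "reach (jump_field L R) UNIV (x, y) (x, y')"
    using assms by (intro reach_slide RL) auto
  then show ?thesis
    using periodic_orbit_forward_invariant[OF _ assms(3,4)] one_sided_lipschitz_jump_field[OF adm]
    unfolding filippov_set_jump_field[OF adm] by blast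
qed

text \<open>At most one periodic orbit passes through the upper end of each of the finitely many
  sliding segments, so only finitely many slide. The others are compact and disjoint from \<Gamma>,
  and the complement of their union serves as neighbourhood.\<close>

lemma sliding_limit_cycleI:
  assumes adm: "downward_jumps F L R" and fin: "finite {x. R x < L x}" and pos: "\<And>x. R x < L x \<Longrightarrow> 0 < x"
    and \<Gamma>: "sliding_orbit F L R X \<Gamma>"
  shows "sliding_limit_cycle F \<Gamma>"
proof -
  have osl: "one_sided_lipschitz (filippov_set F) (6/5)"
    unfolding filippov_set_jump_field[OF adm] by (rule one_sided_lipschitz_jump_field[OF adm])
  have per: "periodic_orbit F \<Gamma>"
    using \<Gamma> by (simp add: sliding_orbit_def)
  obtain x y where xy: "(x, y) \<in> \<Gamma>" "R x < y" "y < L x"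
    using \<Gamma> by (auto simp: sliding_orbit_def)
  have "{x} \<times> {y<..<L x} \<subseteq> \<Gamma> \<inter> sliding_set F"
    using sliding_orbit_contains_exit[OF adm _ per xy(1,2)] pos[of x] xy
    by (auto simp: sliding_set_eq[OF adm])
  then have "{x} \<times> {y<..<L x} \<subseteq> sliding_part F \<Gamma>"
    unfolding sliding_part_def by blast
  moreover have "(x, (y + L x) / 2) \<in> {x} \<times> {y<..<L x}"
    using xy by simp
  ultimately have "slides F \<Gamma>"
    unfolding slides_def by blast
  define \<S> where "\<S> = {\<Gamma>'. periodic_orbit F \<Gamma>' \<and> slides F \<Gamma>'}"
  have "\<S> \<subseteq> (\<Union>x\<in>{x. R x < L x}. {\<Gamma>'. periodic_orbit F \<Gamma>' \<and> (x, L x) \<in> \<Gamma>'})"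
  proof
    fix \<Gamma>' assume "\<Gamma>' \<in> \<S>"
    then have per': "periodic_orbit F \<Gamma>'" and "sliding_part F \<Gamma>' \<noteq> {}"
      by (auto simp: \<S>_def slides_def)
    moreover have "sliding_part F \<Gamma>' \<subseteq> \<Gamma>' \<inter> sliding_set F"
      unfolding sliding_part_def by blast
    ultimately obtain x y where "(x, y) \<in> \<Gamma>' \<inter> sliding_set F"
      by (metis ex_in_conv prod.collapse subsetD)
    then have "(x, y) \<in> \<Gamma>'" "R x < y" "y < L x"
      by (auto simp: sliding_set_eq[OF adm])
    then show "\<Gamma>' \<in> (\<Union>x\<in>{x. R x < L x}. {\<Gamma>'. periodic_orbit F \<Gamma>' \<and> (x, L x) \<in> \<Gamma>'})"
      using sliding_orbit_contains_exit[OF adm _ per', of x y "L x"] pos[of x] per' by force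
  qed
  moreover have "finite {\<Gamma>'. periodic_orbit F \<Gamma>' \<and> p \<in> \<Gamma>'}" for p
  proof (cases "\<exists>\<Gamma>'. periodic_orbit F \<Gamma>' \<and> p \<in> \<Gamma>'")
    case True
    then obtain \<Gamma>' where "periodic_orbit F \<Gamma>'" "p \<in> \<Gamma>'" by blast
    then have "{\<Gamma>'. periodic_orbit F \<Gamma>' \<and> p \<in> \<Gamma>'} \<subseteq> {\<Gamma>'}"
      using periodic_orbits_eq[OF osl] by blast
    then show ?thesis
      by (rule finite_subset) simp
  next
    case False
    then have "{\<Gamma>'. periodic_orbit F \<Gamma>' \<and> p \<in> \<Gamma>'} = {}"
      by blast
    then show ?thesis
      by (simp only: finite.emptyI)
  qed
  ultimately have "finite \<S>"
    using fin by (auto intro: finite_subset)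
  define U where "U = - \<Union>(\<S> - {\<Gamma>})"
  have "closed (\<Union>(\<S> - {\<Gamma>}))"
    using \<open>finite \<S>\<close> by (intro closed_Union) (auto simp: \<S>_def intro: compact_imp_closed periodic_orbit_compact)
  then have "open U"
    by (simp add: U_def open_Compl)
  moreover have "\<Gamma> \<subseteq> U"
    unfolding U_def \<S>_def using periodic_orbits_eq[OF osl per] by blast
  moreover have "\<not> A \<subseteq> U - sliding_set F"
    if other: "periodic_orbit F \<Gamma>'" "slides F \<Gamma>'" "\<Gamma>' \<noteq> \<Gamma>" "orbit_arc F \<Gamma>' A" for \<Gamma>' A
  proof -
    have "A \<noteq> {}" "A \<subseteq> \<Gamma>'"
      using other(4) by (auto simp: orbit_arc_def)
    moreover have "\<Gamma>' \<inter> U = {}"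
      using other by (auto simp: U_def \<S>_def)
    ultimately show ?thesis
      by blast
  qed
  ultimately show ?thesis
    unfolding sliding_limit_cycle_def using per \<open>slides F \<Gamma>\<close> by blast
qed

theorem theorem3:
  fixes n :: nat
  assumes "n \<ge> 1"
  shows "\<exists>F :: real \<Rightarrow> real.
    piecewise_linear n F \<and> card (jump_points F) = n \<and> fold_points F = {} \<and>
    (\<exists>S. finite S \<and> card S \<ge> 2 * n \<and> (\<forall>\<Gamma>\<in>S. limit_cycle F \<Gamma>))"
proof -
  obtain \<beta> \<xi> L R X \<C> \<S> where t: "tower n \<beta> \<xi> L R X \<C> \<S>"
    using tower_exists by blast
  define F where "F = jump_sum n \<beta> \<xi>"
  obtain c D H m where "stage F L R X c D H m"
    using t unfolding tower_def F_def by blast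
  then have adm: "downward_jumps F L R"
    by (rule stage.adm)
  have \<xi>: "\<And>i. i \<in> {1..n} \<Longrightarrow> \<beta> i \<noteq> 0 \<and> 1 \<le> \<xi> i" "strict_mono_on {1..n} \<xi>" "\<xi> 1 = 1"
    and J: "{x. R x < L x} = \<xi> ` {1..n}"
    and \<C>: "finite \<C>" "card \<C> = n" "\<And>\<Gamma>. \<Gamma> \<in> \<C> \<Longrightarrow> isolated_crossing F L R X \<Gamma>"
    and \<S>: "finite \<S>" "card \<S> = n" "\<And>\<Gamma>. \<Gamma> \<in> \<S> \<Longrightarrow> sliding_orbit F L R X \<Gamma>"
    using t assms unfolding tower_def F_def by auto
  have no_fold: "\<not> fold_at F x" for x
  proof (cases "R x < L x")
    case True
    then show ?thesis
      by (rule not_fold_of_jump[OF adm])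
  next
    case False
    then have "x \<notin> \<xi> ` {1..n}"
      unfolding J[symmetric] by simp
    then have "x \<noteq> 1" "\<And>i. i \<in> {1..n} \<Longrightarrow> x \<noteq> \<xi> i"
      using \<xi>(3) assms by force+
    then show ?thesis
      unfolding F_def by (metis jump_sum_differentiable not_fold_of_derivative)
  qed
  have "jump_points F = (\<lambda>x. (x, F x)) ` \<xi> ` {1..n}"
    unfolding jump_points_def downward_jumps_jump_iff[OF adm] J[symmetric] by auto
  moreover have "card ((\<lambda>x. (x, F x)) ` \<xi> ` {1..n}) = n"
  proof -
    have "card ((\<lambda>x. (x, F x)) ` \<xi> ` {1..n}) = card (\<xi> ` {1..n})"
      by (intro card_image inj_onI) simp
    also have "\<dots> = card {1..n}"
      by (intro card_image strict_mono_on_imp_inj_on \<xi>(2))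
    finally show ?thesis
      by simp
  qed
  moreover have "fold_points F = {}"
    using no_fold by (simp add: fold_points_def)
  \<comment> \<open>A sliding orbit has a point strictly between the one-sided limits, which a
    crossing orbit avoids.\<close>
  moreover have "\<C> \<inter> \<S> = {}"
  proof (rule ccontr)
    assume "\<C> \<inter> \<S> \<noteq> {}"
    then obtain \<Gamma> where "isolated_crossing F L R X \<Gamma>" "sliding_orbit F L R X \<Gamma>"
      using \<C>(3) \<S>(3) by blast
    then show False
      by (fastforce simp: isolated_crossing_def sliding_orbit_def off_sliding_def)
  qed
  then have "card (\<C> \<union> \<S>) = 2 * n"
    using \<C> \<S> by (simp add: card_Un_disjoint)
  moreover have "limit_cycle F \<Gamma>" if "\<Gamma> \<in> \<C> \<union> \<S>" for \<Gamma>
    using that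
  proof
    assume "\<Gamma> \<in> \<C>"
    then show ?thesis
      using crossing_limit_cycleI[OF adm no_fold \<C>(3)] by (simp add: limit_cycle_def)
  next
    assume "\<Gamma> \<in> \<S>"
    moreover have "finite {x. R x < L x}" "\<And>x. R x < L x \<Longrightarrow> 0 < x"
      using J \<xi>(1) by force+
    ultimately show ?thesis
      using sliding_limit_cycleI[OF adm _ _ \<S>(3)] by (simp add: limit_cycle_def)
  qed
  moreover have "piecewise_linear n F"
    unfolding F_def using piecewise_linear_jump_sum[OF assms \<xi>] .
  ultimately show ?thesis
    using \<C>(1) \<S>(1) by (intro exI[of _ F] conjI exI[of _ "\<C> \<union> \<S>"]) simp_all
qed

end
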